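(* Let $\mathbf A=(\theta,w,x)$ be a Q-system in $\mathcal C\subset\mathrm{End}_0(N)$, defining $\iota:N\to M$ (with generator $v$) of dimension $\dim(\iota)=d_{\mathbf A}$. Let $P\in\mathrm{Hom}(\theta,\theta)$ be a projection satisfying $$(P\times P)x=(P\times1_\theta)xP=(1_\theta\times P)xP\qquad\text{and}\qquad Pw=w.$$ Let $S\in N$ be an isometry with $SS^*=P$, $\theta_P=S^*\theta(\cdot)S$ and $n_P=S^*x^*(P\times P)xS\in\mathrm{Hom}(\theta_P,\theta_P)$. Then $$w_P=\dim(\theta_P)^{-1/4}\,n_P^{1/2}S^*w,\qquad x_P=\dim(\theta_P)^{1/4}\,(n_P^{-1/2}S^*\times n_P^{-1/2}S^* )\,x\,S\,n_P^{1/2}$$ defines a Q-system $\mathbf A_P=(\theta_P,w_P,x_P)$. It corresponds to the intermediate von Neumann algebra $\iota(N)\subset L_P\subset M$ given by $$L_P:=\iota(NP)\,v .$$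
   Context: $N$ is an infinite (type III) von Neumann factor on a separable Hilbert space. For homomorphisms (unital $*$-homomorphisms) $\alpha,\beta:N\to M$, $\mathrm{Hom}(\alpha,\beta)=\{t\in M:t\alpha(n)=\beta(n)t\ \forall n\}$. For $t_i\in\mathrm{Hom}(\alpha_i,\beta_i)$ put $t_1\times t_2=t_1\alpha_1(t_2)\in\mathrm{Hom}(\alpha_1\alpha_2,\beta_1\beta_2)$; thus $1_\alpha\times t=\alpha(t)$, $t\times1_\alpha=t$. $\alpha:N\to M$, $\bar\alpha:M\to N$ are conjugate if there are $w\in\mathrm{Hom}(\mathrm{id}_N,\bar\alpha\alpha)$, $\bar w\in\mathrm{Hom}(\mathrm{id}_M,\alpha\bar\alpha)$ with $w^*\bar\alpha(\bar w)=1$, $\alpha(w^* )\bar w=1$; $\dim\alpha$ is the infimum of $d$ over such pairs with $w^*w=d1_N$, $\bar w^*\bar w=d1_M$. $\mathrm{End}_0(N)$ is the C* tensor category of endomorphisms of finite dimension; $\mathcal C\subset\mathrm{End}_0(N)$ is a full tensor subcategory closed under direct sums, subobjects and conjugates. A Q-system is a triple $\mathbf A=(\theta,w,x)$ with $\theta\in\mathcal C$, $w\in\mathrm{Hom}(\mathrm{id},\theta)$, $x\in\mathrm{Hom}(\theta,\theta^2)$ satisfying $(w^*\times1_\theta)x=(1_\theta\times w^* )x=1_\theta$; $(x\times1_\theta)x=(1_\theta\times x)x$; $(1_\theta\times x^* )(x\times1_\theta)=xx^*=(x^*\times1_\theta)(1_\theta\times x)$; $w^*w=d_{\mathbf A}1$,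 $x^*x=d_{\mathbf A}1_\theta$, $d_{\mathbf A}=\sqrt{\dim\theta}$. Its extension $\iota:N\to M$ is the von Neumann algebra $M=\iota(N)v$ (each element uniquely $\iota(n)v$) with $v\iota(n)=\iota(\theta(n))v$, $v^2=\iota(x)v$, $v^*=\iota(w^*x^* )v$, $1_M=\iota(w^* )v$, and conjugate $\bar\iota(\iota(n)v)=\theta(n)x$. "Corresponds to" means: the extension of $N$ defined by $\mathbf A_P$ is isomorphic, over $N$, to $\iota:N\to L_P$. *)

theory Defs
  imports "HOL-Analysis.Analysis"
begin

class scaleC =
  fixes scaleC :: "complex \<Rightarrow> 'a \<Rightarrow> 'a" (infixr \<open>*\<^sub>C\<close> 75)

text \<open>The inner product is conjugate linear in its first and linear in its second argument.
  Its real part is the inner product of the underlying real Hilbert space, which carries norm,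
  topology and completeness. The zero space is allowed.\<close>

class chilbert_space = banach + real_inner + scaleC +
  fixes cinner :: "'a \<Rightarrow> 'a \<Rightarrow> complex"
  assumes scaleC_add_right: "c *\<^sub>C (x + y) = c *\<^sub>C x + c *\<^sub>C y"
    and scaleC_add_left: "(c + d) *\<^sub>C x = c *\<^sub>C x + d *\<^sub>C x"
    and scaleC_scaleC: "c *\<^sub>C (d *\<^sub>C x) = (c * d) *\<^sub>C x"
    and scaleR_scaleC: "r *\<^sub>R x = complex_of_real r *\<^sub>C x"
    and cinner_commute: "cinner x y = cnj (cinner y x)"
    and cinner_add_right: "cinner x (y + z) = cinner x y + cinner x z"
    and cinner_scaleC_right: "cinner x (c *\<^sub>C y) = c * cinner x y"
    and Re_cinner: "Re (cinner x y) = inner x y"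

lemma scaleC_one: "1 *\<^sub>C x = (x :: 'a::chilbert_space)"
  by (metis of_real_1 scaleR_one scaleR_scaleC)

lemma norm_scaleC: "norm (c *\<^sub>C x) = cmod c * norm (x :: 'a::chilbert_space)"
proof -
  have "cinner (c *\<^sub>C x) (c *\<^sub>C x) = c * cnj c * cinner x x"
    by (metis cinner_commute cinner_scaleC_right complex_cnj_mult mult.assoc)
  also have "\<dots> = complex_of_real ((cmod c)\<^sup>2) * cinner x x"
    by (simp only: complex_norm_square)
  finally have "Re (cinner (c *\<^sub>C x) (c *\<^sub>C x)) = (cmod c)\<^sup>2 * Re (cinner x x)"
    by simp
  then show ?thesis
    by (simp add: Re_cinner norm_eq_sqrt_inner real_sqrt_mult)
qed

lemma scaleC_zero_right: "c *\<^sub>C (0 :: 'a::chilbert_space) = 0"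
  by (metis mult_zero_right norm_eq_zero norm_scaleC)

lemma scaleC_minus_right: "c *\<^sub>C (- x) = - (c *\<^sub>C (x :: 'a::chilbert_space))"
  by (metis ab_left_minus neg_eq_iff_add_eq_0 scaleC_add_right scaleC_zero_right add.commute)

lemma bounded_linear_scaleC: "bounded_linear (\<lambda>x :: 'a::chilbert_space. c *\<^sub>C x)"
proof (rule bounded_linear_intro[where K = "cmod c"])
  show "c *\<^sub>C (r *\<^sub>R x) = r *\<^sub>R (c *\<^sub>C x)" for r and x :: 'a
    by (simp add: scaleR_scaleC scaleC_scaleC mult.commute)
qed (simp_all add: scaleC_add_right norm_scaleC mult.commute)

typedef (overloaded) 'h bop =
  "{T :: 'h::chilbert_space \<Rightarrow>\<^sub>L 'h. \<forall>c x. blinfun_apply T (c *\<^sub>C x) = c *\<^sub>C blinfun_apply T x}"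
  morphisms blinfun_of_bop Bop
proof
  show "id_blinfun \<in> {T :: 'h \<Rightarrow>\<^sub>L 'h. \<forall>c x. blinfun_apply T (c *\<^sub>C x) = c *\<^sub>C blinfun_apply T x}"
    by simp
qed

setup_lifting type_definition_bop

lift_definition bop_apply :: "'h::chilbert_space bop \<Rightarrow> 'h \<Rightarrow> 'h" (infixr \<open>\<cdot>\<close> 90)
  is blinfun_apply .

lemma bop_apply_scaleC: "T \<cdot> (c *\<^sub>C x) = c *\<^sub>C (T \<cdot> x)"
  by transfer simp

lemma bop_eqI: "(\<And>x. S \<cdot> x = T \<cdot> x) \<Longrightarrow> S = T"
  by transfer (auto intro: blinfun_eqI)

instantiation bop :: (chilbert_space) "{ring, monoid_mult, scaleC}"
begin

lift_definition zero_bop :: "'a bop" is "0 :: 'a \<Rightarrow>\<^sub>L 'a"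
  by (simp add: scaleC_zero_right)

lift_definition one_bop :: "'a bop" is id_blinfun
  by simp

lift_definition plus_bop :: "'a bop \<Rightarrow> 'a bop \<Rightarrow> 'a bop" is "(+)"
  by (simp add: blinfun.add_left scaleC_add_right)

lift_definition uminus_bop :: "'a bop \<Rightarrow> 'a bop" is uminus
  by (simp add: blinfun.minus_left scaleC_minus_right)

definition minus_bop :: "'a bop \<Rightarrow> 'a bop \<Rightarrow> 'a bop" where
  "minus_bop S T = S + (- T)"

lift_definition times_bop :: "'a bop \<Rightarrow> 'a bop \<Rightarrow> 'a bop" is "(o\<^sub>L)"
  by simp

lift_definition scaleC_bop :: "complex \<Rightarrow> 'a bop \<Rightarrow> 'a bop"
  is "\<lambda>c T. Blinfun (\<lambda>x. c *\<^sub>C blinfun_apply T x)"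
  by (simp add: bounded_linear_Blinfun_apply bounded_linear_compose[OF bounded_linear_scaleC]
      blinfun.bounded_linear_right scaleC_scaleC mult.commute)

instance
proof
  fix a b c :: "'a bop"
  show "a * b * c = a * (b * c)" by transfer (simp add: blinfun_eqI)
  show "1 * a = a" by transfer (simp add: blinfun_eqI)
  show "a * 1 = a" by transfer (simp add: blinfun_eqI)
  show "a + b + c = a + (b + c)" by transfer (simp add: add.assoc)
  show "a + b = b + a" by transfer (simp add: add.commute)
  show "0 + a = a" by transfer simp
  show "- a + a = 0" by transfer simp
  show "a - b = a + - b" by (simp add: minus_bop_def)
  show "(a + b) * c = a * c + b * c"
    by transfer (auto intro!: blinfun_eqI simp: blinfun.add_left)
  show "a * (b + c) = a * b + a * c"
    by transfer (auto intro!: blinfun_eqI simp: blinfun.add_left blinfun.add_right)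
qed

end

lemma bop_apply_one: "1 \<cdot> x = x"
  by transfer simp

lemma bop_apply_times: "(S * T) \<cdot> x = S \<cdot> (T \<cdot> x)"
  by transfer simp

lemma bop_apply_plus: "(S + T) \<cdot> x = S \<cdot> x + T \<cdot> x"
  by transfer (simp add: blinfun.add_left)

lemma bop_apply_scaleC_left: "(c *\<^sub>C T) \<cdot> x = c *\<^sub>C (T \<cdot> x)"
  by transfer (simp add: bounded_linear_Blinfun_apply
      bounded_linear_compose[OF bounded_linear_scaleC] blinfun.bounded_linear_right)

definition adj :: "'h::chilbert_space bop \<Rightarrow> 'h bop" (\<open>_\<^sup>\<dagger>\<close> [1000] 999) where
  "T\<^sup>\<dagger> = (THE S. \<forall>x y. cinner (S \<cdot> x) y = cinner x (T \<cdot> y))"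

definition positive_bop :: "'h::chilbert_space bop \<Rightarrow> bool" where
  "positive_bop T \<longleftrightarrow> (\<forall>x. Im (cinner x (T \<cdot> x)) = 0 \<and> 0 \<le> Re (cinner x (T \<cdot> x)))"

definition sqrt_bop :: "'h::chilbert_space bop \<Rightarrow> 'h bop" where
  "sqrt_bop T = (THE R. positive_bop R \<and> R * R = T)"

definition invertible_bop :: "'h::chilbert_space bop \<Rightarrow> bool" where
  "invertible_bop T \<longleftrightarrow> (\<exists>R. R * T = 1 \<and> T * R = 1)"

definition inv_bop :: "'h::chilbert_space bop \<Rightarrow> 'h bop" where
  "inv_bop T = (THE R. R * T = 1 \<and> T * R = 1)"

definition projection :: "'h::chilbert_space bop \<Rightarrow> bool" where
  "projection p \<longleftrightarrow> p * p = p \<and> p\<^sup>\<dagger> = p"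

definition isometry :: "'h::chilbert_space bop \<Rightarrow> bool" where
  "isometry S \<longleftrightarrow> S\<^sup>\<dagger> * S = 1"

definition commutant :: "'h::chilbert_space bop set \<Rightarrow> 'h bop set" where
  "commutant A = {T. \<forall>a\<in>A. T * a = a * T}"

definition von_neumann_algebra :: "'h::chilbert_space bop set \<Rightarrow> bool" where
  "von_neumann_algebra A \<longleftrightarrow> (\<forall>a\<in>A. a\<^sup>\<dagger> \<in> A) \<and> commutant (commutant A) = A"

definition factor :: "'h::chilbert_space bop set \<Rightarrow> bool" where
  "factor A \<longleftrightarrow> von_neumann_algebra A \<and> (1::'h bop) \<noteq> 0 \<and>
     A \<inter> commutant A = range (\<lambda>c. c *\<^sub>C 1)"

text \<open>Type III: every nonzero projection of the factor is infinite, i.e. Murray-von Neumann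
  equivalent, by a partial isometry \<open>u\<close> of the algebra, to a proper subprojection of itself.\<close>

definition type_III_factor :: "'h::chilbert_space bop set \<Rightarrow> bool" where
  "type_III_factor A \<longleftrightarrow> factor A \<and>
     (\<forall>p\<in>A. projection p \<and> p \<noteq> 0 \<longrightarrow>
        (\<exists>u\<in>A. u\<^sup>\<dagger> * u = p \<and> projection (u * u\<^sup>\<dagger>) \<and> p * (u * u\<^sup>\<dagger>) = u * u\<^sup>\<dagger> \<and> u * u\<^sup>\<dagger> \<noteq> p))"

text \<open>A homomorphism is represented by a function on all of \<open>B(H)\<close>, of which only the restriction
  to \<open>A\<close> is relevant; none of the notions below depends on its values outside \<open>A\<close>.\<close>

definition star_hom ::
  "'h::chilbert_space bop set \<Rightarrow> 'k::chilbert_space bop set \<Rightarrow> ('h bop \<Rightarrow> 'k bop) \<Rightarrow> bool" where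
  "star_hom A B \<alpha> \<longleftrightarrow>
     (\<forall>a\<in>A. \<alpha> a \<in> B) \<and>
     (\<forall>a\<in>A. \<forall>b\<in>A. \<alpha> (a + b) = \<alpha> a + \<alpha> b) \<and>
     (\<forall>c. \<forall>a\<in>A. \<alpha> (c *\<^sub>C a) = c *\<^sub>C \<alpha> a) \<and>
     (\<forall>a\<in>A. \<forall>b\<in>A. \<alpha> (a * b) = \<alpha> a * \<alpha> b) \<and>
     (\<forall>a\<in>A. \<alpha> (a\<^sup>\<dagger>) = (\<alpha> a)\<^sup>\<dagger>) \<and>
     \<alpha> 1 = 1"

definition Hom ::
  "'h::chilbert_space bop set \<Rightarrow> 'k::chilbert_space bop set \<Rightarrow>
   ('h bop \<Rightarrow> 'k bop) \<Rightarrow> ('h bop \<Rightarrow> 'k bop) \<Rightarrow> 'k bop set" where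
  "Hom A B \<alpha> \<beta> = {t\<in>B. \<forall>a\<in>A. t * \<alpha> a = \<beta> a * t}"

text \<open>Monoidal product of intertwiners. It depends on the source \<open>\<alpha>\<close> of the left factor, which
  cannot be read off from the operator \<open>s\<close> and is therefore an explicit argument. The unit
  \<open>1\<^sub>\<alpha>\<close> is the operator \<open>1\<close> with source \<open>\<alpha>\<close>.\<close>

definition mtimes ::
  "'k::chilbert_space bop \<Rightarrow> ('h::chilbert_space bop \<Rightarrow> 'k bop) \<Rightarrow> 'h bop \<Rightarrow> 'k bop"
  (\<open>_ \<times>\<^bsub>_\<^esub> _\<close> [76, 0, 76] 75) where
  "s \<times>\<^bsub>\<alpha>\<^esub> t = s * \<alpha> t"

definition conjugate_solution ::
  "'h::chilbert_space bop set \<Rightarrow> 'k::chilbert_space bop set \<Rightarrow> ('h bop \<Rightarrow> 'k bop) \<Rightarrow>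
   ('k bop \<Rightarrow> 'h bop) \<Rightarrow> 'h bop \<Rightarrow> 'k bop \<Rightarrow> bool" where
  "conjugate_solution N M \<alpha> \<alpha>' w w' \<longleftrightarrow>
     w \<in> Hom N N id (\<alpha>' \<circ> \<alpha>) \<and> w' \<in> Hom M M id (\<alpha> \<circ> \<alpha>') \<and>
     w\<^sup>\<dagger> * \<alpha>' w' = 1 \<and> \<alpha> (w\<^sup>\<dagger>) * w' = 1"

definition conjugate ::
  "'h::chilbert_space bop set \<Rightarrow> 'k::chilbert_space bop set \<Rightarrow> ('h bop \<Rightarrow> 'k bop) \<Rightarrow>
   ('k bop \<Rightarrow> 'h bop) \<Rightarrow> bool" where
  "conjugate N M \<alpha> \<alpha>' \<longleftrightarrow>
     star_hom N M \<alpha> \<and> star_hom M N \<alpha>' \<and> (\<exists>w w'. conjugate_solution N M \<alpha> \<alpha>' w w')"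

text \<open>The infimum runs over all conjugates of \<open>\<alpha>\<close>, which are unitarily equivalent to each other.
  The dimension is finite iff \<open>conjugate_dims\<close> is nonempty; otherwise \<open>hom_dim\<close> is a junk value.\<close>

definition conjugate_dims ::
  "'h::chilbert_space bop set \<Rightarrow> 'k::chilbert_space bop set \<Rightarrow> ('h bop \<Rightarrow> 'k bop) \<Rightarrow> real set" where
  "conjugate_dims N M \<alpha> = {d. \<exists>\<alpha>' w w'. star_hom M N \<alpha>' \<and> conjugate_solution N M \<alpha> \<alpha>' w w' \<and>
      w\<^sup>\<dagger> * w = complex_of_real d *\<^sub>C 1 \<and> w'\<^sup>\<dagger> * w' = complex_of_real d *\<^sub>C 1}"

definition hom_dim ::
  "'h::chilbert_space bop set \<Rightarrow> 'k::chilbert_space bop set \<Rightarrow> ('h bop \<Rightarrow> 'k bop) \<Rightarrow> real" where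
  "hom_dim N M \<alpha> = Inf (conjugate_dims N M \<alpha>)"

definition End0 :: "'h::chilbert_space bop set \<Rightarrow> ('h bop \<Rightarrow> 'h bop) set" where
  "End0 N = {\<alpha>. star_hom N N \<alpha> \<and> conjugate_dims N N \<alpha> \<noteq> {}}"

text \<open>A full subcategory is given by its objects.\<close>

definition full_tensor_subcategory ::
  "'h::chilbert_space bop set \<Rightarrow> ('h bop \<Rightarrow> 'h bop) set \<Rightarrow> bool" where
  "full_tensor_subcategory N C \<longleftrightarrow>
     C \<subseteq> End0 N \<and> id \<in> C \<and> (\<forall>\<alpha>\<in>C. \<forall>\<beta>\<in>C. \<alpha> \<circ> \<beta> \<in> C) \<and>
     (\<forall>\<alpha>\<in>C. \<forall>\<beta>\<in>C. \<forall>\<gamma>. star_hom N N \<gamma> \<and>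
        (\<exists>s\<in>Hom N N \<alpha> \<gamma>. \<exists>t\<in>Hom N N \<beta> \<gamma>.
           isometry s \<and> isometry t \<and> s * s\<^sup>\<dagger> + t * t\<^sup>\<dagger> = 1) \<longrightarrow> \<gamma> \<in> C) \<and>
     (\<forall>\<alpha>\<in>C. \<forall>\<beta>. star_hom N N \<beta> \<and> (\<exists>s\<in>Hom N N \<beta> \<alpha>. isometry s) \<longrightarrow> \<beta> \<in> C) \<and>
     (\<forall>\<alpha>\<in>C. \<forall>\<beta>. conjugate N N \<alpha> \<beta> \<longrightarrow> \<beta> \<in> C)"

definition Q_dim :: "'h::chilbert_space bop set \<Rightarrow> ('h bop \<Rightarrow> 'h bop) \<Rightarrow> real" where
  "Q_dim N \<theta> = sqrt (hom_dim N N \<theta>)"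

definition Q_system ::
  "'h::chilbert_space bop set \<Rightarrow> ('h bop \<Rightarrow> 'h bop) set \<Rightarrow>
   ('h bop \<Rightarrow> 'h bop) \<Rightarrow> 'h bop \<Rightarrow> 'h bop \<Rightarrow> bool" where
  "Q_system N C \<theta> w x \<longleftrightarrow>
     \<theta> \<in> C \<and> w \<in> Hom N N id \<theta> \<and> x \<in> Hom N N \<theta> (\<theta> \<circ> \<theta>) \<and>
     (w\<^sup>\<dagger> \<times>\<^bsub>\<theta>\<^esub> 1) * x = 1 \<and> (1 \<times>\<^bsub>\<theta>\<^esub> w\<^sup>\<dagger>) * x = 1 \<and>
     (x \<times>\<^bsub>\<theta>\<^esub> 1) * x = (1 \<times>\<^bsub>\<theta>\<^esub> x) * x \<and>
     (1 \<times>\<^bsub>\<theta>\<^esub> x\<^sup>\<dagger>) * (x \<times>\<^bsub>\<theta>\<^esub> 1) = x * x\<^sup>\<dagger> \<and>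
     x * x\<^sup>\<dagger> = (x\<^sup>\<dagger> \<times>\<^bsub>\<theta> \<circ> \<theta>\<^esub> 1) * (1 \<times>\<^bsub>\<theta>\<^esub> x) \<and>
     w\<^sup>\<dagger> * w = complex_of_real (Q_dim N \<theta>) *\<^sub>C 1 \<and>
     x\<^sup>\<dagger> * x = complex_of_real (Q_dim N \<theta>) *\<^sub>C 1"

text \<open>\<open>\<iota> : N \<rightarrow> M\<close> with generator \<open>v\<close> is an extension of \<open>N\<close> defined by \<open>(\<theta>, w, x)\<close>; these relations
  determine it up to isomorphism over \<open>N\<close>.\<close>

definition extension ::
  "'h::chilbert_space bop set \<Rightarrow> ('h bop \<Rightarrow> 'h bop) \<Rightarrow> 'h bop \<Rightarrow> 'h bop \<Rightarrow>
   'k::chilbert_space bop set \<Rightarrow> ('h bop \<Rightarrow> 'k bop) \<Rightarrow> 'k bop \<Rightarrow> bool" where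
  "extension N \<theta> w x M \<iota> v \<longleftrightarrow>
     von_neumann_algebra M \<and> star_hom N M \<iota> \<and> v \<in> M \<and>
     (\<forall>m\<in>M. \<exists>!n. n \<in> N \<and> m = \<iota> n * v) \<and>
     (\<forall>n\<in>N. v * \<iota> n = \<iota> (\<theta> n) * v) \<and>
     v * v = \<iota> x * v \<and>
     v\<^sup>\<dagger> = \<iota> (w\<^sup>\<dagger> * x\<^sup>\<dagger>) * v \<and>
     1 = \<iota> (w\<^sup>\<dagger>) * v"

definition isomorphic_over ::
  "'h::chilbert_space bop set \<Rightarrow> ('h bop \<Rightarrow> 'k::chilbert_space bop) \<Rightarrow> 'k bop set \<Rightarrow>
   ('h bop \<Rightarrow> 'l::chilbert_space bop) \<Rightarrow> 'l bop set \<Rightarrow> bool" where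
  "isomorphic_over N \<iota> M \<kappa> L \<longleftrightarrow>
     (\<exists>\<phi>. star_hom M L \<phi> \<and> bij_betw \<phi> M L \<and> (\<forall>n\<in>N. \<phi> (\<iota> n) = \<kappa> n))"

end

theory Submission
  imports Defs
begin

text \<open>Put \<open>W = S\<^sup>\<dagger> * w\<close> and \<open>X = S\<^sup>\<dagger> * \<theta> (S\<^sup>\<dagger>) * x * S\<close>. The conditions on \<open>P\<close> make \<open>(\<theta>\<^sub>P, W, X)\<close> a
  C*-Frobenius algebra, except that \<open>W\<close> and \<open>X\<close> need not be multiples of isometries. In every such
  algebra \<open>n = X\<^sup>\<dagger> * X\<close> satisfies \<open>X * n = n * X = \<theta>\<^sub>P n * X\<close>, because \<open>X * n = (X * X\<^sup>\<dagger>) * X\<close> may be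
  rewritten by both forms of the Frobenius law; hence conjugation by \<open>n\<^sup>1\<^sup>/\<^sup>2\<close> normalises \<open>X\<close>.
  The scalar \<open>r\<^sup>\<dagger> * r\<close>, with \<open>r = X * W\<close>, is the dimension of \<open>\<theta>\<^sub>P\<close> as soon as the left and right traces
  defined by \<open>r\<close> agree. For \<open>\<theta>\<close> they agree because \<open>x * w\<close> attains the minimum defining the dimension,
  and agreement passes to the compression by \<open>P\<close>.

  The products in \<open>M\<close> of elements \<open>\<iota> (a * P) * v\<close> show that \<open>L\<^sub>P\<close> is a *-algebra generated by
  \<open>\<iota> (S\<^sup>\<dagger>) * v\<close>. That it equals its bicommutant follows from the finite index of the inclusion, by
  means of the canonical endomorphism of \<open>M\<close>, the separability of the underlying space of \<open>N\<close> and a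
  noncommutative Egorov theorem.\<close>

text \<open>The obstacle is that an extension is given by algebraic relations.
  \<open>\<iota>\<close> and the canonical endomorphism are known only as *-homomorphisms, so the
  continuity at hand is norm contractivity. An element \<open>D\<close> of the bicommutant of
  \<open>L\<^sub>P\<close> is approximated by elements \<open>a\<^sub>n\<close> of
  \<open>L\<^sub>P\<close> merely on vectors, and such convergence need not be visible after
  applying the endomorphism. The Egorov operator \<open>q\<close> repairs this:
  \<open>a\<^sub>n * q\<close> converges in norm, and \<open>q\<close> is injective, so it can be
  cancelled at the end. Building \<open>q\<close> takes a countable family of vectors that separates
  \<open>M\<close>, although \<open>M\<close> may act on a nonseparable space; countability is
  imported from the space of \<open>N\<close> through the faithful conjugate homomorphism of
  \<open>\<iota>\<close>.

  The dimension is an infimum over all conjugates, so two implications are needed: for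
  \<open>\<theta>\<close>, minimality gives equality of traces by a first variation; for the
  compression, equality of traces gives minimality by a Cauchy-Schwarz estimate against an arbitrary
  solution of the conjugate equations.\<close>

section \<open>Projection theorem and Riesz representation over the reals\<close>

lemma orthogonal_projection_exists:
  fixes V :: "'a::{real_inner,banach} set"
  assumes "subspace V" and "closed V"
  shows "\<exists>p\<in>V. \<forall>v\<in>V. inner (x - p) v = 0"
proof -
  define d where "d = (INF v\<in>V. norm (x - v))"
  have V0: "0 \<in> V" using assms(1) by (rule subspace_0)
  have bdd: "bdd_below ((\<lambda>v. norm (x - v)) ` V)" by (auto intro: bdd_belowI2[where m=0])
  have dle: "d \<le> norm (x - v)" if "v \<in> V" for v
    unfolding d_def using bdd that by (rule cINF_lower)
  have d0: "0 \<le> d" unfolding d_def using V0 by (intro cINF_greatest) auto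
  have "\<exists>v\<in>V. norm (x - v) < d + inverse (Suc n)" for n
    using V0 bdd cINF_less_iff[of V "\<lambda>v. norm (x - v)" "d + inverse (Suc n)"]
    unfolding d_def by auto
  then obtain f where fV: "\<And>n. f n \<in> V" and f: "\<And>n. norm (x - f n) < d + inverse (Suc n)"
    by metis
  \<comment> \<open>The midpoint of \<open>a\<close> and \<open>b\<close> lies in \<open>V\<close>
    and so has distance at least \<open>d\<close> from \<open>x\<close>. With this, the
    parallelogram law makes every minimising sequence Cauchy.\<close>
  have par: "(norm (a - b))\<^sup>2 \<le> 2 * (norm (x - a))\<^sup>2 + 2 * (norm (x - b))\<^sup>2 - 4 * d\<^sup>2"
    if "a \<in> V" "b \<in> V" for a b
  proof -
    have "(1/2) *\<^sub>R (a + b) \<in> V" using assms(1) that by (simp add: subspace_add subspace_mul)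
    then have "d\<^sup>2 \<le> (norm (x - (1/2) *\<^sub>R (a + b)))\<^sup>2"
      using dle d0 by (simp add: power_mono)
    moreover have "(norm (a - b))\<^sup>2 + 4 * (norm (x - (1/2) *\<^sub>R (a + b)))\<^sup>2 =
        2 * (norm (x - a))\<^sup>2 + 2 * (norm (x - b))\<^sup>2"
      by (simp add: power2_norm_eq_inner inner_diff_left inner_diff_right inner_add_left
          inner_add_right inner_commute algebra_simps)
    ultimately show ?thesis by linarith
  qed
  have bound: "(norm (f m - f n))\<^sup>2 \<le> (8 * d + 4) * inverse (Suc N)" if "N \<le> m" "N \<le> n" for m n N
  proof -
    have *: "2 * (norm (x - f k))\<^sup>2 \<le> 2 * d\<^sup>2 + (4 * d + 2) * inverse (Suc N)" if "N \<le> k" for k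
    proof -
      let ?e = "inverse (real (Suc N))"
      have e: "0 \<le> ?e" "?e \<le> 1" by (auto simp: inverse_eq_divide)
      have "inverse (real (Suc k)) \<le> ?e" using that by (simp add: le_imp_inverse_le)
      then have "norm (x - f k) \<le> d + ?e" using f[of k] by linarith
      then have "(norm (x - f k))\<^sup>2 \<le> (d + ?e)\<^sup>2" by (simp add: power_mono)
      also have "\<dots> = d\<^sup>2 + 2 * d * ?e + ?e * ?e" by (simp add: power2_eq_square algebra_simps)
      also have "\<dots> \<le> d\<^sup>2 + 2 * d * ?e + ?e" using mult_left_le[OF e(2,1)] by linarith
      finally show ?thesis by (simp add: algebra_simps)
    qed
    show ?thesis using par[OF fV fV, of m n] *[OF that(1)] *[OF that(2)] by (simp add: algebra_simps)
  qed
  have "Cauchy f"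
  proof (rule metric_CauchyI)
    fix e :: real assume "e > 0"
    then have "0 < e\<^sup>2 / (8 * d + 4)" using d0 by auto
    then obtain N where N: "inverse (real (Suc N)) < e\<^sup>2 / (8 * d + 4)"
      using reals_Archimedean by blast
    have "dist (f m) (f n) < e" if "N \<le> m" "N \<le> n" for m n
    proof -
      have "(8 * d + 4) * inverse (Suc N) < e\<^sup>2"
        using N d0 by (simp add: pos_less_divide_eq mult.commute)
      then have "(norm (f m - f n))\<^sup>2 < e\<^sup>2" using bound[OF that] by linarith
      then show ?thesis using \<open>e > 0\<close> by (simp add: dist_norm power2_less_imp_less)
    qed
    then show "\<exists>M. \<forall>m\<ge>M. \<forall>n\<ge>M. dist (f m) (f n) < e" by blast
  qed
  then obtain p where p: "f \<longlonglongrightarrow> p" using Cauchy_convergent convergent_def by blast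
  have pV: "p \<in> V" using closed_sequentially[OF assms(2)] fV p by blast
  have "norm (x - p) \<le> d"
  proof (rule LIMSEQ_le)
    show "(\<lambda>n. norm (x - f n)) \<longlonglongrightarrow> norm (x - p)" using p by (intro tendsto_intros)
    show "(\<lambda>n. d + inverse (real (Suc n))) \<longlonglongrightarrow> d"
      using LIMSEQ_inverse_real_of_nat_add by auto
    show "\<exists>N. \<forall>n\<ge>N. norm (x - f n) \<le> d + inverse (real (Suc n))" using f less_imp_le by blast
  qed
  then have np: "norm (x - p) = d" using dle[OF pV] by linarith
  have "inner (x - p) v = 0" if v: "v \<in> V" for v
  proof (rule ccontr)
    assume nz: "inner (x - p) v \<noteq> 0"
    then have vn: "(norm v)\<^sup>2 > 0" by auto
    \<comment> \<open>The minimiser of the quadratic function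
      \<open>t \<mapsto> (norm (x - p - t *\<^sub>R v))\<^sup>2\<close>. Its value there would be
      below \<open>d\<^sup>2\<close>.\<close>
    define t where "t = inner (x - p) v / (norm v)\<^sup>2"
    have "p + t *\<^sub>R v \<in> V" using assms(1) pV v by (simp add: subspace_add subspace_mul)
    then have "d\<^sup>2 \<le> (norm (x - (p + t *\<^sub>R v)))\<^sup>2" using dle d0 by (simp add: power_mono)
    also have "x - (p + t *\<^sub>R v) = (x - p) - t *\<^sub>R v" by simp
    also have "(norm ((x - p) - t *\<^sub>R v))\<^sup>2 =
        (norm (x - p))\<^sup>2 - 2 * t * inner (x - p) v + t\<^sup>2 * (norm v)\<^sup>2"
      using power2_norm_eq_inner[of "(x - p) - t *\<^sub>R v"]
      by (simp only: inner_diff_left[of "x - p"] inner_diff_right[of _ "x - p"] inner_scaleR_left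
          inner_scaleR_right inner_commute[of v "x - p"] power2_norm_eq_inner)
        (simp add: power2_eq_square algebra_simps)
    also have "\<dots> = d\<^sup>2 - (inner (x - p) v)\<^sup>2 / (norm v)\<^sup>2"
      using vn np by (simp add: t_def field_simps power2_eq_square)
    finally have "(inner (x - p) v)\<^sup>2 / (norm v)\<^sup>2 \<le> 0" by linarith
    moreover have "(inner (x - p) v)\<^sup>2 / (norm v)\<^sup>2 > 0" using nz vn by simp
    ultimately show False by linarith
  qed
  then show ?thesis using pV by blast
qed

text \<open>The kernel of a nonzero functional has codimension one; the component \<open>u\<close>
  of \<open>x0\<close> orthogonal to it represents \<open>f\<close> up to a scalar.\<close>

lemma Riesz_representation:
  fixes f :: "'a::{real_inner,banach} \<Rightarrow> real"
  assumes "bounded_linear f"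
  shows "\<exists>z. \<forall>y. f y = inner z y"
proof (cases "\<forall>y. f y = 0")
  case True
  then show ?thesis by (intro exI[of _ 0]) simp
next
  case False
  then obtain x0 where x0: "f x0 \<noteq> 0" by blast
  interpret f: bounded_linear f by fact
  let ?V = "{y. f y = 0}"
  have "subspace ?V" by (auto simp: subspace_def f.add f.scaleR)
  moreover have "closed ?V" by (intro closed_Collect_eq continuous_intros f.continuous_on)
  ultimately obtain p where p: "f p = 0" "\<And>v. f v = 0 \<Longrightarrow> inner (x0 - p) v = 0"
    using orthogonal_projection_exists[of ?V x0] by blast
  define u where "u = x0 - p"
  have fu: "f u \<noteq> 0" using x0 p by (simp add: u_def f.diff)
  then have u0: "inner u u \<noteq> 0" using f.zero by auto
  have "f y = inner ((f u / inner u u) *\<^sub>R u) y" for y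
  proof -
    have "inner u (y - (f y / f u) *\<^sub>R u) = 0"
      using fu by (intro p(2)[folded u_def]) (simp add: f.diff f.scaleR)
    then have "inner u y = (f y / f u) * inner u u" by (simp add: inner_diff_right)
    then show ?thesis using fu u0 by (simp add: field_simps)
  qed
  then show ?thesis by blast
qed

section \<open>Recovering the complex inner product from the real one\<close>

lemma cinner_scaleC_left: "cinner (c *\<^sub>C x) y = cnj c * cinner x (y :: 'a::chilbert_space)"
  by (metis cinner_commute cinner_scaleC_right complex_cnj_mult)

lemma Im_cinner: "Im (cinner x y) = - inner x (\<i> *\<^sub>C (y :: 'a::chilbert_space))"
  by (simp flip: Re_cinner add: cinner_scaleC_right)

text \<open>Since \<open>Im (cinner x y)\<close> is a real inner product with
  \<open>\<i> *\<^sub>C y\<close>, the real \<open>inner\<close> can carry most arguments about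
  adjoints and positivity, and complex linearity enters as compatibility with
  \<open>\<i>\<close>.\<close>

lemma cinner_eqI:
  assumes "inner x y = inner x' (y' :: 'a::chilbert_space)"
    and "inner x (\<i> *\<^sub>C y) = inner x' (\<i> *\<^sub>C y')"
  shows "cinner x y = cinner x' y'"
  using assms by (simp add: complex_eq_iff Im_cinner Re_cinner)

lemma inner_scaleC_imaginary: "inner (\<i> *\<^sub>C x) y = - inner x (\<i> *\<^sub>C (y :: 'a::chilbert_space))"
  by (simp flip: Re_cinner add: cinner_scaleC_right cinner_scaleC_left)

lemma scaleC_complex: "c *\<^sub>C x = Re c *\<^sub>R x + Im c *\<^sub>R (\<i> *\<^sub>C (x :: 'a::chilbert_space))"
proof -
  have "c = complex_of_real (Re c) + complex_of_real (Im c) * \<i>" by (simp add: complex_eq_iff)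
  then show ?thesis by (metis scaleC_add_left scaleC_scaleC scaleR_scaleC)
qed

lemma cinner_self: "cinner x x = complex_of_real ((norm (x :: 'a::chilbert_space))\<^sup>2)"
proof -
  have "Im (cinner x x) = - Im (cinner x x)"
    by (subst cinner_commute) simp
  then have "Im (cinner x x) = 0" by simp
  then show ?thesis by (simp add: complex_eq_iff Re_cinner power2_norm_eq_inner)
qed

lemma inner_eqI: "(\<And>z. inner x z = inner y z) \<Longrightarrow> x = (y :: 'a::real_inner)"
  by (metis inner_diff_left eq_iff_diff_eq_0 inner_eq_zero_iff)

subsection \<open>The Banach algebra of bounded operators\<close>

lemma bop_apply_add: "T \<cdot> (x + y) = T \<cdot> x + T \<cdot> y"
  by transfer (simp add: blinfun.add_right)

lemma bop_apply_diff: "T \<cdot> (x - y) = T \<cdot> x - T \<cdot> y"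
  by transfer (simp add: blinfun.diff_right)

lemma bop_apply_zero: "T \<cdot> 0 = 0"
  by transfer simp

lemma bop_apply_scaleR: "T \<cdot> (r *\<^sub>R x) = r *\<^sub>R (T \<cdot> x)"
  by transfer (simp add: blinfun.scaleR_right)

lemma bop_apply_zero_left: "0 \<cdot> x = 0"
  by transfer simp

lemma bop_apply_minus_left: "(- T) \<cdot> x = - (T \<cdot> x)"
  by transfer (simp add: blinfun.minus_left)

lemma bop_apply_diff_left: "(S - T) \<cdot> x = S \<cdot> x - T \<cdot> x"
  by (simp add: minus_bop_def bop_apply_plus bop_apply_minus_left del: add_uminus_conv_diff)

instantiation bop :: (chilbert_space) real_normed_vector
begin

text \<open>Phrased through \<open>scaleC\<close>, so that unfolding it converts between the scalars
  \<open>complex_of_real d *\<^sub>C 1\<close> of a Q-system and real multiples, for which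
  simplification rules of real algebras apply.\<close>

definition scaleR_bop :: "real \<Rightarrow> 'a bop \<Rightarrow> 'a bop" where
  "scaleR_bop r T = complex_of_real r *\<^sub>C T"

lift_definition norm_bop :: "'a bop \<Rightarrow> real" is norm .

definition sgn_bop :: "'a bop \<Rightarrow> 'a bop" where
  "sgn_bop T = inverse (norm T) *\<^sub>R T"

definition dist_bop :: "'a bop \<Rightarrow> 'a bop \<Rightarrow> real" where
  "dist_bop S T = norm (S - T)"

definition uniformity_bop :: "('a bop \<times> 'a bop) filter" where
  "uniformity_bop = (INF e\<in>{0 <..}. principal {(x, y). dist x y < e})"

definition open_bop :: "'a bop set \<Rightarrow> bool" where
  "open_bop U = (\<forall>x\<in>U. \<forall>\<^sub>F (x', y) in uniformity. x' = x \<longrightarrow> y \<in> U)"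

lemma bop_apply_scaleR_left: "(r *\<^sub>R T) \<cdot> x = r *\<^sub>R (T \<cdot> (x :: 'a))"
  by (simp add: scaleR_bop_def bop_apply_scaleC_left scaleR_scaleC)

lemma blinfun_of_bop_scaleR: "blinfun_of_bop (r *\<^sub>R T :: 'a bop) = r *\<^sub>R blinfun_of_bop T"
  by (intro blinfun_eqI) (simp add: bop_apply_scaleR_left blinfun.scaleR_left flip: bop_apply.rep_eq)

lemma norm_bop_apply: "norm (T \<cdot> x) \<le> norm T * norm (x :: 'a)"
  by transfer (rule norm_blinfun)

lemma norm_bop_bound: "0 \<le> b \<Longrightarrow> (\<And>x. norm (T \<cdot> x) \<le> b * norm (x :: 'a)) \<Longrightarrow> norm T \<le> b"
  by transfer (rule norm_blinfun_bound)

instance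
proof
  fix S T :: "'a bop" and a b :: real
  show "a *\<^sub>R (S + T) = a *\<^sub>R S + a *\<^sub>R T"
    by (rule bop_eqI) (simp add: bop_apply_scaleR_left bop_apply_plus scaleR_add_right)
  show "(a + b) *\<^sub>R T = a *\<^sub>R T + b *\<^sub>R T"
    by (rule bop_eqI) (simp add: bop_apply_scaleR_left bop_apply_plus scaleR_add_left)
  show "a *\<^sub>R b *\<^sub>R T = (a * b) *\<^sub>R T"
    by (rule bop_eqI) (simp add: bop_apply_scaleR_left)
  show "1 *\<^sub>R T = T"
    by (rule bop_eqI) (simp add: bop_apply_scaleR_left)
  show "norm T = 0 \<longleftrightarrow> T = 0"
    by transfer simp
  show "norm (S + T) \<le> norm S + norm T"
    by transfer (rule norm_triangle_ineq)
  show "norm (a *\<^sub>R T) = \<bar>a\<bar> * norm T"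
    by (simp add: norm_bop.rep_eq blinfun_of_bop_scaleR)
qed (simp_all add: sgn_bop_def dist_bop_def uniformity_bop_def open_bop_def)

end

instance bop :: (chilbert_space) real_normed_algebra
proof
  fix S T :: "'a bop" and a :: real
  show "a *\<^sub>R S * T = a *\<^sub>R (S * T)"
    by (rule bop_eqI) (simp add: bop_apply_scaleR_left bop_apply_times)
  show "S * a *\<^sub>R T = a *\<^sub>R (S * T)"
    by (rule bop_eqI) (simp add: bop_apply_scaleR_left bop_apply_times bop_apply_scaleR)
  show "norm (S * T) \<le> norm S * norm T"
    by transfer (rule norm_blinfun_compose)
qed

text \<open>The complex linear operators are norm closed among the bounded real linear ones, because
  a norm limit is also a pointwise limit and \<open>scaleC\<close> is continuous.\<close>

instance bop :: (chilbert_space) banach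
proof
  fix X :: "nat \<Rightarrow> 'a bop"
  assume "Cauchy X"
  let ?Y = "\<lambda>n. blinfun_of_bop (X n)"
  have diff: "blinfun_of_bop (S - T) = blinfun_of_bop S - blinfun_of_bop T" for S T :: "'a bop"
    by (simp add: minus_bop_def plus_bop.rep_eq uminus_bop.rep_eq del: add_uminus_conv_diff)
  then have dist: "dist S T = dist (blinfun_of_bop S) (blinfun_of_bop T)" for S T :: "'a bop"
    by (simp add: dist_norm norm_bop.rep_eq)
  then have "Cauchy ?Y" using \<open>Cauchy X\<close> by (simp add: Cauchy_def)
  then obtain L where L: "?Y \<longlonglongrightarrow> L" using Cauchy_convergent convergent_def by blast
  have "blinfun_apply L (c *\<^sub>C x) = c *\<^sub>C blinfun_apply L x" for c x
  proof (rule LIMSEQ_unique)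
    have *: "(\<lambda>n. blinfun_apply (?Y n) y) \<longlonglongrightarrow> blinfun_apply L y" for y
      using L by (intro tendsto_intros)
    show "(\<lambda>n. blinfun_apply (?Y n) (c *\<^sub>C x)) \<longlonglongrightarrow> blinfun_apply L (c *\<^sub>C x)" by (rule *)
    have "(\<lambda>n. c *\<^sub>C blinfun_apply (?Y n) x) \<longlonglongrightarrow> c *\<^sub>C blinfun_apply L x"
      using bounded_linear.tendsto[OF bounded_linear_scaleC *] .
    then show "(\<lambda>n. blinfun_apply (?Y n) (c *\<^sub>C x)) \<longlonglongrightarrow> c *\<^sub>C blinfun_apply L x"
      by (simp add: bop_apply_scaleC flip: bop_apply.rep_eq)
  qed
  then have "blinfun_of_bop (Bop L) = L" by (simp add: Bop_inverse)
  then have "X \<longlonglongrightarrow> Bop L" using L by (simp add: lim_sequentially dist)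
  then show "convergent X" by (auto simp: convergent_def)
qed

lemma bounded_linear_bop_apply: "bounded_linear (\<lambda>x. T \<cdot> x)"
  by (rule bounded_linear_intro[where K = "norm T"])
    (simp_all add: bop_apply_add bop_apply_scaleR mult.commute[of _ "norm T"] norm_bop_apply)

lemma inner_bop_apply_le: "inner x (T \<cdot> y) \<le> norm x * (norm T * norm y)"
  by (rule order_trans[OF norm_cauchy_schwarz mult_left_mono[OF norm_bop_apply norm_ge_zero]])

lemma bop_of_function:
  assumes "\<And>x y. f (x + y) = f x + f y" and "\<And>c x. f (c *\<^sub>C x) = c *\<^sub>C f x"
    and "\<And>x. norm (f x) \<le> K * norm x"
  shows "\<exists>T. \<forall>x. T \<cdot> x = f x"
proof -
  have "bounded_linear f"
    by (rule bounded_linear_intro[where K = K])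
      (simp_all add: assms scaleR_scaleC mult.commute[of _ K])
  then have b: "blinfun_apply (Blinfun f) = f" by (rule bounded_linear_Blinfun_apply)
  then have "blinfun_of_bop (Bop (Blinfun f)) = Blinfun f"
    by (simp add: Bop_inverse assms(2))
  then have "Bop (Blinfun f) \<cdot> x = f x" for x
    by (simp add: bop_apply.rep_eq b)
  then show ?thesis by blast
qed

subsection \<open>Adjoints\<close>

text \<open>The Riesz vector of \<open>y \<mapsto> inner x (T \<cdot> y)\<close> depends on
  \<open>x\<close> real linearly, and it respects multiplication by \<open>\<i>\<close> because
  \<open>T\<close> does; together this is complex linearity.\<close>

lemma adjoint_exists: "\<exists>S. \<forall>x y. inner (S \<cdot> x) y = inner x (T \<cdot> y)"
proof -
  have "bounded_linear (\<lambda>y. inner x (T \<cdot> y))" for x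
    using bounded_linear_compose[OF bounded_linear_inner_right bounded_linear_bop_apply] .
  then have "\<exists>z. \<forall>y. inner z y = inner x (T \<cdot> y)" for x
    using Riesz_representation by metis
  then obtain f where f: "\<And>x y. inner (f x) y = inner x (T \<cdot> y)" by metis
  have "\<exists>S. \<forall>x. S \<cdot> x = f x"
  proof (rule bop_of_function)
    show "f (x + y) = f x + f y" for x y
      by (rule inner_eqI) (simp add: f inner_add_left)
    have i: "f (\<i> *\<^sub>C x) = \<i> *\<^sub>C f x" for x
      by (rule inner_eqI) (simp add: f inner_scaleC_imaginary bop_apply_scaleC)
    have r: "f (r *\<^sub>R x) = r *\<^sub>R f x" for r x
      by (rule inner_eqI) (simp add: f)
    show "f (c *\<^sub>C x) = c *\<^sub>C f x" for c x
      using \<open>\<And>x y. f (x + y) = f x + f y\<close> r i scaleC_complex[of c x] scaleC_complex[of c "f x"] by simp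
    show "norm (f x) \<le> norm T * norm x" for x
    proof (cases "f x = 0")
      case False
      have "norm (f x) * norm (f x) = inner x (T \<cdot> f x)"
        by (simp only: f power2_norm_eq_inner flip: power2_eq_square)
      also have "\<dots> \<le> norm x * (norm T * norm (f x))"
        by (rule inner_bop_apply_le)
      finally show ?thesis using False by (simp add: mult_ac)
    qed simp
  qed
  then show ?thesis using f by metis
qed

lemma adj_eqI:
  assumes "\<And>x y. inner (S \<cdot> x) y = inner x (T \<cdot> y)"
  shows "T\<^sup>\<dagger> = S"
  unfolding adj_def
proof (rule the_equality)
  show "\<forall>x y. cinner (S \<cdot> x) y = cinner x (T \<cdot> y)"
    using assms by (auto intro!: cinner_eqI simp flip: bop_apply_scaleC)
  fix S'
  assume *: "\<forall>x y. cinner (S' \<cdot> x) y = cinner x (T \<cdot> y)"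
  have "inner (S' \<cdot> x) y = inner (S \<cdot> x) y" for x y
    using arg_cong[OF *[rule_format, of x y], of Re] unfolding Re_cinner assms .
  then show "S' = S" by (rule bop_eqI[OF inner_eqI])
qed

lemma inner_adj: "inner (T\<^sup>\<dagger> \<cdot> x) y = inner x (T \<cdot> y)"
  using adjoint_exists[of T] adj_eqI by metis

lemma inner_adj_right: "inner x (T\<^sup>\<dagger> \<cdot> y) = inner (T \<cdot> x) y"
  by (metis inner_adj inner_commute)

lemma cinner_adj: "cinner (T\<^sup>\<dagger> \<cdot> x) y = cinner x (T \<cdot> y)"
  by (rule cinner_eqI) (simp_all add: inner_adj bop_apply_scaleC)

lemma adj_adj [simp]: "(T\<^sup>\<dagger>)\<^sup>\<dagger> = T"
  by (rule adj_eqI) (simp add: inner_adj_right)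

lemma adj_times [simp]: "(S * T)\<^sup>\<dagger> = T\<^sup>\<dagger> * S\<^sup>\<dagger>"
  by (rule adj_eqI) (simp add: bop_apply_times inner_adj)

lemma adj_plus [simp]: "(S + T)\<^sup>\<dagger> = S\<^sup>\<dagger> + T\<^sup>\<dagger>"
  by (rule adj_eqI) (simp add: bop_apply_plus inner_adj inner_add_left inner_add_right)

lemma adj_minus [simp]: "(- T)\<^sup>\<dagger> = - (T\<^sup>\<dagger>)"
  by (rule adj_eqI) (simp add: bop_apply_minus_left inner_adj)

lemma adj_diff [simp]: "(S - T)\<^sup>\<dagger> = S\<^sup>\<dagger> - T\<^sup>\<dagger>"
  by (simp add: diff_conv_add_uminus del: add_uminus_conv_diff)

lemma adj_one [simp]: "1\<^sup>\<dagger> = 1"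
  by (rule adj_eqI) (simp add: bop_apply_one)

lemma adj_zero [simp]: "0\<^sup>\<dagger> = 0"
  by (rule adj_eqI) (simp add: bop_apply_zero_left)

lemma adj_scaleC [simp]: "(c *\<^sub>C T)\<^sup>\<dagger> = cnj c *\<^sub>C (T\<^sup>\<dagger>)"
proof (rule adj_eqI)
  fix x y
  have "cinner ((cnj c *\<^sub>C T\<^sup>\<dagger>) \<cdot> x) y = cinner x ((c *\<^sub>C T) \<cdot> y)"
    by (simp add: bop_apply_scaleC_left cinner_scaleC_left cinner_scaleC_right cinner_adj)
  then show "inner ((cnj c *\<^sub>C T\<^sup>\<dagger>) \<cdot> x) y = inner x ((c *\<^sub>C T) \<cdot> y)"
    by (metis Re_cinner)
qed

lemma adj_scaleR [simp]: "(r *\<^sub>R T)\<^sup>\<dagger> = r *\<^sub>R (T\<^sup>\<dagger>)"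
  by (simp add: scaleR_bop_def)

lemma adj_eq_iff: "S\<^sup>\<dagger> = T\<^sup>\<dagger> \<longleftrightarrow> S = T"
  by (metis adj_adj)

lemma norm_adj [simp]: "norm (T\<^sup>\<dagger>) = norm T"
proof -
  have *: "norm (S\<^sup>\<dagger>) \<le> norm S" for S :: "'a bop"
  proof (rule norm_bop_bound)
    fix x
    show "norm (S\<^sup>\<dagger> \<cdot> x) \<le> norm S * norm x"
    proof (cases "S\<^sup>\<dagger> \<cdot> x = 0")
      case False
      have "norm (S\<^sup>\<dagger> \<cdot> x) * norm (S\<^sup>\<dagger> \<cdot> x) = inner x (S \<cdot> S\<^sup>\<dagger> \<cdot> x)"
        by (simp only: inner_adj power2_norm_eq_inner flip: power2_eq_square)
      also have "\<dots> \<le> norm x * (norm S * norm (S\<^sup>\<dagger> \<cdot> x))"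
        by (rule inner_bop_apply_le)
      finally show ?thesis using False by (simp add: mult_ac)
    qed simp
  qed simp
  show ?thesis using *[of T] *[of "T\<^sup>\<dagger>"] by simp
qed

lemma tendsto_adj:
  assumes "(T \<longlongrightarrow> L) F"
  shows "((\<lambda>n. (T n)\<^sup>\<dagger>) \<longlongrightarrow> L\<^sup>\<dagger>) F"
proof -
  have "bounded_linear (\<lambda>T. T\<^sup>\<dagger>)"
    by (rule bounded_linear_intro[where K = 1]) simp_all
  then show ?thesis using assms by (rule bounded_linear.tendsto)
qed

lemma norm_apply_adj_times: "inner x ((T\<^sup>\<dagger> * T) \<cdot> x) = (norm (T \<cdot> x))\<^sup>2"
  by (simp add: bop_apply_times inner_adj_right power2_norm_eq_inner)

lemma adj_times_self_eq_0: "T\<^sup>\<dagger> * T = 0 \<Longrightarrow> T = 0"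
  using norm_apply_adj_times[of _ T] by (intro bop_eqI) (simp add: bop_apply_zero_left)

subsection \<open>Inverses and square roots of coercive operators\<close>

lemma norm_bop_one_le: "norm (1 :: 'h::chilbert_space bop) \<le> 1"
  by (rule norm_bop_bound) (simp_all add: bop_apply_one)

lemma inner_bop_commute: "T\<^sup>\<dagger> = T \<Longrightarrow> inner x (T \<cdot> y) = inner y (T \<cdot> x)"
  by (metis inner_adj inner_commute)

lemma Cauchy_Schwarz_bop:
  assumes "T\<^sup>\<dagger> = T" and pos: "\<And>x. 0 \<le> inner x (T \<cdot> x)"
  shows "(inner x (T \<cdot> y))\<^sup>2 \<le> inner x (T \<cdot> x) * inner y (T \<cdot> y)"
proof -
  let ?a = "inner x (T \<cdot> x)" and ?b = "inner x (T \<cdot> y)" and ?c = "inner y (T \<cdot> y)"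
  have q: "0 \<le> ?a + 2 * t * ?b + t\<^sup>2 * ?c" for t
  proof -
    have "inner (x + t *\<^sub>R y) (T \<cdot> (x + t *\<^sub>R y)) = ?a + 2 * t * ?b + t\<^sup>2 * ?c"
      by (simp add: bop_apply_add bop_apply_scaleR inner_add_left inner_add_right
          inner_bop_commute[OF assms(1), of y x] power2_eq_square algebra_simps)
    then show ?thesis using pos by metis
  qed
  show ?thesis
  proof (cases "?c = 0")
    case True
    have "?b = 0"
    proof (rule ccontr)
      \<comment> \<open>With \<open>?c = 0\<close> the form is affine in \<open>t\<close>; at the
        value of \<open>t\<close> chosen next it equals -1.\<close>
      assume "?b \<noteq> 0"
      then have "2 * (- (?a + 1) / (2 * ?b)) * ?b = - (?a + 1)" by (simp add: field_simps)
      then show False using q[of "- (?a + 1) / (2 * ?b)"] True by simp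
    qed
    then show ?thesis using True by simp
  next
    case False
    then have "?c > 0" using pos[of y] by linarith
    moreover have "?a + 2 * (- ?b / ?c) * ?b + (- ?b / ?c)\<^sup>2 * ?c = ?a - ?b\<^sup>2 / ?c"
      using False by (simp add: power2_eq_square field_simps)
    ultimately have "?b\<^sup>2 / ?c \<le> ?a" using q[of "- ?b / ?c"] by linarith
    then show ?thesis using \<open>?c > 0\<close> by (simp only: pos_divide_le_eq)
  qed
qed

text \<open>Cauchy-Schwarz for the form of \<open>T\<close> at the pair \<open>T \<cdot> x\<close>,
  \<open>x\<close> bounds the fourth power of \<open>norm (T \<cdot> x)\<close> by two values of the
  quadratic form.\<close>

lemma norm_positive_bop_le:
  assumes sa: "T\<^sup>\<dagger> = T" and pos: "\<And>x. 0 \<le> inner x (T \<cdot> x)"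
    and le: "\<And>x. inner x (T \<cdot> x) \<le> b * (norm x)\<^sup>2" and "0 \<le> b"
  shows "norm T \<le> b"
proof (rule norm_bop_bound[OF \<open>0 \<le> b\<close>])
  fix x
  let ?y = "T \<cdot> x"
  show "norm ?y \<le> b * norm x"
  proof (cases "?y = 0")
    case False
    have "(norm ?y)\<^sup>2 * (norm ?y)\<^sup>2 = (inner ?y (T \<cdot> x))\<^sup>2"
      by (metis power2_eq_square power2_norm_eq_inner)
    also have "\<dots> \<le> inner ?y (T \<cdot> ?y) * inner x (T \<cdot> x)"
      by (rule Cauchy_Schwarz_bop[OF sa pos])
    also have "\<dots> \<le> (b * (norm ?y)\<^sup>2) * (b * (norm x)\<^sup>2)"
      using \<open>0 \<le> b\<close> by (intro mult_mono le pos) auto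
    finally have "(norm ?y)\<^sup>2 \<le> (b * norm x)\<^sup>2"
      using False by (simp add: power_mult_distrib power2_eq_square mult_ac)
    then show ?thesis using \<open>0 \<le> b\<close> by (simp add: power2_le_iff_abs_le)
  qed (use \<open>0 \<le> b\<close> in simp)
qed

text \<open>Self-adjoint and bounded below by a positive constant. For this class inverses and
  square roots come from contractions in the operator norm, so no spectral calculus is involved;
  every operator whose root or inverse is taken below is brought into it.\<close>

definition coercive :: "'h::chilbert_space bop \<Rightarrow> bool" where
  "coercive T \<longleftrightarrow> T\<^sup>\<dagger> = T \<and> (\<exists>c>0. \<forall>x. c * (norm x)\<^sup>2 \<le> inner x (T \<cdot> x))"

lemma positive_bopI:
  assumes "T\<^sup>\<dagger> = T" and "\<And>x. 0 \<le> inner x (T \<cdot> x)"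
  shows "positive_bop T"
proof -
  have "Im (cinner x (T \<cdot> x)) = 0" for x
  proof -
    have "cinner x (T \<cdot> x) = cnj (cinner x (T \<cdot> x))"
      by (metis assms(1) cinner_adj cinner_commute)
    from arg_cong[OF this, of Im] show ?thesis by simp
  qed
  then show ?thesis using assms(2) by (simp add: positive_bop_def Re_cinner)
qed

lemma coercive_nonneg: "coercive T \<Longrightarrow> 0 \<le> inner x (T \<cdot> x)"
  unfolding coercive_def by (metis mult_nonneg_nonneg less_imp_le order_trans zero_le_power2)

lemma coercive_positive: "coercive T \<Longrightarrow> positive_bop T"
  using coercive_nonneg by (auto intro!: positive_bopI simp: coercive_def)

text \<open>With lower bound \<open>c\<close> and \<open>s = 1 / (norm T + c)\<close>, the form of
  \<open>s *\<^sub>R T\<close> lies between \<open>s * c\<close> and 1, so that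
  \<open>A = 1 - s *\<^sub>R T\<close> is positive of norm at most
  \<open>q = 1 - s * c\<close>.\<close>

lemma contraction_of_coercive:
  assumes "coercive T"
  shows "\<exists>s q A. 0 < s \<and> 0 \<le> q \<and> q < 1 \<and> A\<^sup>\<dagger> = A \<and> norm A \<le> q \<and> s *\<^sub>R T = 1 - A"
proof -
  obtain c where T: "T\<^sup>\<dagger> = T" and c: "c > 0" "\<And>x. c * (norm x)\<^sup>2 \<le> inner x (T \<cdot> x)"
    using assms by (auto simp: coercive_def)
  define s where "s = 1 / (norm T + c)"
  have s: "0 < s" using c(1) by (simp add: s_def add_nonneg_pos)
  have sc: "s * c \<le> 1" and sT: "s * norm T \<le> 1"
    using c(1) by (simp_all add: s_def divide_simps add_nonneg_pos)
  define A where "A = 1 - s *\<^sub>R T"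
  have inn: "inner x (A \<cdot> x) = (norm x)\<^sup>2 - s * inner x (T \<cdot> x)" for x
    by (simp add: A_def bop_apply_diff_left bop_apply_one bop_apply_scaleR_left inner_diff_right
        power2_norm_eq_inner)
  have "norm A \<le> 1 - s * c"
  proof (rule norm_positive_bop_le)
    show "A\<^sup>\<dagger> = A" by (simp add: A_def T)
    fix x
    have "inner x (T \<cdot> x) \<le> norm x * (norm T * norm x)"
      by (rule inner_bop_apply_le)
    then have "s * inner x (T \<cdot> x) \<le> (s * norm T) * (norm x)\<^sup>2"
      using s by (simp add: power2_eq_square mult_ac)
    also have "\<dots> \<le> (norm x)\<^sup>2" using sT by (simp add: mult_left_le_one_le s less_imp_le)
    finally show "0 \<le> inner x (A \<cdot> x)" by (simp add: inn)
    have "s * (c * (norm x)\<^sup>2) \<le> s * inner x (T \<cdot> x)" using s c(2) by simp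
    then show "inner x (A \<cdot> x) \<le> (1 - s * c) * (norm x)\<^sup>2" by (simp add: inn algebra_simps)
  qed (use sc in simp)
  moreover have "A\<^sup>\<dagger> = A" by (simp add: A_def T)
  moreover have "0 \<le> 1 - s * c" "1 - s * c < 1" using s c sc by auto
  ultimately show ?thesis using s by (intro exI[of _ s] exI[of _ "1 - s * c"] exI[of _ A]) (simp add: A_def)
qed

text \<open>The one-sided inverses are fixed points of the contractions
  \<open>Z \<mapsto> 1 + A * Z\<close> and \<open>Z \<mapsto> 1 + Z * A\<close>; associativity
  identifies them.\<close>

lemma Neumann_inverse:
  fixes A :: "'h::chilbert_space bop"
  assumes "norm A < 1"
  shows "\<exists>Z. (1 - A) * Z = 1 \<and> Z * (1 - A) = 1"
proof -
  have "\<exists>!Z. 1 + A * Z = Z"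
  proof (rule banach_fix_type)
    show "\<forall>X Y. dist (1 + A * X) (1 + A * Y) \<le> norm A * dist X Y"
      by (metis add_diff_cancel_left dist_norm norm_mult_ineq right_diff_distrib)
  qed (use assms in auto)
  then obtain Z where Z: "1 + A * Z = Z" by blast
  have "\<exists>!Z. 1 + Z * A = Z"
  proof (rule banach_fix_type)
    show "\<forall>X Y. dist (1 + X * A) (1 + Y * A) \<le> norm A * dist X Y"
      by (metis add_diff_cancel_left dist_norm norm_mult_ineq left_diff_distrib mult.commute)
  qed (use assms in auto)
  then obtain Z' where Z': "1 + Z' * A = Z'" by blast
  have 1: "(1 - A) * Z = 1" using Z by (simp add: left_diff_distrib algebra_simps)
  have 2: "Z' * (1 - A) = 1" using Z' by (simp add: right_diff_distrib algebra_simps)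
  have "Z' = Z" using 1 2 by (metis mult.assoc mult_1_left mult_1_right)
  then show ?thesis using 1 2 by blast
qed

lemma coercive_invertible:
  assumes "coercive T"
  shows "\<exists>Z. T * Z = 1 \<and> Z * T = 1"
proof -
  obtain s q A where *: "0 < s" "q < 1" "norm A \<le> q" "s *\<^sub>R T = 1 - A"
    using contraction_of_coercive[OF assms] by blast
  then obtain Z where "(1 - A) * Z = 1" "Z * (1 - A) = 1" using Neumann_inverse[of A] by auto
  then have "T * (s *\<^sub>R Z) = 1 \<and> (s *\<^sub>R Z) * T = 1" using *(4)[symmetric] by simp
  then show ?thesis by blast
qed

text \<open>If \<open>\<parallel>A\<parallel> < 1\<close>, the fixed point of \<open>Y \<mapsto> (A + Y\<^sup>2) / 2\<close> satisfies \<open>(1 - Y)\<^sup>2 = 1 - A\<close>.\<close>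

lemma coercive_sqrt_exists:
  assumes "coercive T"
  shows "\<exists>R. coercive R \<and> R * R = T \<and> (\<forall>B. B * T = T * B \<longrightarrow> B * R = R * B)"
proof -
  obtain s q A where s: "0 < s" and q: "0 \<le> q" "q < 1" and A: "A\<^sup>\<dagger> = A" "norm A \<le> q"
    and sT: "s *\<^sub>R T = 1 - A"
    using contraction_of_coercive[OF assms] by blast
  \<comment> \<open>The smaller root of \<open>q + r\<^sup>2 = 2 * r\<close>. Hence \<open>f\<close>
    maps the ball of radius \<open>r\<close> into itself, and \<open>r < 1\<close> is also a
    Lipschitz constant of \<open>f\<close> there.\<close>
  define r where "r = 1 - sqrt (1 - q)"
  have r: "0 \<le> r" "r < 1" using q by (auto simp: r_def)
  have "(1 - r)\<^sup>2 = 1 - q" using q by (simp add: r_def)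
  then have rq: "q + r\<^sup>2 = 2 * r" by (simp add: power2_eq_square algebra_simps)
  \<comment> \<open>Self-adjointness and commutation with everything that commutes with
    \<open>A\<close> are built into the complete set, so the fixed point inherits both.\<close>
  define \<Sigma> where "\<Sigma> = {Y. norm Y \<le> r \<and> Y\<^sup>\<dagger> = Y \<and> (\<forall>B. B * A = A * B \<longrightarrow> B * Y = Y * B)}"
  define f where "f = (\<lambda>Y. (1 / 2) *\<^sub>R (A + Y * Y))"
  have "\<exists>!Y\<in>\<Sigma>. f Y = Y"
  proof (rule Banach_fix)
    have "closed \<Sigma>"
      unfolding closed_sequential_limits
    proof (intro allI impI, elim conjE)
      fix X L assume X: "\<forall>n. X n \<in> \<Sigma>" and L: "X \<longlonglongrightarrow> L"
      have "norm L \<le> r"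
        using X L by (intro LIMSEQ_le_const2[OF tendsto_norm[OF L]]) (auto simp: \<Sigma>_def)
      moreover have "L\<^sup>\<dagger> = L"
        using tendsto_adj[OF L] L X by (auto simp: \<Sigma>_def intro: LIMSEQ_unique)
      moreover have "B * L = L * B" if "B * A = A * B" for B
      proof (rule LIMSEQ_unique)
        show "(\<lambda>n. B * X n) \<longlonglongrightarrow> B * L" by (intro tendsto_mult tendsto_const L)
        have "(\<lambda>n. X n * B) \<longlonglongrightarrow> L * B" by (intro tendsto_mult tendsto_const L)
        then show "(\<lambda>n. B * X n) \<longlonglongrightarrow> L * B" using X that by (simp add: \<Sigma>_def)
      qed
      ultimately show "L \<in> \<Sigma>" by (simp add: \<Sigma>_def)
    qed
    then show "complete \<Sigma>" by (simp add: complete_eq_closed)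
    have "0 \<in> \<Sigma>" using r by (simp add: \<Sigma>_def)
    then show "\<Sigma> \<noteq> {}" by blast
    show "f ` \<Sigma> \<subseteq> \<Sigma>"
    proof (clarify)
      fix Y assume Y: "Y \<in> \<Sigma>"
      have "norm (A + Y * Y) \<le> q + norm Y * norm Y"
        using A(2) norm_mult_ineq[of Y Y] norm_triangle_ineq[of A "Y * Y"] by linarith
      also have "\<dots> \<le> q + r * r" using Y r by (intro add_left_mono mult_mono) (auto simp: \<Sigma>_def)
      finally have "norm (f Y) \<le> r" using rq by (simp add: f_def power2_eq_square)
      moreover have "B * f Y = f Y * B" if "B * A = A * B" for B
      proof -
        have "B * Y = Y * B" using Y that by (auto simp: \<Sigma>_def)
        then have "B * (Y * Y) = Y * Y * B" by (metis mult.assoc)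
        then show ?thesis by (simp add: f_def distrib_left distrib_right that)
      qed
      moreover have "Y\<^sup>\<dagger> = Y" using Y by (simp only: \<Sigma>_def mem_Collect_eq)
      then have "(f Y)\<^sup>\<dagger> = f Y" using A(1) by (simp add: f_def)
      ultimately show "f Y \<in> \<Sigma>" by (simp add: \<Sigma>_def)
    qed
    show "dist (f X) (f Y) \<le> r * dist X Y" if "X \<in> \<Sigma>" "Y \<in> \<Sigma>" for X Y
    proof -
      have "X * X - Y * Y = X * (X - Y) + (X - Y) * Y" by (simp add: algebra_simps)
      then have "norm (X * X - Y * Y) \<le> norm X * norm (X - Y) + norm (X - Y) * norm Y"
        using norm_mult_ineq[of X "X - Y"] norm_mult_ineq[of "X - Y" Y]
          norm_triangle_ineq[of "X * (X - Y)" "(X - Y) * Y"] by simp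
      also have "\<dots> \<le> r * norm (X - Y) + norm (X - Y) * r"
        using that by (intro add_mono mult_right_mono mult_left_mono) (auto simp: \<Sigma>_def)
      finally have "norm (X * X - Y * Y) \<le> 2 * (r * norm (X - Y))" by simp
      moreover have "f X - f Y = (1 / 2) *\<^sub>R (X * X - Y * Y)"
        by (simp add: f_def flip: scaleR_diff_right)
      ultimately show ?thesis by (simp add: dist_norm)
    qed
  qed (use r in auto)
  then obtain Y where Y: "Y \<in> \<Sigma>" and "f Y = Y" by blast
  then have "2 *\<^sub>R f Y = 2 *\<^sub>R Y" by simp
  then have fY: "A + Y * Y = Y + Y" by (simp add: f_def scaleR_2)
  define R where "R = (1 / sqrt s) *\<^sub>R (1 - Y)"
  have RR: "R * R = T"
  proof -
    have "(1 - Y) * (1 - Y) = 1 - (Y + Y) + Y * Y" by (simp add: algebra_simps)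
    also have "\<dots> = s *\<^sub>R T" unfolding fY[symmetric] sT by simp
    finally show ?thesis using s by (simp add: R_def)
  qed
  have "coercive R"
    unfolding coercive_def
  proof (intro conjI exI allI)
    have "Y\<^sup>\<dagger> = Y" using Y by (simp only: \<Sigma>_def mem_Collect_eq)
    then show "R\<^sup>\<dagger> = R" by (simp add: R_def)
    show "(1 - r) / sqrt s > 0" using r s by simp
    fix x
    have "inner x (Y \<cdot> x) \<le> norm x * (norm Y * norm x)"
      by (rule inner_bop_apply_le)
    also have "\<dots> \<le> norm x * (r * norm x)"
      using Y by (intro mult_left_mono mult_right_mono) (auto simp: \<Sigma>_def)
    finally have "(1 - r) * (norm x)\<^sup>2 \<le> inner x ((1 - Y) \<cdot> x)"
      by (simp add: bop_apply_diff_left bop_apply_one inner_diff_right power2_norm_eq_inner[symmetric]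
          power2_eq_square algebra_simps)
    then show "(1 - r) / sqrt s * (norm x)\<^sup>2 \<le> inner x (R \<cdot> x)"
      using s by (simp add: R_def bop_apply_scaleR_left divide_right_mono)
  qed
  moreover have "B * R = R * B" if "B * T = T * B" for B
  proof -
    have "B * (s *\<^sub>R T) = (s *\<^sub>R T) * B" using that by simp
    then have "B * A = A * B" unfolding sT by (simp add: algebra_simps)
    then have "B * Y = Y * B" using Y unfolding \<Sigma>_def by blast
    then show ?thesis by (simp add: R_def left_diff_distrib right_diff_distrib)
  qed
  ultimately show ?thesis using RR by blast
qed

text \<open>Identifies the definite description: a positive root \<open>R'\<close> commutes with
  \<open>T\<close>, hence with the root \<open>R\<close> just constructed, so
  \<open>(R + R') * (R - R') = 0\<close>; coercivity of \<open>R\<close> makes \<open>R + R'\<close>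
  injective.\<close>

lemma sqrt_bop_coercive:
  assumes "coercive T"
  shows "coercive (sqrt_bop T)" and "sqrt_bop T * sqrt_bop T = T"
    and "B * T = T * B \<Longrightarrow> B * sqrt_bop T = sqrt_bop T * B"
proof -
  obtain R where R: "coercive R" "R * R = T" "\<And>B. B * T = T * B \<Longrightarrow> B * R = R * B"
    using coercive_sqrt_exists[OF assms] by blast
  have eq: "sqrt_bop T = R"
    unfolding sqrt_bop_def
  proof (rule the_equality)
    show "positive_bop R \<and> R * R = T" using R coercive_positive by blast
    fix R' assume R': "positive_bop R' \<and> R' * R' = T"
    then have "R' * T = T * R'" by (metis mult.assoc)
    then have "R' * R = R * R'" by (rule R(3))
    then have "(R + R') * (R - R') = 0" using R(2) R' by (simp add: algebra_simps)
    then have 0: "(R + R') \<cdot> (R - R') \<cdot> x = 0" for x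
      by (metis bop_apply_times bop_apply_zero_left)
    obtain c where c: "c > 0" "\<And>x. c * (norm x)\<^sup>2 \<le> inner x (R \<cdot> x)"
      using R(1) by (auto simp: coercive_def)
    have "(R - R') \<cdot> x = 0" for x
    proof -
      let ?y = "(R - R') \<cdot> x"
      have "inner ?y (R \<cdot> ?y) + inner ?y (R' \<cdot> ?y) = 0"
        using 0[of x] by (metis bop_apply_plus inner_add_right inner_zero_right)
      moreover have "0 \<le> inner ?y (R' \<cdot> ?y)"
        using R' by (simp add: positive_bop_def flip: Re_cinner)
      ultimately have "c * (norm ?y)\<^sup>2 \<le> 0" using c(2)[of ?y] by linarith
      then show ?thesis using c(1) by (simp add: mult_le_0_iff)
    qed
    then have "R - R' = 0" by (intro bop_eqI) (simp add: bop_apply_zero_left)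
    then show "R' = R" by simp
  qed
  show "coercive (sqrt_bop T)" unfolding eq by (rule R(1))
  show "sqrt_bop T * sqrt_bop T = T" unfolding eq by (rule R(2))
  show "B * sqrt_bop T = sqrt_bop T * B" if "B * T = T * B" unfolding eq using that by (rule R(3))
qed

lemma inv_bop_eqI: "R * T = 1 \<Longrightarrow> T * R = 1 \<Longrightarrow> inv_bop T = R"
  unfolding inv_bop_def by (rule the_equality) (auto, metis mult.assoc mult_1_left mult_1_right)

lemma inv_bop_coercive:
  assumes "coercive T"
  shows "inv_bop T * T = 1" and "T * inv_bop T = 1" and "(inv_bop T)\<^sup>\<dagger> = inv_bop T"
    and "B * T = T * B \<Longrightarrow> B * inv_bop T = inv_bop T * B"
proof -
  obtain Z where Z: "T * Z = 1" "Z * T = 1" using coercive_invertible[OF assms] by blast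
  then have i: "inv_bop T = Z" by (intro inv_bop_eqI)
  then show 1: "inv_bop T * T = 1" and 2: "T * inv_bop T = 1" using Z by auto
  have "T\<^sup>\<dagger> = T" using assms by (simp add: coercive_def)
  then have "Z\<^sup>\<dagger> * T = 1" "T * Z\<^sup>\<dagger> = 1" by (metis Z adj_one adj_times)+
  then show "(inv_bop T)\<^sup>\<dagger> = inv_bop T" using inv_bop_eqI i by metis
  assume B: "B * T = T * B"
  have "B * Z = Z * T * (B * Z)" by (simp add: Z)
  also have "\<dots> = Z * (B * T) * Z" by (simp add: B mult.assoc)
  also have "\<dots> = Z * B" by (simp add: mult.assoc Z)
  finally show "B * inv_bop T = inv_bop T * B" by (simp add: i)
qed

text \<open>A left inverse bounds \<open>T\<close> from below. In a Frobenius algebra the unit law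
  says that the comultiplication has the left inverse \<open>w\<^sup>\<dagger>\<close>, which makes
  \<open>n\<close> coercive.\<close>

lemma coercive_adj_times_self:
  assumes "L * T = 1"
  shows "coercive (T\<^sup>\<dagger> * T)"
  unfolding coercive_def
proof (intro conjI exI allI)
  show "(T\<^sup>\<dagger> * T)\<^sup>\<dagger> = T\<^sup>\<dagger> * T" by simp
  \<comment> \<open>The summand 1 keeps the constant meaningful when \<open>L = 0\<close>, which
    happens on the zero space.\<close>
  have "1 + norm L > 0" by (simp add: add_pos_nonneg)
  then show "1 / (1 + norm L)\<^sup>2 > 0" by simp
  fix x
  have "norm x = norm (L \<cdot> T \<cdot> x)" using assms by (simp add: bop_apply_one flip: bop_apply_times)
  also have "\<dots> \<le> norm L * norm (T \<cdot> x)" by (rule norm_bop_apply)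
  also have "\<dots> \<le> (1 + norm L) * norm (T \<cdot> x)" by (simp add: mult_right_mono)
  finally have "(norm x)\<^sup>2 \<le> (1 + norm L)\<^sup>2 * (norm (T \<cdot> x))\<^sup>2"
    by (metis norm_ge_zero power_mono power_mult_distrib)
  then show "1 / (1 + norm L)\<^sup>2 * (norm x)\<^sup>2 \<le> inner x ((T\<^sup>\<dagger> * T) \<cdot> x)"
    using \<open>1 + norm L > 0\<close> pos_divide_le_eq[of "(1 + norm L)\<^sup>2"]
    by (simp add: norm_apply_adj_times mult.commute)
qed

lemma coercive_inverse:
  assumes "coercive T" and Z: "T * Z = 1" "Z * T = 1"
  shows "Z\<^sup>\<dagger> = Z" and "0 \<le> inner x (Z \<cdot> x)"
proof -
  show "Z\<^sup>\<dagger> = Z" using inv_bop_coercive(3)[OF assms(1)] inv_bop_eqI[OF Z(2,1)] by simp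
  have "inner x (Z \<cdot> x) = inner (Z \<cdot> x) (T \<cdot> Z \<cdot> x)"
    using Z by (metis bop_apply_one bop_apply_times inner_commute)
  then show "0 \<le> inner x (Z \<cdot> x)" using coercive_nonneg[OF assms(1)] by simp
qed

subsection \<open>Projections onto closed subspaces\<close>

lemma projection_bop_exists:
  fixes V :: "'h::chilbert_space set"
  assumes V: "subspace V" "closed V" and cV: "\<And>c v. v \<in> V \<Longrightarrow> c *\<^sub>C v \<in> V"
  shows "\<exists>p. p\<^sup>\<dagger> = p \<and> (\<forall>x. p \<cdot> x \<in> V) \<and> (\<forall>v\<in>V. p \<cdot> v = v) \<and>
    (\<forall>T. (\<forall>v\<in>V. T \<cdot> v \<in> V) \<and> (\<forall>v\<in>V. T\<^sup>\<dagger> \<cdot> v \<in> V) \<longrightarrow> p * T = T * p)"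
proof -
  obtain f where fV: "\<And>x. f x \<in> V" and f: "\<And>x v. v \<in> V \<Longrightarrow> inner (x - f x) v = 0"
    using orthogonal_projection_exists[OF V] by metis
  \<comment> \<open>The orthogonality relation characterises \<open>f x\<close>. Additivity,
    homogeneity and commutation with \<open>T\<close> are then checked by verifying it for the
    candidate value.\<close>
  have uniq: "f x = y" if "y \<in> V" and o: "\<And>v. v \<in> V \<Longrightarrow> inner (x - y) v = 0" for x y
  proof -
    have d: "f x - y \<in> V" using V fV that by (simp add: subspace_diff)
    have "inner (f x - y) (f x - y) = inner (x - y) (f x - y) - inner (x - f x) (f x - y)"
      by (simp add: inner_diff_left)
    then show ?thesis using f[OF d] o[OF d] by simp
  qed
  have "\<exists>p. \<forall>x. p \<cdot> x = f x"
  proof (rule bop_of_function)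
    show "f (x + y) = f x + f y" for x y
    proof (rule uniq)
      fix v assume "v \<in> V"
      have "x + y - (f x + f y) = (x - f x) + (y - f y)" by simp
      then show "inner (x + y - (f x + f y)) v = 0"
        using f[OF \<open>v \<in> V\<close>] by (simp only: inner_add_left)
    qed (use V fV in \<open>simp add: subspace_add\<close>)
    show "f (c *\<^sub>C x) = c *\<^sub>C f x" for c x
    proof (rule uniq)
      fix v assume v: "v \<in> V"
      have "c *\<^sub>C x - c *\<^sub>C f x = c *\<^sub>C (x - f x)"
        by (simp add: scaleC_add_right scaleC_minus_right diff_conv_add_uminus
            del: add_uminus_conv_diff)
      then show "inner (c *\<^sub>C x - c *\<^sub>C f x) v = 0"
        using f[OF v] f[OF cV[OF v, of \<i>]] scaleC_complex[of c "x - f x"]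
        by (simp add: inner_add_left inner_scaleC_imaginary)
    qed (simp add: cV fV)
    show "norm (f x) \<le> 1 * norm x" for x
    proof -
      have "(norm x)\<^sup>2 = (norm (x - f x))\<^sup>2 + (norm (f x))\<^sup>2"
        using f[OF fV, of x x] by (simp add: power2_norm_eq_inner inner_diff_left inner_diff_right inner_commute)
      then show ?thesis by (simp add: power2_le_imp_le)
    qed
  qed
  then obtain p where p: "\<And>x. p \<cdot> x = f x" by blast
  have "p\<^sup>\<dagger> = p"
  proof (rule adj_eqI)
    fix x y
    have "inner (f x) y = inner (f x) (f y)" using f[OF fV, of y x]
      unfolding inner_commute[of _ "f x"] by (simp add: inner_diff_right)
    moreover have "inner x (f y) = inner (f x) (f y)" using f[OF fV, of x y]
      by (simp add: inner_diff_left)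
    ultimately show "inner (p \<cdot> x) y = inner x (p \<cdot> y)" by (simp add: p)
  qed
  moreover have "p * T = T * p" if T: "\<And>v. v \<in> V \<Longrightarrow> T \<cdot> v \<in> V" "\<And>v. v \<in> V \<Longrightarrow> T\<^sup>\<dagger> \<cdot> v \<in> V" for T
  proof (rule bop_eqI)
    fix x
    have "f (T \<cdot> x) = T \<cdot> f x"
    proof (rule uniq)
      fix v assume v: "v \<in> V"
      have "inner (T \<cdot> x - T \<cdot> f x) v = inner (x - f x) (T\<^sup>\<dagger> \<cdot> v)"
        by (simp add: inner_adj_right bop_apply_diff)
      then show "inner (T \<cdot> x - T \<cdot> f x) v = 0" using f[OF T(2)[OF v]] by simp
    qed (simp add: T fV)
    then show "(p * T) \<cdot> x = (T * p) \<cdot> x" by (simp add: bop_apply_times p)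
  qed
  moreover have "p \<cdot> v = v" if "v \<in> V" for v unfolding p using that by (intro uniq) auto
  ultimately show ?thesis using fV p by metis
qed

subsection \<open>Von Neumann algebras\<close>

locale star_algebra =
  fixes A :: "'h::chilbert_space bop set"
  assumes one: "1 \<in> A"
    and add: "a \<in> A \<Longrightarrow> b \<in> A \<Longrightarrow> a + b \<in> A"
    and times: "a \<in> A \<Longrightarrow> b \<in> A \<Longrightarrow> a * b \<in> A"
    and scaleC: "a \<in> A \<Longrightarrow> c *\<^sub>C a \<in> A"
    and adj: "a \<in> A \<Longrightarrow> a\<^sup>\<dagger> \<in> A"
begin

lemma scaleR: "a \<in> A \<Longrightarrow> r *\<^sub>R a \<in> A"
  by (simp add: scaleR_bop_def scaleC)

lemma uminus: "a \<in> A \<Longrightarrow> - a \<in> A"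
  using scaleR[of a "-1"] by simp

lemma diff: "a \<in> A \<Longrightarrow> b \<in> A \<Longrightarrow> a - b \<in> A"
  using add uminus by (metis diff_conv_add_uminus)

lemma zero: "0 \<in> A"
  using scaleR[OF one, of 0] by simp

lemma sum: "(\<And>i. i \<in> I \<Longrightarrow> f i \<in> A) \<Longrightarrow> sum f I \<in> A"
  by (induction I rule: infinite_finite_induct) (auto intro: zero add)

end

lemma scaleC_bop_times_left: "(c *\<^sub>C S) * T = c *\<^sub>C (S * (T :: 'h::chilbert_space bop))"
  by (rule bop_eqI) (simp add: bop_apply_times bop_apply_scaleC_left)

lemma scaleC_bop_times_right: "S * (c *\<^sub>C T) = c *\<^sub>C (S * (T :: 'h::chilbert_space bop))"
  by (rule bop_eqI) (simp add: bop_apply_times bop_apply_scaleC_left bop_apply_scaleC)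

lemma scaleC_bop_scaleC: "c *\<^sub>C d *\<^sub>C T = (c * d) *\<^sub>C (T :: 'h::chilbert_space bop)"
  by (rule bop_eqI) (simp add: bop_apply_scaleC_left scaleC_scaleC)

lemma scaleC_bop_one: "1 *\<^sub>C T = (T :: 'h::chilbert_space bop)"
  by (rule bop_eqI) (simp add: bop_apply_scaleC_left scaleC_one)

lemma scaleC_bop_minus_one: "(- 1) *\<^sub>C T = - (T :: 'h::chilbert_space bop)"
  by (rule bop_eqI)
    (metis bop_apply_minus_left bop_apply_scaleC_left of_real_1 of_real_minus scaleR_minus1_left
      scaleR_scaleC)

lemma star_algebra_commutant:
  assumes "\<And>a. a \<in> A \<Longrightarrow> a\<^sup>\<dagger> \<in> A"
  shows "star_algebra (commutant A)"
proof
  show "a\<^sup>\<dagger> \<in> commutant A" if "a \<in> commutant A" for a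
  proof -
    have "a\<^sup>\<dagger> * b = b * a\<^sup>\<dagger>" if "b \<in> A" for b
    proof -
      have "a * b\<^sup>\<dagger> = b\<^sup>\<dagger> * a" using \<open>a \<in> commutant A\<close> assms[OF that] by (simp add: commutant_def)
      from arg_cong[OF this, of adj] show ?thesis by simp
    qed
    then show ?thesis by (simp add: commutant_def)
  qed
  show "a * b \<in> commutant A" if "a \<in> commutant A" "b \<in> commutant A" for a b
    using that by (auto simp: commutant_def) (metis mult.assoc)
qed (auto simp: commutant_def distrib_left distrib_right scaleC_bop_times_left
    scaleC_bop_times_right)

lemma von_neumann_star_algebra: "von_neumann_algebra N \<Longrightarrow> star_algebra N"
  unfolding von_neumann_algebra_def
  by (metis star_algebra_commutant star_algebra.adj)

lemma bicommutant_superset: "A \<subseteq> commutant (commutant A)"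
  by (auto simp: commutant_def)

lemma commutant_antimono: "A \<subseteq> B \<Longrightarrow> commutant B \<subseteq> commutant A"
  by (auto simp: commutant_def)

text \<open>The bicommutant condition as a membership test: roots, inverses and strong limits of
  elements of \<open>N\<close> commute with whatever commutes with \<open>N\<close>, hence stay in
  \<open>N\<close>.\<close>

lemma von_neumann_memI:
  assumes "von_neumann_algebra N" and "\<And>b. b \<in> commutant N \<Longrightarrow> T * b = b * T"
  shows "T \<in> N"
  using assms unfolding von_neumann_algebra_def by (auto simp: commutant_def)

lemma von_neumann_commutes:
  "T \<in> N \<Longrightarrow> b \<in> commutant N \<Longrightarrow> b * T = T * b"
  by (simp add: commutant_def)

lemma von_neumann_sqrt:
  assumes "von_neumann_algebra N" "T \<in> N" "coercive T"
  shows "sqrt_bop T \<in> N"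
  using assms by (metis von_neumann_memI von_neumann_commutes sqrt_bop_coercive(3))

lemma von_neumann_inverse:
  assumes "von_neumann_algebra N" "T \<in> N" and Z: "T * Z = 1" "Z * T = 1"
  shows "Z \<in> N"
proof (rule von_neumann_memI[OF assms(1)])
  fix b assume b: "b \<in> commutant N"
  have "Z * b = Z * (b * T) * Z" by (simp add: mult.assoc Z)
  also have "\<dots> = Z * T * (b * Z)" using von_neumann_commutes[OF assms(2) b] by (simp add: mult.assoc)
  finally show "Z * b = b * Z" by (simp add: Z)
qed

lemma von_neumann_strong_limit:
  assumes "von_neumann_algebra N" and "\<And>n. T n \<in> N" and lim: "\<And>x. (\<lambda>n. T n \<cdot> x) \<longlonglongrightarrow> L \<cdot> x"
  shows "L \<in> N"
proof (rule von_neumann_memI[OF assms(1)])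
  fix b assume b: "b \<in> commutant N"
  show "L * b = b * L"
  proof (rule bop_eqI)
    fix x
    have "(\<lambda>n. b \<cdot> T n \<cdot> x) \<longlonglongrightarrow> b \<cdot> L \<cdot> x"
      by (rule bounded_linear.tendsto[OF bounded_linear_bop_apply lim])
    moreover have "b \<cdot> T n \<cdot> x = T n \<cdot> b \<cdot> x" for n
      using von_neumann_commutes[OF assms(2) b] by (metis bop_apply_times)
    ultimately show "(L * b) \<cdot> x = (b * L) \<cdot> x"
      using lim[of "b \<cdot> x"] by (simp add: bop_apply_times LIMSEQ_unique)
  qed
qed

text \<open>For \<open>e > 0\<close> the operator
  \<open>((norm T)\<^sup>2 + e) *\<^sub>R 1 - T\<^sup>\<dagger> * T\<close> is coercive, and its
  root lies in \<open>M\<close>. Its image is therefore of the form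
  \<open>b\<^sup>\<dagger> * b\<close>, thus positive, and \<open>e\<close> tends to 0.\<close>

lemma star_hom_norm_le:
  assumes M: "von_neumann_algebra M" and \<alpha>: "star_hom M B \<alpha>" and T: "T \<in> M"
  shows "norm (\<alpha> T) \<le> norm T"
proof -
  interpret M: star_algebra M by (rule von_neumann_star_algebra[OF M])
  have le: "(norm (\<alpha> T \<cdot> x))\<^sup>2 \<le> ((norm T)\<^sup>2 + e) * (norm x)\<^sup>2" if "e > 0" for e x
  proof -
    define k where "k = (norm T)\<^sup>2 + e"
    define Q where "Q = k *\<^sub>R 1 - T\<^sup>\<dagger> * T"
    have QM: "Q \<in> M" by (simp add: Q_def M.diff M.scaleR M.one M.times M.adj T)
    have "coercive Q"
      unfolding coercive_def
    proof (intro conjI exI allI)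
      show "Q\<^sup>\<dagger> = Q" by (simp add: Q_def)
      show "e > 0" by fact
      fix y
      have "(norm (T \<cdot> y))\<^sup>2 \<le> (norm T)\<^sup>2 * (norm y)\<^sup>2"
        by (metis norm_bop_apply norm_ge_zero power_mono power_mult_distrib)
      then show "e * (norm y)\<^sup>2 \<le> inner y (Q \<cdot> y)"
        by (simp add: Q_def k_def bop_apply_diff_left bop_apply_scaleR_left bop_apply_one
            bop_apply_plus inner_add_right inner_diff_right norm_apply_adj_times power2_norm_eq_inner[symmetric] algebra_simps)
    qed
    note s = sqrt_bop_coercive[OF this] and sM = von_neumann_sqrt[OF M QM this]
    have ss: "(sqrt_bop Q)\<^sup>\<dagger> = sqrt_bop Q" using s(1) by (simp add: coercive_def)
    have "(\<alpha> (sqrt_bop Q))\<^sup>\<dagger> * \<alpha> (sqrt_bop Q) = \<alpha> (sqrt_bop Q * sqrt_bop Q)"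
      using \<alpha> sM ss by (simp add: star_hom_def) metis
    also have "\<dots> = \<alpha> Q" by (simp add: s(2))
    also have "\<alpha> Q = \<alpha> (complex_of_real k *\<^sub>C 1 + (-1) *\<^sub>C (T\<^sup>\<dagger> * T))"
      by (simp add: Q_def scaleR_bop_def scaleC_bop_minus_one)
    also have "\<dots> = complex_of_real k *\<^sub>C 1 + (-1) *\<^sub>C ((\<alpha> T)\<^sup>\<dagger> * \<alpha> T)"
      using \<alpha> T by (simp add: star_hom_def M.one M.times M.adj M.scaleC)
    also have "\<dots> = k *\<^sub>R 1 - (\<alpha> T)\<^sup>\<dagger> * \<alpha> T"
      by (simp add: scaleR_bop_def scaleC_bop_minus_one)
    finally have "inner x ((k *\<^sub>R 1 - (\<alpha> T)\<^sup>\<dagger> * \<alpha> T) \<cdot> x) = (norm (\<alpha> (sqrt_bop Q) \<cdot> x))\<^sup>2"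
      by (metis norm_apply_adj_times)
    moreover have "inner x ((k *\<^sub>R 1 - (\<alpha> T)\<^sup>\<dagger> * \<alpha> T) \<cdot> x) = k * (norm x)\<^sup>2 - (norm (\<alpha> T \<cdot> x))\<^sup>2"
      by (simp add: bop_apply_diff_left bop_apply_scaleR_left bop_apply_one
            inner_diff_right norm_apply_adj_times power2_norm_eq_inner[symmetric])
    ultimately show ?thesis using k_def by (metis diff_ge_0_iff_ge zero_le_power2)
  qed
  show ?thesis
  proof (rule norm_bop_bound)
    fix x
    have "(norm (\<alpha> T \<cdot> x))\<^sup>2 \<le> (norm T)\<^sup>2 * (norm x)\<^sup>2"
    proof (cases "x = 0")
      case False
      show ?thesis
      proof (rule field_le_epsilon)
        fix e :: real assume "e > 0"
        then show "(norm (\<alpha> T \<cdot> x))\<^sup>2 \<le> (norm T)\<^sup>2 * (norm x)\<^sup>2 + e"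
          using le[of "e / (norm x)\<^sup>2" x] False by (simp add: distrib_right)
      qed
    qed (simp add: bop_apply_zero)
    then show "norm (\<alpha> T \<cdot> x) \<le> norm T * norm x"
      by (metis norm_ge_zero mult_nonneg_nonneg power2_le_imp_le power_mult_distrib)
  qed simp
qed

text \<open>The numbers \<open>inner x (T n \<cdot> x)\<close> decrease and are bounded below.
  Cauchy-Schwarz for the positive operator \<open>T m - T n\<close> bounds the square of
  \<open>norm ((T m - T n) \<cdot> x)\<close> by \<open>norm (T 0)\<close> times a difference of
  these numbers.\<close>

lemma decreasing_bop_converges:
  fixes T :: "nat \<Rightarrow> 'h::chilbert_space bop"
  assumes sa: "\<And>n. (T n)\<^sup>\<dagger> = T n" and pos: "\<And>n x. 0 \<le> inner x (T n \<cdot> x)"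
    and dec: "\<And>n x. inner x (T (Suc n) \<cdot> x) \<le> inner x (T n \<cdot> x)"
  shows "\<exists>L. L\<^sup>\<dagger> = L \<and> (\<forall>x. (\<lambda>n. T n \<cdot> x) \<longlonglongrightarrow> L \<cdot> x)"
proof -
  have mono: "inner x (T n \<cdot> x) \<le> inner x (T m \<cdot> x)" if "m \<le> n" for m n x
    by (rule lift_Suc_antimono_le[OF _ that]) (rule dec)
  have T0: "inner x (T n \<cdot> x) \<le> norm (T 0) * (norm x)\<^sup>2" for x n
  proof -
    have "inner x (T n \<cdot> x) \<le> inner x (T 0 \<cdot> x)" by (rule mono) simp
    also have "\<dots> \<le> norm x * (norm (T 0) * norm x)"
      by (rule inner_bop_apply_le)
    finally show ?thesis by (simp add: power2_eq_square mult_ac)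
  qed
  have nT: "norm (T n) \<le> norm (T 0)" for n
    by (rule norm_positive_bop_le[OF sa pos T0]) simp
  have sq: "(norm ((T m - T n) \<cdot> x))\<^sup>2 \<le> norm (T 0) * (inner x (T m \<cdot> x) - inner x (T n \<cdot> x))"
    if "m \<le> n" for m n x
  proof -
    let ?S = "T m - T n"
    have S: "?S\<^sup>\<dagger> = ?S" "\<And>x. inner x (?S \<cdot> x) = inner x (T m \<cdot> x) - inner x (T n \<cdot> x)"
      by (simp_all add: sa bop_apply_diff_left inner_diff_right)
    have S0: "0 \<le> inner x (?S \<cdot> x)" for x using mono[OF that] by (simp add: S(2))
    have S1: "inner x (?S \<cdot> x) \<le> norm (T 0) * (norm x)\<^sup>2" for x
      using T0[of x m] pos[of x n] by (simp add: S(2))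
    let ?y = "?S \<cdot> x"
    show ?thesis
    proof (cases "?y = 0")
      case False
      have "(norm ?y)\<^sup>2 * (norm ?y)\<^sup>2 = (inner ?y (?S \<cdot> x))\<^sup>2"
        by (metis power2_eq_square power2_norm_eq_inner)
      also have "\<dots> \<le> inner ?y (?S \<cdot> ?y) * inner x (?S \<cdot> x)"
        by (rule Cauchy_Schwarz_bop[OF S(1) S0])
      also have "\<dots> \<le> (norm (T 0) * (norm ?y)\<^sup>2) * inner x (?S \<cdot> x)"
        by (intro mult_right_mono S1 S0)
      finally have "(norm ?y)\<^sup>2 * (norm ?y)\<^sup>2 \<le> (norm ?y)\<^sup>2 * (norm (T 0) * inner x (?S \<cdot> x))"
        by (simp only: mult_ac)
      moreover have "(norm ?y)\<^sup>2 > 0" using False by simp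
      ultimately show ?thesis unfolding S(2) by (rule mult_left_le_imp_le)
    next
      case True
      then have "inner x (T m \<cdot> x) - inner x (T n \<cdot> x) = 0" by (simp flip: S(2))
      then show ?thesis using True by simp
    qed
  qed
  have "convergent (\<lambda>n. T n \<cdot> x)" for x
  proof (rule Cauchy_convergent)
    have "convergent (\<lambda>n. inner x (T n \<cdot> x))"
      using decseq_convergent[of "\<lambda>n. inner x (T n \<cdot> x)" 0] mono pos
      by (metis decseq_def convergent_def)
    then have C: "Cauchy (\<lambda>n. inner x (T n \<cdot> x))" by (rule convergent_Cauchy)
    show "Cauchy (\<lambda>n. T n \<cdot> x)"
    proof (rule metric_CauchyI)
      fix e :: real assume e: "e > 0"
      have p: "0 < norm (T 0) + 1" by (simp add: add_nonneg_pos)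
      then have "0 < e\<^sup>2 / (norm (T 0) + 1)" using e by simp
      then obtain N where N: "\<And>m n. m \<ge> N \<Longrightarrow> n \<ge> N \<Longrightarrow>
          \<bar>inner x (T m \<cdot> x) - inner x (T n \<cdot> x)\<bar> < e\<^sup>2 / (norm (T 0) + 1)"
        using C unfolding Cauchy_def dist_real_def by blast
      have main: "norm (T m \<cdot> x - T n \<cdot> x) < e" if "N \<le> m" "m \<le> n" for m n
      proof -
        have "(norm (T m \<cdot> x - T n \<cdot> x))\<^sup>2 \<le> norm (T 0) * (inner x (T m \<cdot> x) - inner x (T n \<cdot> x))"
          using sq[OF that(2), of x] by (simp add: bop_apply_diff_left)
        also have "\<dots> \<le> (norm (T 0) + 1) * (inner x (T m \<cdot> x) - inner x (T n \<cdot> x))"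
          using mono[OF that(2), of x] by (intro mult_right_mono) auto
        also have "\<dots> < e\<^sup>2"
          using N[of m n] that p mono[OF that(2), of x]
          by (simp add: pos_less_divide_eq mult.commute abs_of_nonneg)
        finally show ?thesis using e by (simp add: power2_less_imp_less)
      qed
      have "dist (T m \<cdot> x) (T n \<cdot> x) < e" if "N \<le> m" "N \<le> n" for m n
        using main[of m n] main[of n m] that
        by (cases "m \<le> n") (simp_all add: dist_norm norm_minus_commute)
      then show "\<exists>M. \<forall>m\<ge>M. \<forall>n\<ge>M. dist (T m \<cdot> x) (T n \<cdot> x) < e" by blast
    qed
  qed
  then obtain f where f: "\<And>x. (\<lambda>n. T n \<cdot> x) \<longlonglongrightarrow> f x"
    unfolding convergent_def by metis
  have "\<exists>L. \<forall>x. L \<cdot> x = f x"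
  proof (rule bop_of_function)
    show "f (x + y) = f x + f y" for x y
      using LIMSEQ_unique[OF f tendsto_add[OF f f, of x y, folded bop_apply_add]] .
    show "f (c *\<^sub>C x) = c *\<^sub>C f x" for c x
      using LIMSEQ_unique[OF f bounded_linear.tendsto[OF bounded_linear_scaleC f, of c x,
          folded bop_apply_scaleC]] .
    show "norm (f x) \<le> norm (T 0) * norm x" for x
    proof (rule LIMSEQ_le_const2[OF tendsto_norm[OF f]], intro exI allI impI)
      show "norm (T n \<cdot> x) \<le> norm (T 0) * norm x" for n
        using order_trans[OF norm_bop_apply mult_right_mono[OF nT norm_ge_zero]] .
    qed
  qed
  then obtain L where L: "\<And>x. L \<cdot> x = f x" by blast
  have "L\<^sup>\<dagger> = L"
  proof (rule adj_eqI)
    fix x y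
    have "(\<lambda>n. inner (T n \<cdot> x) y) \<longlonglongrightarrow> inner (L \<cdot> x) y" unfolding L by (intro tendsto_intros f)
    moreover have "(\<lambda>n. inner x (T n \<cdot> y)) \<longlonglongrightarrow> inner x (L \<cdot> y)" unfolding L by (intro tendsto_intros f)
    moreover have "inner (T n \<cdot> x) y = inner x (T n \<cdot> y)" for n by (metis inner_adj sa)
    ultimately show "inner (L \<cdot> x) y = inner x (L \<cdot> y)" by (simp add: LIMSEQ_unique)
  qed
  then show ?thesis using f L by metis
qed

text \<open>Cauchy-Schwarz for the form of \<open>P\<close> at \<open>Q' \<cdot> x\<close> and
  \<open>P' \<cdot> x\<close>, followed by \<open>P \<le> Q\<close> at the first vector, gives
  \<open>a * a \<le> a * b\<close> for the two quantities \<open>a\<close> and \<open>b\<close> to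
  be compared.\<close>

lemma coercive_inverse_antimono:
  assumes P: "coercive P" "P * P' = 1" "P' * P = 1" and Q: "coercive Q" "Q * Q' = 1" "Q' * Q = 1"
    and le: "\<And>x. inner x (P \<cdot> x) \<le> inner x (Q \<cdot> x)"
  shows "inner x (Q' \<cdot> x) \<le> inner x (P' \<cdot> x)"
proof -
  let ?y = "Q' \<cdot> x" and ?z = "P' \<cdot> x"
  have Pz: "P \<cdot> ?z = x" and Qy: "Q \<cdot> ?y = x"
    using P Q by (metis bop_apply_one bop_apply_times)+
  have "(inner x ?y)\<^sup>2 = (inner ?y (P \<cdot> ?z))\<^sup>2" by (simp only: Pz inner_commute)
  also have "\<dots> \<le> inner ?y (P \<cdot> ?y) * inner ?z (P \<cdot> ?z)"
    using P(1) by (intro Cauchy_Schwarz_bop coercive_nonneg) (auto simp: coercive_def)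
  also have "\<dots> \<le> inner ?y (Q \<cdot> ?y) * inner ?z (P \<cdot> ?z)"
    by (intro mult_right_mono le coercive_nonneg P)
  also have "\<dots> = inner x ?y * inner x ?z" by (simp only: Pz Qy inner_commute)
  finally have *: "inner x ?y * inner x ?y \<le> inner x ?y * inner x ?z" by (simp add: power2_eq_square)
  have "0 \<le> inner x ?y" "0 \<le> inner x ?z"
    using coercive_inverse(2)[OF P] coercive_inverse(2)[OF Q] by auto
  then show ?thesis using * by (cases "inner x ?y = 0") auto
qed

subsection \<open>Square-summable sequences and amplification\<close>

text \<open>One vector here packs countably many vectors of \<open>'h\<close>. Density of an algebra
  at a single vector of this space is therefore simultaneous approximation on a whole
  sequence.\<close>

typedef (overloaded) 'h ell2 = "{f :: nat \<Rightarrow> 'h::chilbert_space. summable (\<lambda>i. (norm (f i))\<^sup>2)}"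
  morphisms coord Ell2
  by (rule exI[of _ "\<lambda>_. 0"]) simp

setup_lifting type_definition_ell2

lemma summable_coord: "summable (\<lambda>i. (norm (coord x i))\<^sup>2)"
  using coord[of x] by simp

lemma summable_square_add:
  fixes f g :: "nat \<Rightarrow> 'h::real_inner"
  assumes "summable (\<lambda>i. (norm (f i))\<^sup>2)" "summable (\<lambda>i. (norm (g i))\<^sup>2)"
  shows "summable (\<lambda>i. (norm (f i + g i))\<^sup>2)"
proof (rule summable_comparison_test')
  show "summable (\<lambda>i. 2 * (norm (f i))\<^sup>2 + 2 * (norm (g i))\<^sup>2)"
    using assms by (intro summable_add summable_mult)
  fix i
  have "(norm (f i + g i))\<^sup>2 \<le> (norm (f i) + norm (g i))\<^sup>2"
    by (simp add: norm_triangle_ineq power_mono)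
  also have "\<dots> \<le> 2 * (norm (f i))\<^sup>2 + 2 * (norm (g i))\<^sup>2"
    using sum_squares_bound[of "norm (f i)" "norm (g i)"] by (simp add: power2_sum)
  finally show "norm ((norm (f i + g i))\<^sup>2) \<le> 2 * (norm (f i))\<^sup>2 + 2 * (norm (g i))\<^sup>2" by simp
qed

lemma summable_square_scaled:
  fixes f :: "nat \<Rightarrow> 'h::real_inner"
  assumes "summable (\<lambda>i. (norm (f i))\<^sup>2)" and "\<And>i. norm (g i) \<le> K * norm (f i)"
  shows "summable (\<lambda>i. (norm (g i))\<^sup>2)"
proof (rule summable_comparison_test')
  show "summable (\<lambda>i. K\<^sup>2 * (norm (f i))\<^sup>2)" using assms(1) by (rule summable_mult)
  show "norm ((norm (g i))\<^sup>2) \<le> K\<^sup>2 * (norm (f i))\<^sup>2" for i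
    using power_mono[OF assms(2)[of i] norm_ge_zero, of 2] by (simp add: power_mult_distrib)
qed

lemma summable_inner_square:
  fixes f g :: "nat \<Rightarrow> 'h::real_inner"
  assumes "summable (\<lambda>i. (norm (f i))\<^sup>2)" "summable (\<lambda>i. (norm (g i))\<^sup>2)"
  shows "summable (\<lambda>i. inner (f i) (g i))"
proof (rule summable_comparison_test')
  show "summable (\<lambda>i. (norm (f i))\<^sup>2 + (norm (g i))\<^sup>2)"
    using assms by (intro summable_add)
  fix i
  have "\<bar>inner (f i) (g i)\<bar> \<le> norm (f i) * norm (g i)" by (rule Cauchy_Schwarz_ineq2)
  also have "\<dots> \<le> (norm (f i))\<^sup>2 + (norm (g i))\<^sup>2"
    using sum_squares_bound[of "norm (f i)" "norm (g i)"]
      mult_nonneg_nonneg[OF norm_ge_zero norm_ge_zero, of "f i" "g i"] by linarith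
  finally show "norm (inner (f i) (g i)) \<le> (norm (f i))\<^sup>2 + (norm (g i))\<^sup>2" by simp
qed

lemma ell2_eqI: "(\<And>i. coord x i = coord y i) \<Longrightarrow> x = y"
  by (simp add: coord_inject[symmetric] ext)

instantiation ell2 :: (chilbert_space) real_inner
begin

lift_definition zero_ell2 :: "'a ell2" is "\<lambda>_. 0" by simp

lift_definition plus_ell2 :: "'a ell2 \<Rightarrow> 'a ell2 \<Rightarrow> 'a ell2" is "\<lambda>f g i. f i + g i"
  by (rule summable_square_add)

lift_definition uminus_ell2 :: "'a ell2 \<Rightarrow> 'a ell2" is "\<lambda>f i. - f i" by simp

lift_definition minus_ell2 :: "'a ell2 \<Rightarrow> 'a ell2 \<Rightarrow> 'a ell2" is "\<lambda>f g i. f i - g i"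
  using summable_square_add[where g = "\<lambda>i. - g i" for g] by simp

lift_definition scaleR_ell2 :: "real \<Rightarrow> 'a ell2 \<Rightarrow> 'a ell2" is "\<lambda>r f i. r *\<^sub>R f i"
  subgoal for r f by (rule summable_square_scaled[of f _ "\<bar>r\<bar>"]) simp_all
  done

definition inner_ell2 :: "'a ell2 \<Rightarrow> 'a ell2 \<Rightarrow> real" where
  "inner_ell2 x y = (\<Sum>i. inner (coord x i) (coord y i))"

definition norm_ell2 :: "'a ell2 \<Rightarrow> real" where
  "norm_ell2 x = sqrt (inner x x)"

definition sgn_ell2 :: "'a ell2 \<Rightarrow> 'a ell2" where
  "sgn_ell2 x = inverse (norm x) *\<^sub>R x"

definition dist_ell2 :: "'a ell2 \<Rightarrow> 'a ell2 \<Rightarrow> real" where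
  "dist_ell2 x y = norm (x - y)"

definition uniformity_ell2 :: "('a ell2 \<times> 'a ell2) filter" where
  "uniformity_ell2 = (INF e\<in>{0 <..}. principal {(x, y). dist x y < e})"

definition open_ell2 :: "'a ell2 set \<Rightarrow> bool" where
  "open_ell2 U = (\<forall>x\<in>U. \<forall>\<^sub>F (x', y) in uniformity. x' = x \<longrightarrow> y \<in> U)"

lemmas coord_simps = zero_ell2.rep_eq plus_ell2.rep_eq uminus_ell2.rep_eq minus_ell2.rep_eq
  scaleR_ell2.rep_eq

lemma summable_inner_coord: "summable (\<lambda>i. inner (coord x i) (coord y i))"
  by (intro summable_inner_square summable_coord)

instance
proof
  fix x y z :: "'a ell2" and r s :: real
  show "x + y + z = x + (y + z)" by (rule ell2_eqI) (simp add: coord_simps add.assoc)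
  show "x + y = y + x" by (rule ell2_eqI) (simp add: coord_simps add.commute)
  show "0 + x = x" by (rule ell2_eqI) (simp add: coord_simps)
  show "- x + x = 0" by (rule ell2_eqI) (simp add: coord_simps)
  show "x - y = x + - y" by (rule ell2_eqI) (simp add: coord_simps)
  show "r *\<^sub>R (x + y) = r *\<^sub>R x + r *\<^sub>R y" by (rule ell2_eqI) (simp add: coord_simps scaleR_add_right)
  show "(r + s) *\<^sub>R x = r *\<^sub>R x + s *\<^sub>R x" by (rule ell2_eqI) (simp add: coord_simps scaleR_add_left)
  show "r *\<^sub>R s *\<^sub>R x = (r * s) *\<^sub>R x" by (rule ell2_eqI) (simp add: coord_simps)
  show "1 *\<^sub>R x = x" by (rule ell2_eqI) (simp add: coord_simps)
  show "inner x y = inner y x" by (simp add: inner_ell2_def inner_commute)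
  show "inner (x + y) z = inner x z + inner y z"
    by (simp add: inner_ell2_def coord_simps inner_add_left suminf_add summable_inner_coord)
  show "inner (r *\<^sub>R x) y = r * inner x y"
    by (simp add: inner_ell2_def coord_simps suminf_mult summable_inner_coord)
  show "0 \<le> inner x x"
    by (simp add: inner_ell2_def suminf_nonneg summable_inner_coord)
  show "inner x x = 0 \<longleftrightarrow> x = 0"
  proof
    assume "inner x x = 0"
    then have "inner (coord x i) (coord x i) = 0" for i
      using suminf_eq_zero_iff[OF summable_inner_coord, of x x] by (simp add: inner_ell2_def)
    then show "x = 0" by (intro ell2_eqI) (simp add: coord_simps)
  qed (simp add: inner_ell2_def coord_simps)
qed (simp_all add: norm_ell2_def sgn_ell2_def dist_ell2_def uniformity_ell2_def open_ell2_def)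

end

lemma norm_ell2_sq: "(norm x)\<^sup>2 = (\<Sum>i. (norm (coord x i))\<^sup>2)"
  by (simp add: power2_norm_eq_inner inner_ell2_def)

lemma norm_coord_le: "norm (coord x i) \<le> norm x"
proof -
  have "(norm (coord x i))\<^sup>2 \<le> (norm x)\<^sup>2"
    using sum_le_suminf[OF summable_coord, of "{i}" x] by (simp add: norm_ell2_sq)
  then show ?thesis by (rule power2_le_imp_le) simp
qed

lemma norm_ell2_le:
  assumes "\<And>n. (\<Sum>i<n. (norm (coord x i))\<^sup>2) \<le> K\<^sup>2" and "0 \<le> K"
  shows "norm x \<le> K"
proof -
  have "(norm x)\<^sup>2 \<le> K\<^sup>2"
    unfolding norm_ell2_sq by (intro suminf_le_const summable_coord assms)
  then show ?thesis using assms(2) by (rule power2_le_imp_le)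
qed

instance ell2 :: (chilbert_space) banach
proof
  fix X :: "nat \<Rightarrow> 'a ell2"
  assume X: "Cauchy X"
  have "Cauchy (\<lambda>n. coord (X n) i)" for i
  proof (rule metric_CauchyI)
    fix e :: real assume "e > 0"
    then obtain N where "\<And>m n. m \<ge> N \<Longrightarrow> n \<ge> N \<Longrightarrow> dist (X m) (X n) < e"
      using X unfolding Cauchy_def by blast
    moreover have "dist (coord x i) (coord y i) \<le> dist x y" for x y :: "'a ell2"
      using norm_coord_le[of "x - y" i] by (simp add: dist_norm coord_simps)
    ultimately show "\<exists>M. \<forall>m\<ge>M. \<forall>n\<ge>M. dist (coord (X m) i) (coord (X n) i) < e"
      using le_less_trans by blast
  qed
  then have "\<forall>i. \<exists>l. (\<lambda>n. coord (X n) i) \<longlonglongrightarrow> l"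
    using Cauchy_convergent unfolding convergent_def by blast
  then obtain L where L: "\<And>i. (\<lambda>n. coord (X n) i) \<longlonglongrightarrow> L i" by metis
  have part: "\<exists>N. \<forall>m\<ge>N. \<forall>k. (\<Sum>i<k. (norm (coord (X m) i - L i))\<^sup>2) \<le> e\<^sup>2" if e: "e > 0" for e
  proof -
    obtain N where N: "\<And>m n. m \<ge> N \<Longrightarrow> n \<ge> N \<Longrightarrow> dist (X m) (X n) < e"
      using X e unfolding Cauchy_def by blast
    have "(\<Sum>i<k. (norm (coord (X m) i - L i))\<^sup>2) \<le> e\<^sup>2" if m: "m \<ge> N" for m k
    proof (rule LIMSEQ_le_const2)
      show "(\<lambda>n. \<Sum>i<k. (norm (coord (X m) i - coord (X n) i))\<^sup>2) \<longlonglongrightarrow>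
          (\<Sum>i<k. (norm (coord (X m) i - L i))\<^sup>2)"
        by (intro tendsto_intros L)
      have "(\<Sum>i<k. (norm (coord (X m) i - coord (X n) i))\<^sup>2) \<le> e\<^sup>2" if n: "n \<ge> N" for n
      proof -
        have "(\<Sum>i<k. (norm (coord (X m - X n) i))\<^sup>2) \<le> (norm (X m - X n))\<^sup>2"
          unfolding norm_ell2_sq by (intro sum_le_suminf summable_coord) auto
        also have "\<dots> \<le> e\<^sup>2" using N[OF m n] by (intro power_mono) (auto simp: dist_norm)
        finally show ?thesis by (simp add: coord_simps)
      qed
      then show "\<exists>N. \<forall>n\<ge>N. (\<Sum>i<k. (norm (coord (X m) i - coord (X n) i))\<^sup>2) \<le> e\<^sup>2" by blast
    qed
    then show ?thesis by blast
  qed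
  obtain N where N: "\<And>k. (\<Sum>i<k. (norm (coord (X N) i - L i))\<^sup>2) \<le> 1"
    using part[of 1] by auto
  have "summable (\<lambda>i. (norm (coord (X N) i - L i))\<^sup>2)"
    by (rule summableI_nonneg_bounded[OF _ N]) simp
  then have "summable (\<lambda>i. (norm (coord (X N) i + - (coord (X N) i - L i)))\<^sup>2)"
    by (intro summable_square_add summable_coord) (simp add: norm_minus_commute)
  then have cL: "coord (Ell2 L) = L" by (simp add: Ell2_inverse)
  have "X \<longlonglongrightarrow> Ell2 L"
    unfolding lim_sequentially
  proof (intro allI impI)
    fix e :: real assume "e > 0"
    then obtain N where N: "\<And>m k. m \<ge> N \<Longrightarrow> (\<Sum>i<k. (norm (coord (X m) i - L i))\<^sup>2) \<le> (e / 2)\<^sup>2"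
      using part[of "e / 2"] by auto
    have "dist (X m) (Ell2 L) < e" if "m \<ge> N" for m
    proof -
      have "norm (X m - Ell2 L) \<le> e / 2"
        using N[OF that] \<open>e > 0\<close> by (intro norm_ell2_le) (simp_all add: coord_simps cL)
      then show ?thesis using \<open>e > 0\<close> by (simp add: dist_norm)
    qed
    then show "\<exists>N. \<forall>n\<ge>N. dist (X n) (Ell2 L) < e" by blast
  qed
  then show "convergent X" by (auto simp: convergent_def)
qed

instantiation ell2 :: (chilbert_space) chilbert_space
begin

lift_definition scaleC_ell2 :: "complex \<Rightarrow> 'a ell2 \<Rightarrow> 'a ell2" is "\<lambda>c f i. c *\<^sub>C f i"
  subgoal for c f by (rule summable_square_scaled[of f _ "cmod c"]) (simp_all add: norm_scaleC)
  done

definition cinner_ell2 :: "'a ell2 \<Rightarrow> 'a ell2 \<Rightarrow> complex" where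
  "cinner_ell2 x y = (\<Sum>i. cinner (coord x i) (coord y i))"

lemma summable_cinner_coord: "summable (\<lambda>i. cinner (coord x i) (coord y i))"
proof -
  have "summable (\<lambda>i. inner (coord x i) (coord y i))" by (rule summable_inner_coord)
  moreover have "summable (\<lambda>i. (norm (\<i> *\<^sub>C coord y i))\<^sup>2)"
    by (rule summable_square_scaled[OF summable_coord[of y], of _ 1]) (simp add: norm_scaleC)
  then have "summable (\<lambda>i. - inner (coord x i) (\<i> *\<^sub>C coord y i))"
    by (intro summable_minus summable_inner_square summable_coord)
  ultimately show ?thesis
    by (simp only: summable_complex_iff Re_cinner Im_cinner simp_thms)
qed

instance
proof
  fix x y z :: "'a ell2" and c d :: complex and r :: real
  show "c *\<^sub>C (x + y) = c *\<^sub>C x + c *\<^sub>C y"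
    by (rule ell2_eqI) (simp add: scaleC_ell2.rep_eq coord_simps scaleC_add_right)
  show "(c + d) *\<^sub>C x = c *\<^sub>C x + d *\<^sub>C x"
    by (rule ell2_eqI) (simp add: scaleC_ell2.rep_eq coord_simps scaleC_add_left)
  show "c *\<^sub>C d *\<^sub>C x = (c * d) *\<^sub>C x"
    by (rule ell2_eqI) (simp add: scaleC_ell2.rep_eq scaleC_scaleC)
  show "r *\<^sub>R x = complex_of_real r *\<^sub>C x"
    by (rule ell2_eqI) (simp add: scaleC_ell2.rep_eq coord_simps scaleR_scaleC)
  show "cinner x y = cnj (cinner y x)"
    unfolding cinner_ell2_def
  proof (rule sums_unique[symmetric])
    have "(\<lambda>i. cnj (cinner (coord y i) (coord x i))) sums cnj (\<Sum>i. cinner (coord y i) (coord x i))"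
      unfolding sums_cnj by (rule summable_sums[OF summable_cinner_coord])
    then show "(\<lambda>i. cinner (coord x i) (coord y i)) sums cnj (\<Sum>i. cinner (coord y i) (coord x i))"
      by (rule back_subst[of "\<lambda>f. f sums _"]) (intro ext cinner_commute[symmetric])
  qed
  show "cinner x (y + z) = cinner x y + cinner x z"
    by (simp add: cinner_ell2_def coord_simps cinner_add_right suminf_add summable_cinner_coord)
  show "cinner x (c *\<^sub>C y) = c * cinner x y"
    by (simp add: cinner_ell2_def scaleC_ell2.rep_eq cinner_scaleC_right suminf_mult summable_cinner_coord)
  show "Re (cinner x y) = inner x y"
    by (simp add: cinner_ell2_def inner_ell2_def Re_suminf summable_cinner_coord Re_cinner)
qed

end

lift_definition single :: "nat \<Rightarrow> 'h::chilbert_space \<Rightarrow> 'h ell2" is "\<lambda>j x i. if i = j then x else 0"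
  using summable_single[of _ "\<lambda>_. (norm _)\<^sup>2"] by (simp add: if_distrib[of "\<lambda>x. (norm x)\<^sup>2"] cong: if_cong)

lemma inner_single: "inner x (single j z) = inner (coord x j) z"
proof -
  have "inner x (single j z) = (\<Sum>i. if i = j then inner (coord x j) z else 0)"
    unfolding inner_ell2_def single.rep_eq by (intro arg_cong[of _ _ suminf] ext) simp
  then show ?thesis using sums_single[of j "\<lambda>_. inner (coord x j) z"] by (simp add: sums_iff)
qed

lemma norm_single: "norm (single j z) = norm z"
  by (simp add: norm_eq_sqrt_inner inner_single single.rep_eq)

text \<open>Passing to adjoints replaces the density of finitely supported sequences: coordinate
  \<open>j\<close> of \<open>S\<^sup>\<dagger> \<cdot> x\<close> is determined by inner products of
  \<open>x\<close> with vectors \<open>S \<cdot> single j z\<close>.\<close>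

lemma bop_ell2_eqI:
  assumes "\<And>i j z. coord (S \<cdot> single j z) i = coord (T \<cdot> single j z) i"
  shows "S = (T :: 'h::chilbert_space ell2 bop)"
proof -
  have *: "S \<cdot> single j z = T \<cdot> single j z" for j z by (intro ell2_eqI assms)
  have "S\<^sup>\<dagger> = T\<^sup>\<dagger>"
  proof (rule bop_eqI)
    fix x
    show "S\<^sup>\<dagger> \<cdot> x = T\<^sup>\<dagger> \<cdot> x"
    proof (rule ell2_eqI)
      fix j
      show "coord (S\<^sup>\<dagger> \<cdot> x) j = coord (T\<^sup>\<dagger> \<cdot> x) j"
        by (rule inner_eqI) (simp add: inner_adj * flip: inner_single)
    qed
  qed
  then show ?thesis by (simp add: adj_eq_iff)
qed

text \<open>The diagonal operator with \<open>T\<close> in every coordinate. The condition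
  determines \<open>U\<close> completely, so the choice is harmless once existence is shown in
  \<open>coord_amp\<close>.\<close>

definition amp :: "'h::chilbert_space bop \<Rightarrow> 'h ell2 bop" where
  "amp T = (SOME U. \<forall>x. coord (U \<cdot> x) = (\<lambda>i. T \<cdot> coord x i))"

lemma coord_amp [simp]: "coord (amp T \<cdot> x) i = T \<cdot> coord x i"
proof -
  define f where "f x = Ell2 (\<lambda>i. T \<cdot> coord x i)" for x
  have s: "summable (\<lambda>i. (norm (T \<cdot> coord x i))\<^sup>2)" for x
    by (rule summable_square_scaled[OF summable_coord norm_bop_apply])
  then have f: "coord (f x) = (\<lambda>i. T \<cdot> coord x i)" for x
    by (simp add: f_def Ell2_inverse)
  have "\<exists>U. \<forall>x. U \<cdot> x = f x"
  proof (rule bop_of_function)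
    show "f (x + y) = f x + f y" for x y
      by (rule ell2_eqI) (simp add: f coord_simps bop_apply_add)
    show "f (c *\<^sub>C x) = c *\<^sub>C f x" for c x
      by (rule ell2_eqI) (simp add: f scaleC_ell2.rep_eq bop_apply_scaleC)
    show "norm (f x) \<le> norm T * norm x" for x
    proof (rule norm_ell2_le)
      fix n
      have "(\<Sum>i<n. (norm (coord (f x) i))\<^sup>2) \<le> (\<Sum>i<n. (norm T)\<^sup>2 * (norm (coord x i))\<^sup>2)"
        unfolding f
        by (intro sum_mono) (metis norm_bop_apply norm_ge_zero power_mono power_mult_distrib)
      also have "\<dots> = (norm T)\<^sup>2 * (\<Sum>i<n. (norm (coord x i))\<^sup>2)" by (simp add: sum_distrib_left)
      also have "\<dots> \<le> (norm T)\<^sup>2 * (norm x)\<^sup>2"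
        unfolding norm_ell2_sq by (intro mult_left_mono sum_le_suminf summable_coord) auto
      finally show "(\<Sum>i<n. (norm (coord (f x) i))\<^sup>2) \<le> (norm T * norm x)\<^sup>2"
        by (simp add: power_mult_distrib)
    qed simp
  qed
  then have "\<exists>U. \<forall>x. coord (U \<cdot> x) = (\<lambda>i. T \<cdot> coord x i)" using f by metis
  then have "\<forall>x. coord (amp T \<cdot> x) = (\<lambda>i. T \<cdot> coord x i)" unfolding amp_def by (rule someI_ex)
  then show ?thesis by simp
qed

lemma amp_times: "amp (S * T) = amp S * amp T"
  by (rule bop_eqI, rule ell2_eqI) (simp add: bop_apply_times)

lemma amp_adj: "amp (T\<^sup>\<dagger>) = (amp T)\<^sup>\<dagger>"
  by (rule adj_eqI[symmetric]) (simp add: inner_ell2_def inner_adj)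

lemma amp_plus: "amp (S + T) = amp S + amp T"
  by (rule bop_eqI, rule ell2_eqI) (simp add: bop_apply_plus coord_simps)

lemma amp_diff: "amp (S - T) = amp S - amp T"
  by (rule bop_eqI, rule ell2_eqI) (simp add: bop_apply_diff_left coord_simps)

lemma amp_scaleC: "amp (c *\<^sub>C T) = c *\<^sub>C amp T"
  by (rule bop_eqI, rule ell2_eqI) (simp add: bop_apply_scaleC_left scaleC_ell2.rep_eq)

lemma amp_one: "amp 1 = 1"
  by (rule bop_eqI, rule ell2_eqI) (simp add: bop_apply_one)

lemma amp_single: "amp T \<cdot> single j z = single j (T \<cdot> z)"
  by (rule ell2_eqI) (simp add: single.rep_eq bop_apply_zero)

lemma matrix_coefficient_exists: "\<exists>t. \<forall>z. t \<cdot> z = coord (U \<cdot> single j z) i"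
proof (rule bop_of_function)
  have "single j (x + y) = single j x + single j y" for x y :: 'a
    by (rule ell2_eqI) (simp add: single.rep_eq coord_simps)
  then show "coord (U \<cdot> single j (x + y)) i = coord (U \<cdot> single j x) i + coord (U \<cdot> single j y) i" for x y
    by (simp add: bop_apply_add coord_simps)
  have "single j (c *\<^sub>C x) = c *\<^sub>C single j x" for c and x :: 'a
    by (rule ell2_eqI) (simp add: single.rep_eq scaleC_ell2.rep_eq scaleC_zero_right)
  then show "coord (U \<cdot> single j (c *\<^sub>C x)) i = c *\<^sub>C coord (U \<cdot> single j x) i" for c x
    by (simp add: bop_apply_scaleC scaleC_ell2.rep_eq)
  show "norm (coord (U \<cdot> single j x) i) \<le> norm U * norm x" for x
    using order_trans[OF norm_coord_le norm_bop_apply, of U "single j x" i] by (simp add: norm_single)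
qed

lemma amp_bicommutant:
  assumes "D \<in> commutant (commutant A)"
  shows "amp D \<in> commutant (commutant (amp ` A))"
proof -
  have "amp D * U = U * amp D" if U: "U \<in> commutant (amp ` A)" for U
  proof (rule bop_ell2_eqI)
    fix i j z
    obtain t where t: "\<And>z. t \<cdot> z = coord (U \<cdot> single j z) i"
      using matrix_coefficient_exists by metis
    have "t * a = a * t" if "a \<in> A" for a
    proof (rule bop_eqI)
      fix x
      have "U * amp a = amp a * U" using U that by (simp add: commutant_def)
      then show "(t * a) \<cdot> x = (a * t) \<cdot> x"
        by (metis bop_apply_times t amp_single coord_amp)
    qed
    then have "D * t = t * D" using assms by (simp add: commutant_def)
    then show "coord ((amp D * U) \<cdot> single j z) i = coord ((U * amp D) \<cdot> single j z) i"
      by (metis bop_apply_times t amp_single coord_amp)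
  qed
  then show ?thesis by (simp add: commutant_def)
qed

lemma star_algebra_amp:
  assumes "star_algebra A"
  shows "star_algebra (amp ` A)"
proof -
  interpret star_algebra A by fact
  show ?thesis
    by standard
      (use one add times scaleC adj in \<open>auto simp flip: amp_plus amp_times amp_scaleC amp_adj amp_one\<close>)
qed

subsection \<open>The bicommutant density theorem\<close>

lemma subspace_closure:
  fixes W :: "'a::real_normed_vector set"
  assumes "subspace W"
  shows "subspace (closure W)"
  unfolding subspace_def
proof (intro conjI ballI allI)
  show "0 \<in> closure W" using subspace_0[OF assms] closure_subset by blast
  fix x y r assume x: "x \<in> closure W"
  then obtain f where f: "\<And>n. f n \<in> W" "f \<longlonglongrightarrow> x" unfolding closure_sequential by blast
  show "r *\<^sub>R x \<in> closure W"
    unfolding closure_sequential using f assms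
    by (intro exI[of _ "\<lambda>n. r *\<^sub>R f n"]) (auto intro: tendsto_intros subspace_mul)
  assume "y \<in> closure W"
  then obtain g where g: "\<And>n. g n \<in> W" "g \<longlonglongrightarrow> y" unfolding closure_sequential by blast
  show "x + y \<in> closure W"
    unfolding closure_sequential using f g assms
    by (intro exI[of _ "\<lambda>n. f n + g n"]) (auto intro: tendsto_intros subspace_add)
qed

text \<open>The closed orbit of \<open>x\<close> is invariant under \<open>A\<close>, which contains
  adjoints, so the projection onto it commutes with \<open>A\<close>.\<close>

lemma cyclic_projection_exists:
  assumes "star_algebra A"
  shows "\<exists>p\<in>commutant A. p\<^sup>\<dagger> = p \<and> p * p = p \<and> p \<cdot> x = x \<and> (\<forall>y. p \<cdot> y \<in> closure {a \<cdot> x | a. a \<in> A})"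
proof -
  interpret A: star_algebra A by fact
  let ?W = "{a \<cdot> x | a. a \<in> A}"
  let ?V = "closure ?W"
  have W: "subspace ?W"
    unfolding subspace_def
  proof (safe)
    show "\<exists>a. 0 = a \<cdot> x \<and> a \<in> A" using A.zero by (intro exI[of _ 0]) (simp add: bop_apply_zero_left)
  qed (auto simp flip: bop_apply_plus bop_apply_scaleR_left intro: A.add A.scaleR)
  have AV: "a \<cdot> y \<in> ?V" if a: "a \<in> A" and y: "y \<in> ?V" for a y
  proof -
    obtain f where f: "\<And>n. f n \<in> ?W" "f \<longlonglongrightarrow> y" using y unfolding closure_sequential by blast
    have "(\<lambda>n. a \<cdot> f n) \<longlonglongrightarrow> a \<cdot> y"
      by (rule bounded_linear.tendsto[OF bounded_linear_bop_apply f(2)])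
    moreover have "a \<cdot> f n \<in> ?W" for n
      using f(1)[of n] a by (auto simp flip: bop_apply_times intro: A.times)
    ultimately show ?thesis
      unfolding closure_sequential by (intro exI[of _ "\<lambda>n. a \<cdot> f n"] conjI allI)
  qed
  have "c *\<^sub>C y \<in> ?V" if "y \<in> ?V" for c y
    using AV[OF A.scaleC[OF A.one, of c] that] by (simp add: bop_apply_scaleC_left bop_apply_one)
  then have "\<exists>p. p\<^sup>\<dagger> = p \<and> (\<forall>y. p \<cdot> y \<in> ?V) \<and> (\<forall>v\<in>?V. p \<cdot> v = v) \<and>
      (\<forall>T. (\<forall>v\<in>?V. T \<cdot> v \<in> ?V) \<and> (\<forall>v\<in>?V. T\<^sup>\<dagger> \<cdot> v \<in> ?V) \<longrightarrow> p * T = T * p)"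
    by (intro projection_bop_exists subspace_closure W closed_closure)
  then obtain p where p: "p\<^sup>\<dagger> = p" "\<And>y. p \<cdot> y \<in> ?V" "\<And>y. y \<in> ?V \<Longrightarrow> p \<cdot> y = y"
    and pT: "\<And>T. (\<forall>v\<in>?V. T \<cdot> v \<in> ?V) \<and> (\<forall>v\<in>?V. T\<^sup>\<dagger> \<cdot> v \<in> ?V) \<Longrightarrow> p * T = T * p"
    by (elim exE conjE) fast
  have "p \<in> commutant A" using AV A.adj by (auto simp: commutant_def intro!: pT)
  moreover have "p * p = p" by (rule bop_eqI) (simp add: bop_apply_times p)
  moreover have "p \<cdot> x = x"
    by (rule p(3), rule subsetD[OF closure_subset]) (use A.one bop_apply_one[of x] in force)
  ultimately show ?thesis using p by blast
qed

text \<open>\<open>D\<close> commutes with the cyclic projection \<open>p\<close> of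
  \<open>x\<close>, so \<open>D \<cdot> x = D \<cdot> p \<cdot> x\<close> is in the range of
  \<open>p\<close>.\<close>

lemma bicommutant_dense:
  assumes A: "star_algebra A" and D: "D \<in> commutant (commutant A)"
  shows "D \<cdot> x \<in> closure {a \<cdot> x | a. a \<in> A}"
proof -
  obtain p where p: "p \<in> commutant A" "p \<cdot> x = x" "\<And>y. p \<cdot> y \<in> closure {a \<cdot> x | a. a \<in> A}"
    using cyclic_projection_exists[OF A, of x] by blast
  then have "p * D = D * p" using D by (simp add: commutant_def)
  then have "(p * D) \<cdot> x = (D * p) \<cdot> x" by (rule arg_cong)
  then have "D \<cdot> x = p \<cdot> D \<cdot> x" by (simp add: bop_apply_times p)
  then show ?thesis by (rule ssubst) (rule p(3))
qed

text \<open>A vector \<open>\<eta>\<close> orthogonal to all \<open>a \<cdot> x\<close> with self-adjoint \<open>a\<close> gives a functional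
  \<open>T \<mapsto> \<langle>\<eta>, T x\<rangle> + \<langle>x, T \<eta>\<rangle>\<close> vanishing on the whole algebra, to which density at the pair \<open>(x, \<eta>)\<close> applies.\<close>

lemma bicommutant_dense_selfadjoint:
  assumes A: "star_algebra A" and D: "D \<in> commutant (commutant A)" "D\<^sup>\<dagger> = D"
  shows "D \<cdot> x \<in> closure {a \<cdot> x | a. a \<in> A \<and> a\<^sup>\<dagger> = a}"
proof -
  interpret A: star_algebra A by fact
  let ?W = "{a \<cdot> x | a. a \<in> A \<and> a\<^sup>\<dagger> = a}"
  have W: "subspace ?W"
    unfolding subspace_def
  proof (safe)
    show "\<exists>a. 0 = a \<cdot> x \<and> a \<in> A \<and> a\<^sup>\<dagger> = a" by (intro exI[of _ 0]) (simp add: bop_apply_zero_left A.zero)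
    show "\<exists>c. a \<cdot> x + b \<cdot> x = c \<cdot> x \<and> c \<in> A \<and> c\<^sup>\<dagger> = c"
      if "a \<in> A" "a\<^sup>\<dagger> = a" "b \<in> A" "b\<^sup>\<dagger> = b" for a b
      using that by (intro exI[of _ "a + b"]) (simp add: bop_apply_plus A.add)
    show "\<exists>b. r *\<^sub>R a \<cdot> x = b \<cdot> x \<and> b \<in> A \<and> b\<^sup>\<dagger> = b" if "a \<in> A" "a\<^sup>\<dagger> = a" for a r
      using that by (intro exI[of _ "r *\<^sub>R a"]) (simp add: bop_apply_scaleR_left A.scaleR)
  qed
  \<comment> \<open>The self-adjoint elements form only a real subspace, so this is where the
    projection theorem is needed over the reals.\<close>
  obtain y where y: "y \<in> closure ?W" and o: "\<And>v. v \<in> closure ?W \<Longrightarrow> inner (D \<cdot> x - y) v = 0"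
    using orthogonal_projection_exists[OF subspace_closure[OF W] closed_closure, of "D \<cdot> x"] by blast
  define \<eta> where "\<eta> = D \<cdot> x - y"
  define z where "z = single 0 x + single 1 \<eta>"
  have key: "inner (amp T \<cdot> z) (single 0 \<eta> + single 1 x) = inner \<eta> (T \<cdot> x) + inner x (T \<cdot> \<eta>)" for T
    by (simp add: inner_add_right inner_single z_def coord_simps single.rep_eq inner_commute[of "T \<cdot> _"])
  have a0: "inner \<eta> (a \<cdot> x) + inner x (a \<cdot> \<eta>) = 0" if "a \<in> A" for a
  proof -
    \<comment> \<open>Orthogonality to self-adjoint elements, applied to
      \<open>a + a\<^sup>\<dagger>\<close>, is exactly the vanishing of the functional at the
      arbitrary element \<open>a\<close>.\<close>
    have "(a + a\<^sup>\<dagger>) \<cdot> x \<in> ?W" using that by (intro CollectI exI[of _ "a + a\<^sup>\<dagger>"]) (simp add: A.add A.adj add.commute)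
    then have "inner \<eta> ((a + a\<^sup>\<dagger>) \<cdot> x) = 0" using o[OF subsetD[OF closure_subset]] by (simp only: \<eta>_def)
    then show ?thesis by (simp add: bop_apply_plus inner_add_right inner_adj_right inner_commute)
  qed
  have "amp D \<cdot> z \<in> closure {b \<cdot> z | b. b \<in> amp ` A}"
    by (intro bicommutant_dense star_algebra_amp A amp_bicommutant D)
  then obtain f where f: "\<And>n. f n \<in> {b \<cdot> z | b. b \<in> amp ` A}" "f \<longlonglongrightarrow> amp D \<cdot> z"
    unfolding closure_sequential by blast
  have "\<exists>a\<in>A. f n = amp a \<cdot> z" for n using f(1)[of n] by blast
  then obtain a where a: "\<And>n. a n \<in> A" "\<And>n. f n = amp (a n) \<cdot> z" by metis
  have "(\<lambda>n. inner (f n) (single 0 \<eta> + single 1 x)) \<longlonglongrightarrow> inner (amp D \<cdot> z) (single 0 \<eta> + single 1 x)"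
    by (intro tendsto_intros f)
  then have "(\<lambda>n. 0) \<longlonglongrightarrow> inner \<eta> (D \<cdot> x) + inner x (D \<cdot> \<eta>)"
    unfolding a(2) key a0[OF a(1)] .
  then have "inner \<eta> (D \<cdot> x) + inner x (D \<cdot> \<eta>) = 0" using LIMSEQ_unique tendsto_const by blast
  then have "inner \<eta> (D \<cdot> x) = 0" using inner_bop_commute[OF D(2), of x \<eta>] by simp
  moreover have "inner \<eta> y = 0" using o[OF y] by (simp add: \<eta>_def)
  ultimately have "inner \<eta> \<eta> = 0" by (simp add: \<eta>_def inner_diff_right)
  then show ?thesis using y by (simp add: \<eta>_def)
qed

subsection \<open>Countable separating families\<close>

text \<open>Cyclicity of the family for the commutant, which amounts to separation for
  \<open>M\<close>. The real inner product suffices because a commutant is closed under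
  multiplication by \<open>\<i>\<close>.\<close>

definition separating_sequence :: "'k::chilbert_space bop set \<Rightarrow> (nat \<Rightarrow> 'k) \<Rightarrow> bool" where
  "separating_sequence M \<xi> \<longleftrightarrow>
     (\<forall>\<zeta>. (\<forall>i. \<forall>T\<in>commutant M. inner \<zeta> (T \<cdot> \<xi> i) = 0) \<longrightarrow> \<zeta> = 0)"

text \<open>Orthogonal unit vectors have distance \<open>sqrt 2\<close>, so points of a countable
  dense set within 1/2 of them are distinct.\<close>

lemma countable_orthogonal_unit_vectors:
  fixes u :: "'i \<Rightarrow> 'h::real_inner"
  assumes sep: "separable_space (euclidean :: 'h topology)"
    and unit: "\<And>i. i \<in> I \<Longrightarrow> norm (u i) = 1"
    and orth: "\<And>i j. i \<in> I \<Longrightarrow> j \<in> I \<Longrightarrow> i \<noteq> j \<Longrightarrow> inner (u i) (u j) = 0"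
  shows "countable I"
proof -
  obtain C :: "'h set" where C: "countable C" "closure C = UNIV"
    using sep unfolding separable_space_def by auto
  have "\<exists>c\<in>C. dist c (u i) < 1/2" for i
    using C(2) closure_approachable[of "u i" C] half_gt_zero[OF zero_less_one] by blast
  then obtain f where fC: "\<And>i. f i \<in> C" and f: "\<And>i. dist (f i) (u i) < 1/2" by metis
  have "inj_on f I"
  proof (rule inj_onI, rule ccontr)
    fix i j assume ij: "i \<in> I" "j \<in> I" "f i = f j" "i \<noteq> j"
    have "dist (u i) (u j) < 1"
      using f[of i] f[of j] dist_triangle3[of "u i" "u j" "f i"] ij(3) by (simp add: dist_commute)
    then have "(norm (u i - u j))\<^sup>2 < 1\<^sup>2"
      unfolding dist_norm by (intro power_strict_mono) auto
    moreover have "(norm (u i - u j))\<^sup>2 = (norm (u i))\<^sup>2 + (norm (u j))\<^sup>2"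
      using orth[OF ij(1,2,4)] by (simp add: power2_norm_eq_inner inner_diff_left inner_diff_right inner_commute)
    ultimately show False using unit ij by simp
  qed
  moreover have "f ` I \<subseteq> C" using fC by blast
  ultimately show ?thesis using C(1) countable_subset countable_image_inj_on by blast
qed

text \<open>Zorn yields a maximal set of vectors whose orbits under the commutant are mutually
  orthogonal; maximality makes it total. The cyclic projections are nonzero, mutually orthogonal and
  in \<open>M\<close>. The faithful \<open>\<rho>\<close> carries them to the separable space, where
  there can be only countably many.\<close>

lemma separating_sequence_exists:
  fixes M :: "'k::chilbert_space bop set" and \<rho> :: "'k bop \<Rightarrow> 'h::chilbert_space bop"
  assumes sep: "separable_space (euclidean :: 'h topology)"
    and M: "von_neumann_algebra M" and \<rho>: "star_hom M B \<rho>"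
    and inj: "\<And>m. m \<in> M \<Longrightarrow> \<rho> m = 0 \<Longrightarrow> m = 0"
  shows "\<exists>\<xi>. separating_sequence M \<xi>"
proof -
  interpret M': star_algebra "commutant M"
    using M by (intro star_algebra_commutant) (auto simp: von_neumann_algebra_def)
  define \<F> where "\<F> = {\<Xi>. 0 \<notin> \<Xi> \<and>
    (\<forall>\<xi>\<in>\<Xi>. \<forall>\<eta>\<in>\<Xi>. \<xi> \<noteq> \<eta> \<longrightarrow> (\<forall>T\<in>commutant M. inner \<xi> (T \<cdot> \<eta>) = 0))}"
  have "\<exists>\<Xi>\<in>\<F>. \<forall>X\<in>\<F>. \<Xi> \<subseteq> X \<longrightarrow> X = \<Xi>"
  proof (rule subset_Zorn')
    fix \<C> assume "subset.chain \<F> \<C>"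
    then have sub: "\<C> \<subseteq> \<F>" and ch: "\<And>X Y. X \<in> \<C> \<Longrightarrow> Y \<in> \<C> \<Longrightarrow> X \<subseteq> Y \<or> Y \<subseteq> X"
      by (auto simp: subset_chain_def)
    have "inner \<xi> (T \<cdot> \<eta>) = 0"
      if "\<xi> \<in> X" "X \<in> \<C>" "\<eta> \<in> Y" "Y \<in> \<C>" "\<xi> \<noteq> \<eta>" "T \<in> commutant M" for \<xi> \<eta> X Y T
    proof -
      have "\<exists>Z\<in>\<C>. \<xi> \<in> Z \<and> \<eta> \<in> Z" using ch[OF that(2,4)] that(1-4) by blast
      then obtain Z where "Z \<in> \<C>" "\<xi> \<in> Z" "\<eta> \<in> Z" by blast
      then show ?thesis using sub that(5,6) unfolding \<F>_def by blast
    qed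
    then show "\<Union>\<C> \<in> \<F>" using sub unfolding \<F>_def by blast
  qed
  then obtain \<Xi> where \<Xi>: "\<Xi> \<in> \<F>" and max: "\<And>X. X \<in> \<F> \<Longrightarrow> \<Xi> \<subseteq> X \<Longrightarrow> X = \<Xi>" by blast
  have orth: "inner \<xi> (T \<cdot> \<eta>) = 0" if "\<xi> \<in> \<Xi>" "\<eta> \<in> \<Xi>" "\<xi> \<noteq> \<eta>" "T \<in> commutant M" for \<xi> \<eta> T
    using \<Xi> that unfolding \<F>_def by blast
  have total: "\<zeta> = 0" if \<zeta>: "\<And>\<xi> T. \<xi> \<in> \<Xi> \<Longrightarrow> T \<in> commutant M \<Longrightarrow> inner \<zeta> (T \<cdot> \<xi>) = 0" for \<zeta>
  proof (rule ccontr)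
    assume nz: "\<zeta> \<noteq> 0"
    have "inner \<xi> (T \<cdot> \<zeta>) = 0" if "\<xi> \<in> \<Xi>" "T \<in> commutant M" for \<xi> T
      using \<zeta>[OF that(1) M'.adj[OF that(2)]] by (simp add: inner_adj_right inner_commute)
    then have "insert \<zeta> \<Xi> \<in> \<F>" using \<Xi> \<zeta> nz unfolding \<F>_def by blast
    then have "\<zeta> \<in> \<Xi>" using max by blast
    then have "inner \<zeta> (1 \<cdot> \<zeta>) = 0" using \<zeta> M'.one by blast
    then show False using nz by (simp add: bop_apply_one)
  qed
  \<comment> \<open>The cyclic projection for the algebra \<open>commutant M\<close> lies in its
    commutant, which is \<open>M\<close>.\<close>
  have "\<forall>\<xi>. \<exists>e. e \<in> M \<and> e\<^sup>\<dagger> = e \<and> e * e = e \<and> e \<cdot> \<xi> = \<xi> \<and>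
      (\<forall>x. e \<cdot> x \<in> closure {T \<cdot> \<xi> | T. T \<in> commutant M})"
    using cyclic_projection_exists[OF M'.star_algebra_axioms] M
    unfolding Bex_def von_neumann_algebra_def by simp
  from choice[OF this] obtain e where *: "\<forall>\<xi>. e \<xi> \<in> M \<and> (e \<xi>)\<^sup>\<dagger> = e \<xi> \<and> e \<xi> * e \<xi> = e \<xi> \<and>
      e \<xi> \<cdot> \<xi> = \<xi> \<and> (\<forall>x. e \<xi> \<cdot> x \<in> closure {T \<cdot> \<xi> | T. T \<in> commutant M})" ..
  then have eM: "\<And>\<xi>. e \<xi> \<in> M" and e: "\<And>\<xi>. (e \<xi>)\<^sup>\<dagger> = e \<xi>" "\<And>\<xi>. e \<xi> * e \<xi> = e \<xi>"
    "\<And>\<xi>. e \<xi> \<cdot> \<xi> = \<xi>" "\<And>\<xi> x. e \<xi> \<cdot> x \<in> closure {T \<cdot> \<xi> | T. T \<in> commutant M}"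
    by blast+
  have ee: "e \<xi> * e \<eta> = 0" if \<xi>\<eta>: "\<xi> \<in> \<Xi>" "\<eta> \<in> \<Xi>" "\<xi> \<noteq> \<eta>" for \<xi> \<eta>
  proof -
    have WW: "inner a b = 0" if ab: "a \<in> {T \<cdot> \<xi> | T. T \<in> commutant M}" "b \<in> {T \<cdot> \<eta> | T. T \<in> commutant M}" for a b
    proof -
      obtain S T where ST: "S \<in> commutant M" "T \<in> commutant M" "a = S \<cdot> \<xi>" "b = T \<cdot> \<eta>"
        using ab by blast
      then have "inner a b = inner \<xi> ((S\<^sup>\<dagger> * T) \<cdot> \<eta>)" by (simp add: bop_apply_times inner_adj_right)
      then show ?thesis using orth[OF \<xi>\<eta>] ST by (simp add: M'.times M'.adj)
    qed
    have cl: "inner a b = 0" if ab: "a \<in> closure {T \<cdot> \<xi> | T. T \<in> commutant M}"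
      and ab': "b \<in> closure {T \<cdot> \<eta> | T. T \<in> commutant M}" for a b
    proof -
      obtain f where f: "\<And>n. f n \<in> {T \<cdot> \<xi> | T. T \<in> commutant M}" "f \<longlonglongrightarrow> a"
        using ab unfolding closure_sequential by blast
      obtain g where g: "\<And>n. g n \<in> {T \<cdot> \<eta> | T. T \<in> commutant M}" "g \<longlonglongrightarrow> b"
        using ab' unfolding closure_sequential by blast
      have "(\<lambda>n. inner (f n) (g n)) \<longlonglongrightarrow> inner a b" by (intro tendsto_inner f g)
      then have "(\<lambda>n. 0) \<longlonglongrightarrow> inner a b" unfolding WW[OF f(1) g(1)] .
      then show ?thesis using LIMSEQ_unique tendsto_const by blast
    qed
    have "inner x ((e \<xi> * e \<eta>) \<cdot> y) = 0" for x y
      using cl[OF e(4) e(4), of x y] inner_adj[of "e \<xi>" x "e \<eta> \<cdot> y"] by (simp add: e(1) bop_apply_times)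
    then show ?thesis by (intro bop_eqI) (metis bop_apply_zero_left inner_eq_zero_iff)
  qed
  have \<rho>e: "(\<rho> (e \<xi>))\<^sup>\<dagger> = \<rho> (e \<xi>)" "\<rho> (e \<xi>) * \<rho> (e \<xi>) = \<rho> (e \<xi>)" for \<xi>
    using \<rho> eM[of \<xi>] e(1,2)[of \<xi>] by (auto simp: star_hom_def) metis+
  have "\<rho> 0 = \<rho> 0 + \<rho> 0"
    using \<rho> star_algebra.zero[OF von_neumann_star_algebra[OF M]] unfolding star_hom_def
    by (metis add.right_neutral)
  then have \<rho>0: "\<rho> 0 = 0" by simp
  have \<rho>ee: "\<rho> (e \<xi>) * \<rho> (e \<eta>) = 0" if "\<xi> \<in> \<Xi>" "\<eta> \<in> \<Xi>" "\<xi> \<noteq> \<eta>" for \<xi> \<eta>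
    using \<rho> eM ee[OF that] \<rho>0 unfolding star_hom_def by metis
  have "\<exists>u. norm u = 1 \<and> \<rho> (e \<xi>) \<cdot> u = u" if "\<xi> \<in> \<Xi>" for \<xi>
  proof -
    have "\<xi> \<noteq> 0" using that \<Xi> unfolding \<F>_def by blast
    then have "e \<xi> \<noteq> 0" using e(3)[of \<xi>] by (metis bop_apply_zero_left)
    then have "\<rho> (e \<xi>) \<noteq> 0" using inj eM by blast
    then obtain x where x: "\<rho> (e \<xi>) \<cdot> x \<noteq> 0" by (metis bop_apply_zero_left bop_eqI)
    let ?y = "\<rho> (e \<xi>) \<cdot> x"
    have "\<rho> (e \<xi>) \<cdot> ?y = ?y" using \<rho>e(2) by (metis bop_apply_times)
    then have "\<rho> (e \<xi>) \<cdot> ((1 / norm ?y) *\<^sub>R ?y) = (1 / norm ?y) *\<^sub>R ?y"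
      by (simp add: bop_apply_scaleR)
    moreover have "norm ((1 / norm ?y) *\<^sub>R ?y) = 1" using x by simp
    ultimately show ?thesis by blast
  qed
  then obtain u where u: "\<And>\<xi>. \<xi> \<in> \<Xi> \<Longrightarrow> norm (u \<xi>) = 1"
    and \<rho>u: "\<And>\<xi>. \<xi> \<in> \<Xi> \<Longrightarrow> \<rho> (e \<xi>) \<cdot> u \<xi> = u \<xi>" by metis
  have uu: "inner (u \<xi>) (u \<eta>) = 0" if "\<xi> \<in> \<Xi>" "\<eta> \<in> \<Xi>" "\<xi> \<noteq> \<eta>" for \<xi> \<eta>
  proof -
    have "inner (u \<xi>) (u \<eta>) = inner (\<rho> (e \<xi>) \<cdot> u \<xi>) (\<rho> (e \<eta>) \<cdot> u \<eta>)" by (simp add: \<rho>u that)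
    also have "\<dots> = inner (u \<xi>) ((\<rho> (e \<xi>) * \<rho> (e \<eta>)) \<cdot> u \<eta>)"
      using inner_adj[of "\<rho> (e \<xi>)"] by (simp add: \<rho>e bop_apply_times)
    finally show ?thesis using \<rho>ee[OF that] by (simp add: bop_apply_zero_left)
  qed
  have "countable \<Xi>" by (rule countable_orthogonal_unit_vectors[OF sep, of \<Xi> u]) (fact u uu)+
  \<comment> \<open>If \<open>\<Xi>\<close> is empty, totality forces the underlying space to be
    zero, and the constant sequence 0 serves.\<close>
  have "separating_sequence M (if \<Xi> = {} then \<lambda>_. 0 else from_nat_into \<Xi>)"
    unfolding separating_sequence_def
  proof (intro allI impI total)
    fix \<zeta> \<xi> T
    assume *: "\<forall>i. \<forall>T\<in>commutant M. inner \<zeta> (T \<cdot> (if \<Xi> = {} then \<lambda>_. 0 else from_nat_into \<Xi>) i) = 0"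
      and \<xi>: "\<xi> \<in> \<Xi>" and T: "T \<in> commutant M"
    obtain i where "from_nat_into \<Xi> i = \<xi>"
      using from_nat_into_surj[OF \<open>countable \<Xi>\<close> \<xi>] by blast
    then show "inner \<zeta> (T \<cdot> \<xi>) = 0" using *[rule_format, OF T, of i] \<xi> by (cases "\<Xi> = {}") auto
  qed
  then show ?thesis by blast
qed

text \<open>Rescaled by weights, the sequence becomes one vector of the amplified space, at which
  density gives an error below \<open>(1/4) ^ n\<close>; undoing the weight costs the constant
  \<open>1 / c i\<close>. The rate is the one that the weights in \<open>Egorov_operator\<close>
  require.\<close>

lemma bicommutant_approximation:
  fixes \<xi> :: "nat \<Rightarrow> 'k::chilbert_space"
  assumes A: "star_algebra A" and D: "D \<in> commutant (commutant A)" "D\<^sup>\<dagger> = D"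
  shows "\<exists>a. (\<forall>n. a n \<in> A \<and> (a n)\<^sup>\<dagger> = a n) \<and>
    (\<forall>i. \<exists>C. \<forall>n::nat. norm ((D - a n) \<cdot> \<xi> i) \<le> C / 4 ^ n)"
proof -
  \<comment> \<open>The factor \<open>2 ^ i\<close> makes the scaled sequence square-summable;
    \<open>1 + norm (\<xi> i)\<close> rather than \<open>norm (\<xi> i)\<close> also admits zero
    vectors.\<close>
  define c where "c i = 1 / (2 ^ i * (1 + norm (\<xi> i)))" for i
  have c: "c i > 0" for i by (simp add: c_def add_pos_nonneg)
  have "norm (c i *\<^sub>R \<xi> i) \<le> (1/2) ^ i" for i
  proof -
    have "norm (\<xi> i) / (1 + norm (\<xi> i)) \<le> 1" using divide_le_eq_1[of "norm (\<xi> i)" "1 + norm (\<xi> i)"]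
      by (simp add: add_pos_nonneg)
    then have "(1/2) ^ i * (norm (\<xi> i) / (1 + norm (\<xi> i))) \<le> (1/2) ^ i * 1" by (intro mult_left_mono) auto
    then show ?thesis using c[of i] by (simp add: c_def power_divide)
  qed
  then have sq: "(norm (c i *\<^sub>R \<xi> i))\<^sup>2 \<le> ((1/2) ^ i)\<^sup>2" for i
    by (rule power_mono) simp
  have half_sq: "((1/2 :: real) ^ i)\<^sup>2 = (1/4) ^ i" for i
  proof -
    have "((1/2 :: real) ^ i)\<^sup>2 = ((1/2)\<^sup>2) ^ i" by (simp only: power_mult[symmetric] mult.commute)
    then show ?thesis by (simp add: power2_eq_square)
  qed
  have "summable (\<lambda>i. (norm (c i *\<^sub>R \<xi> i))\<^sup>2)"
  proof (rule summable_comparison_test')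
    show "summable (\<lambda>i. (1/4 :: real) ^ i)" by (rule summable_geometric) simp
    show "norm ((norm (c i *\<^sub>R \<xi> i))\<^sup>2) \<le> (1/4) ^ i" for i
      using sq[of i] unfolding half_sq by simp
  qed
  then have "coord (Ell2 (\<lambda>i. c i *\<^sub>R \<xi> i)) = (\<lambda>i. c i *\<^sub>R \<xi> i)" by (simp add: Ell2_inverse)
  then obtain x where x: "coord x = (\<lambda>i. c i *\<^sub>R \<xi> i)" by blast
  have cl: "amp D \<cdot> x \<in> closure {b \<cdot> x | b. b \<in> amp ` A \<and> b\<^sup>\<dagger> = b}"
    using D by (intro bicommutant_dense_selfadjoint star_algebra_amp A amp_bicommutant)
      (auto simp flip: amp_adj)
  have amp_inj: "a = b" if "amp a = amp b" for a b :: "'k bop"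
  proof (rule bop_eqI)
    fix y
    have "coord (amp a \<cdot> single 0 y) 0 = coord (amp b \<cdot> single 0 y) 0" by (simp add: that)
    then show "a \<cdot> y = b \<cdot> y" by (simp add: single.rep_eq)
  qed
  have "\<exists>a. a \<in> A \<and> a\<^sup>\<dagger> = a \<and> dist (amp a \<cdot> x) (amp D \<cdot> x) < (1/4) ^ n" for n :: nat
  proof -
    obtain b where b: "b \<in> amp ` A" "b\<^sup>\<dagger> = b" "dist (b \<cdot> x) (amp D \<cdot> x) < (1/4) ^ n"
      using cl[unfolded closure_approachable, rule_format, of "(1/4) ^ n"] by auto
    then obtain a where a: "a \<in> A" "b = amp a" by blast
    then have "a\<^sup>\<dagger> = a" using b(2) amp_inj by (simp flip: amp_adj)
    then show ?thesis using a b by blast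
  qed
  then obtain a where a: "\<And>n. a n \<in> A" "\<And>n. (a n)\<^sup>\<dagger> = a n"
    "\<And>n::nat. dist (amp (a n) \<cdot> x) (amp D \<cdot> x) < (1/4) ^ n" by metis
  have "norm ((D - a n) \<cdot> \<xi> i) \<le> (1 / c i) / 4 ^ n" for n i
  proof -
    have "c i * norm ((D - a n) \<cdot> \<xi> i) = norm (coord (amp (D - a n) \<cdot> x) i)"
      using c[of i] by (simp add: x bop_apply_scaleR)
    also have "\<dots> \<le> norm (amp (D - a n) \<cdot> x)" by (rule norm_coord_le)
    also have "\<dots> \<le> (1/4) ^ n"
      using a(3)[of n] by (simp add: amp_diff bop_apply_diff_left dist_norm norm_minus_commute less_imp_le)
    finally show ?thesis using c[of i] by (simp add: power_divide field_simps)
  qed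
  then show ?thesis using a(1,2) by blast
qed

subsection \<open>A noncommutative Egorov theorem\<close>

text \<open>The operator \<open>q\<close> is the strong limit of the inverses of \<open>1 + (\<Sum>k<m. 4^k B\<^sub>k\<^sup>2)\<close>.\<close>

lemma Egorov_operator:
  fixes B :: "nat \<Rightarrow> 'k::chilbert_space bop"
  assumes M: "von_neumann_algebra M" and \<xi>: "separating_sequence M \<xi>"
    and B: "\<And>n. B n \<in> M" "\<And>n. (B n)\<^sup>\<dagger> = B n"
    and lim: "\<And>i. \<exists>C. \<forall>n::nat. norm (B n \<cdot> \<xi> i) \<le> C / 4 ^ n"
  shows "\<exists>q\<in>M. q\<^sup>\<dagger> = q \<and> (\<forall>x. q \<cdot> x = 0 \<longrightarrow> x = 0) \<and> (\<forall>n. norm (B n * q) \<le> 1 / 2 ^ n)"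
proof -
  interpret M: star_algebra M by (rule von_neumann_star_algebra[OF M])
  \<comment> \<open>The weight \<open>4 ^ k\<close> serves both ends: \<open>Q m\<close> dominates
    the square of \<open>2 ^ n * norm (B n \<cdot> _)\<close> for \<open>n < m\<close>, which gives
    the rate \<open>1 / 2 ^ n\<close>, while its form at \<open>\<xi> i\<close> stays bounded, the
    terms being at most \<open>C\<^sup>2 * (1/4) ^ k\<close>.\<close>
  define Q where "Q m = 1 + (\<Sum>k<m. (4 ^ k) *\<^sub>R (B k * B k))" for m :: nat
  have QM: "Q m \<in> M" for m
    unfolding Q_def by (intro M.add M.one M.sum M.scaleR M.times B)
  have Qx: "inner x (Q m \<cdot> x) = (norm x)\<^sup>2 + (\<Sum>k<m. 4 ^ k * (norm (B k \<cdot> x))\<^sup>2)" for x m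
  proof (induction m)
    case 0
    then show ?case by (simp add: Q_def bop_apply_one power2_norm_eq_inner)
  next
    case (Suc m)
    have "Q (Suc m) = Q m + (4 ^ m) *\<^sub>R ((B m)\<^sup>\<dagger> * B m)" by (simp add: Q_def B)
    then show ?case
      by (simp add: Suc bop_apply_plus bop_apply_scaleR_left inner_add_right norm_apply_adj_times)
  qed
  have Qsa: "(Q m)\<^sup>\<dagger> = Q m" for m
  proof (induction m)
    case (Suc m)
    have "Q (Suc m) = Q m + (4 ^ m) *\<^sub>R (B m * B m)" by (simp add: Q_def)
    then show ?case by (simp add: Suc B)
  qed (simp add: Q_def)
  have Qco: "coercive (Q m)" for m
    unfolding coercive_def
    by (intro conjI exI[of _ 1] allI Qsa) (simp_all add: Qx sum_nonneg)
  obtain R where R: "\<And>m. Q m * R m = 1" "\<And>m. R m * Q m = 1"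
    using coercive_invertible[OF Qco] by metis
  have RM: "R m \<in> M" for m by (rule von_neumann_inverse[OF M QM R])
  note Rsa = coercive_inverse[OF Qco R]
  have "\<exists>q. q\<^sup>\<dagger> = q \<and> (\<forall>x. (\<lambda>m. R m \<cdot> x) \<longlonglongrightarrow> q \<cdot> x)"
  proof (rule decreasing_bop_converges[OF Rsa])
    show "inner x (R (Suc m) \<cdot> x) \<le> inner x (R m \<cdot> x)" for m x
      by (rule coercive_inverse_antimono[OF Qco R Qco R]) (simp add: Qx)
  qed
  then obtain q where q: "q\<^sup>\<dagger> = q" "\<And>x. (\<lambda>m. R m \<cdot> x) \<longlonglongrightarrow> q \<cdot> x" by blast
  have QR: "Q m \<cdot> R m \<cdot> x = x" for m x
    using R(1) by (metis bop_apply_one bop_apply_times)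
  have Rle: "inner x (R m \<cdot> x) \<le> (norm x)\<^sup>2" for m x
  proof -
    have "(norm (R m \<cdot> x))\<^sup>2 \<le> inner (R m \<cdot> x) (Q m \<cdot> R m \<cdot> x)"
      unfolding Qx by (simp add: sum_nonneg)
    also have "\<dots> = inner x (R m \<cdot> x)" by (simp add: QR inner_commute)
    also have "\<dots> \<le> norm x * norm (R m \<cdot> x)" by (rule norm_cauchy_schwarz)
    finally have "norm (R m \<cdot> x) \<le> norm x"
      by (cases "R m \<cdot> x = 0") (simp_all add: power2_eq_square)
    then show ?thesis
      using norm_cauchy_schwarz[of x "R m \<cdot> x"]
        mult_left_mono[of "norm (R m \<cdot> x)" "norm x" "norm x"] by (simp add: power2_eq_square)
  qed
  have BR: "norm (B n \<cdot> R m \<cdot> x) \<le> norm x / 2 ^ n" if "n < m" for n m x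
  proof -
    have "4 ^ n * (norm (B n \<cdot> R m \<cdot> x))\<^sup>2 \<le> (\<Sum>k<m. 4 ^ k * (norm (B k \<cdot> R m \<cdot> x))\<^sup>2)"
      using that by (intro member_le_sum) auto
    also have "\<dots> \<le> inner (R m \<cdot> x) (Q m \<cdot> R m \<cdot> x)" unfolding Qx by simp
    also have "\<dots> \<le> (norm x)\<^sup>2" using Rle by (simp add: QR inner_commute)
    finally have "4 ^ n * (norm (B n \<cdot> R m \<cdot> x))\<^sup>2 \<le> (norm x)\<^sup>2" .
    moreover have "4 ^ n * (norm (B n \<cdot> R m \<cdot> x))\<^sup>2 = (2 ^ n * norm (B n \<cdot> R m \<cdot> x))\<^sup>2"
      using power_mult_distrib[of "2::real" 2 n] by (simp add: power_mult_distrib power2_eq_square)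
    ultimately have "(2 ^ n * norm (B n \<cdot> R m \<cdot> x))\<^sup>2 \<le> (norm x)\<^sup>2" by simp
    then have "2 ^ n * norm (B n \<cdot> R m \<cdot> x) \<le> norm x" by (rule power2_le_imp_le) simp
    then show ?thesis by (simp add: pos_le_divide_eq mult.commute)
  qed
  have Bq: "norm (B n * q) \<le> 1 / 2 ^ n" for n
  proof (rule norm_bop_bound)
    fix x
    have "norm (B n \<cdot> q \<cdot> x) \<le> norm x / 2 ^ n"
    proof (rule LIMSEQ_le_const2)
      show "(\<lambda>m. norm (B n \<cdot> R m \<cdot> x)) \<longlonglongrightarrow> norm (B n \<cdot> q \<cdot> x)"
        by (intro tendsto_norm bounded_linear.tendsto[OF bounded_linear_bop_apply] q)
      show "\<exists>N. \<forall>m\<ge>N. norm (B n \<cdot> R m \<cdot> x) \<le> norm x / 2 ^ n"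
        using BR by (intro exI[of _ "Suc n"]) auto
    qed
    then show "norm ((B n * q) \<cdot> x) \<le> 1 / 2 ^ n * norm x" by (simp add: bop_apply_times)
  qed simp
  have qM: "q \<in> M" by (rule von_neumann_strong_limit[OF M RM q(2)])
  have orth: "inner \<zeta> (\<xi> i) = 0" if \<zeta>: "q \<cdot> \<zeta> = 0" for \<zeta> i
  proof -
    obtain C where C: "\<And>n::nat. norm (B n \<cdot> \<xi> i) \<le> C / 4 ^ n" using lim by blast
    have C0: "0 \<le> C" using order_trans[OF norm_ge_zero C[of 0]] by simp
    have summand: "4 ^ k * (norm (B k \<cdot> \<xi> i))\<^sup>2 \<le> C\<^sup>2 * (1/4) ^ k" for k
    proof -
      have "(norm (B k \<cdot> \<xi> i))\<^sup>2 \<le> (C / 4 ^ k)\<^sup>2" using C by (intro power_mono) auto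
      then have "4 ^ k * (norm (B k \<cdot> \<xi> i))\<^sup>2 \<le> 4 ^ k * (C / 4 ^ k)\<^sup>2" by simp
      also have "\<dots> = C\<^sup>2 * (1/4) ^ k" by (simp add: power_divide power2_eq_square field_simps)
      finally show ?thesis .
    qed
    define K where "K = (norm (\<xi> i))\<^sup>2 + C\<^sup>2 * (\<Sum>k. (1/4) ^ k)"
    have QK: "inner (\<xi> i) (Q m \<cdot> \<xi> i) \<le> K" for m
    proof -
      have "(\<Sum>k<m. 4 ^ k * (norm (B k \<cdot> \<xi> i))\<^sup>2) \<le> C\<^sup>2 * (\<Sum>k<m. (1/4) ^ k)"
        unfolding sum_distrib_left by (intro sum_mono summand)
      also have "\<dots> \<le> C\<^sup>2 * (\<Sum>k. (1/4) ^ k)"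
        by (intro mult_left_mono sum_le_suminf summable_geometric) auto
      finally show ?thesis by (simp add: Qx K_def)
    qed
    \<comment> \<open>Cauchy-Schwarz for the form of \<open>Q m\<close> at \<open>\<xi> i\<close>
      and \<open>R m \<cdot> \<zeta>\<close>. The bound \<open>K\<close> does not depend on
      \<open>m\<close>, so in the limit the kernel of \<open>q\<close> is orthogonal to every
      \<open>\<xi> i\<close>.\<close>
    have le: "(inner \<zeta> (\<xi> i))\<^sup>2 \<le> K * inner \<zeta> (R m \<cdot> \<zeta>)" for m
    proof -
      have "(inner \<zeta> (\<xi> i))\<^sup>2 = (inner (\<xi> i) (Q m \<cdot> R m \<cdot> \<zeta>))\<^sup>2" by (simp add: QR inner_commute)
      also have "\<dots> \<le> inner (\<xi> i) (Q m \<cdot> \<xi> i) * inner (R m \<cdot> \<zeta>) (Q m \<cdot> R m \<cdot> \<zeta>)"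
        by (intro Cauchy_Schwarz_bop Qsa coercive_nonneg Qco)
      also have "\<dots> \<le> K * inner (R m \<cdot> \<zeta>) (Q m \<cdot> R m \<cdot> \<zeta>)"
        by (intro mult_right_mono QK coercive_nonneg Qco)
      finally show ?thesis by (simp add: QR inner_commute)
    qed
    have "(\<lambda>m. K * inner \<zeta> (R m \<cdot> \<zeta>)) \<longlonglongrightarrow> K * inner \<zeta> (q \<cdot> \<zeta>)" by (intro tendsto_intros q)
    then have "(inner \<zeta> (\<xi> i))\<^sup>2 \<le> K * inner \<zeta> (q \<cdot> \<zeta>)"
      using le by (intro LIMSEQ_le_const) auto
    then show ?thesis using \<zeta> by simp
  qed
  \<comment> \<open>The kernel of \<open>q\<close> is invariant under the commutant of
    \<open>M\<close>, so orthogonality to the \<open>\<xi> i\<close> extends to their orbits, which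
    are total.\<close>
  have "\<zeta> = 0" if \<zeta>: "q \<cdot> \<zeta> = 0" for \<zeta>
  proof -
    interpret M': star_algebra "commutant M"
      using M by (intro star_algebra_commutant) (auto simp: von_neumann_algebra_def)
    have "inner \<zeta> (T \<cdot> \<xi> i) = 0" if T: "T \<in> commutant M" for T i
    proof -
      have "q \<cdot> T\<^sup>\<dagger> \<cdot> \<zeta> = T\<^sup>\<dagger> \<cdot> q \<cdot> \<zeta>"
        using von_neumann_commutes[OF qM M'.adj[OF T]] by (metis bop_apply_times)
      then have "inner (T\<^sup>\<dagger> \<cdot> \<zeta>) (\<xi> i) = 0" using \<zeta> by (intro orth) (simp add: bop_apply_zero)
      then show ?thesis by (simp add: inner_adj)
    qed
    then show ?thesis using \<xi> unfolding separating_sequence_def by blast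
  qed
  then show ?thesis using qM q(1) Bq by blast
qed

subsection \<open>A criterion for von Neumann subalgebras\<close>

text \<open>The map \<open>m \<mapsto> u * \<gamma> m * t\<close> is a right \<open>A\<close>-linear projection of \<open>M\<close>
  onto \<open>A\<close>. For self-adjoint \<open>D\<close> in the bicommutant, approximated by \<open>a\<^sub>n\<close> in \<open>A\<close>, the element
  \<open>h = t\<^sup>\<dagger> * \<gamma> (q * q) * t\<close> of \<open>A\<close> turns the convergence of \<open>a\<^sub>n * q\<close> into norm convergence of
  \<open>a\<^sub>n * h\<close> to \<open>D * h\<close>, so that the projection fixes \<open>D * h\<close>, hence \<open>D\<close>.\<close>

lemma von_neumann_subalgebra:
  fixes M A :: "'k::chilbert_space bop set"
  assumes M: "von_neumann_algebra M" and \<xi>: "separating_sequence M \<xi>"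
    and A: "star_algebra A" "A \<subseteq> M"
    and \<gamma>: "star_hom M M \<gamma>"
    and tuv: "t \<in> M" "u \<in> M" "u * t = 1" "v\<^sup>\<dagger> * t = t\<^sup>\<dagger> * t"
    and t: "\<And>a. a \<in> A \<Longrightarrow> \<gamma> a * t = t * a"
    and v: "\<And>m. m \<in> M \<Longrightarrow> v * m = \<gamma> m * v"
    and E: "\<And>m. m \<in> M \<Longrightarrow> u * \<gamma> m * t \<in> A"
    and F: "\<And>m. m \<in> M \<Longrightarrow> t\<^sup>\<dagger> * \<gamma> m * t \<in> A"
  shows "von_neumann_algebra A"
proof -
  interpret M: star_algebra M by (rule von_neumann_star_algebra[OF M])
  interpret A: star_algebra A by (rule A)
  have \<gamma>_times: "\<gamma> (a * b) = \<gamma> a * \<gamma> b" and \<gamma>_adj: "\<gamma> (a\<^sup>\<dagger>) = (\<gamma> a)\<^sup>\<dagger>"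
    and \<gamma>_M: "\<gamma> a \<in> M" and \<gamma>_add: "\<gamma> (a + b) = \<gamma> a + \<gamma> b" if "a \<in> M" "b \<in> M" for a b
    using \<gamma> that by (auto simp: star_hom_def)
  have \<gamma>_minus: "\<gamma> (- b) = - \<gamma> b" if "b \<in> M" for b
    using \<gamma> that scaleC_bop_minus_one unfolding star_hom_def by metis
  have \<gamma>_diff: "\<gamma> (a - b) = \<gamma> a - \<gamma> b" if "a \<in> M" "b \<in> M" for a b
    using that by (simp add: \<gamma>_add \<gamma>_minus M.uminus diff_conv_add_uminus del: add_uminus_conv_diff)
  have AM: "a \<in> M" if "a \<in> A" for a using that A(2) by blast
  have bic: "commutant (commutant A) \<subseteq> M"
    using commutant_antimono[OF commutant_antimono[OF A(2)]] M by (auto simp: von_neumann_algebra_def)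
  have main: "D \<in> A" if D: "D \<in> commutant (commutant A)" "D\<^sup>\<dagger> = D" for D
  proof -
    have DM: "D \<in> M" using D bic by blast
    obtain a where a: "\<And>n. a n \<in> A" "\<And>n. (a n)\<^sup>\<dagger> = a n"
      and lim: "\<And>i. \<exists>C. \<forall>n::nat. norm ((D - a n) \<cdot> \<xi> i) \<le> C / 4 ^ n"
      using bicommutant_approximation[OF A(1) D] by metis
    obtain q where q: "q \<in> M" "q\<^sup>\<dagger> = q" "\<And>x. q \<cdot> x = 0 \<Longrightarrow> x = 0"
      and Bq: "\<And>n. norm ((D - a n) * q) \<le> 1 / 2 ^ n"
      using Egorov_operator[OF M \<xi>, of "\<lambda>n. D - a n"] DM AM a D lim by (auto simp: M.diff)
    \<comment> \<open>Injectivity of \<open>q\<close> replaces an inverse, which need not exist as a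
      bounded operator.\<close>
    have q_cancel: "X = Y" if "q * X = q * Y" for X Y
    proof (rule bop_eqI)
      fix x
      have "q \<cdot> (X \<cdot> x - Y \<cdot> x) = 0" using that by (simp add: bop_apply_diff flip: bop_apply_times)
      from q(3)[OF this] show "X \<cdot> x = Y \<cdot> x" by simp
    qed
    define h where "h = t\<^sup>\<dagger> * \<gamma> (q * q) * t"
    have hA: "h \<in> A" unfolding h_def by (intro F M.times q)
    have half: "(\<lambda>n. 1 / 2 ^ n :: real) \<longlonglongrightarrow> 0"
      using LIMSEQ_realpow_zero[of "1/2"] by (simp add: power_divide)
    \<comment> \<open>This is the adjoint of the Egorov estimate, available because \<open>D\<close>
      and the \<open>a n\<close> are self-adjoint. It identifies the limit of \<open>a n * h\<close>
      after cancelling \<open>q\<close>.\<close>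
    have qB: "norm (q * (D - a n)) \<le> 1 / 2 ^ n" for n
      using norm_adj[of "(D - a n) * q"] Bq[of n] by (simp add: D(2) a(2) q(2))
    define K where "K = norm (t\<^sup>\<dagger>) * norm (\<gamma> q * t)"
    have ah: "norm (a m * h - a n * h) \<le> (1 / 2 ^ m + 1 / 2 ^ n) * K" for m n
    proof -
      \<comment> \<open>Moving \<open>a m\<close> through \<open>t\<^sup>\<dagger>\<close> puts it
        under \<open>\<gamma>\<close> next to a factor \<open>q\<close>; contractivity of
        \<open>\<gamma>\<close> then makes \<open>a n * h\<close> a Cauchy sequence in norm.\<close>
      have at: "a m * t\<^sup>\<dagger> = t\<^sup>\<dagger> * \<gamma> (a m)" for m
        using arg_cong[OF t[OF a(1)[of m]], of adj] a \<gamma>_adj[OF AM[OF a(1)] AM[OF a(1)], of m] by simp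
      have "a m * h - a n * h = (a m * t\<^sup>\<dagger> - a n * t\<^sup>\<dagger>) * \<gamma> (q * q) * t"
        by (simp add: h_def left_diff_distrib mult.assoc)
      also have "a m * t\<^sup>\<dagger> - a n * t\<^sup>\<dagger> = t\<^sup>\<dagger> * \<gamma> (a m - a n)"
        by (simp add: at \<gamma>_diff AM a right_diff_distrib)
      also have "t\<^sup>\<dagger> * \<gamma> (a m - a n) * \<gamma> (q * q) * t = t\<^sup>\<dagger> * \<gamma> ((a m - a n) * q) * (\<gamma> q * t)"
        using q AM a by (simp add: \<gamma>_times M.diff mult.assoc)
      finally have 1: "norm (a m * h - a n * h) \<le>
          norm (t\<^sup>\<dagger>) * norm (\<gamma> ((a m - a n) * q)) * norm (\<gamma> q * t)"
        by (simp only: order_trans[OF norm_mult_ineq mult_right_mono[OF norm_mult_ineq norm_ge_zero]])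
      have "norm (\<gamma> ((a m - a n) * q)) \<le> norm ((a m - a n) * q)"
        by (rule star_hom_norm_le[OF M \<gamma>]) (simp add: q AM a M.diff M.times)
      also have "norm ((a m - a n) * q) = norm ((D - a n) * q - (D - a m) * q)"
        by (simp add: left_diff_distrib)
      also have "\<dots> \<le> 1 / 2 ^ m + 1 / 2 ^ n"
        using norm_triangle_ineq4[of "(D - a n) * q" "(D - a m) * q"] Bq[of m] Bq[of n] by linarith
      finally have "norm (t\<^sup>\<dagger>) * norm (\<gamma> ((a m - a n) * q)) * norm (\<gamma> q * t) \<le>
          norm (t\<^sup>\<dagger>) * (1 / 2 ^ m + 1 / 2 ^ n) * norm (\<gamma> q * t)"
        by (intro mult_right_mono mult_left_mono norm_ge_zero)
      then show ?thesis using 1 unfolding K_def by (simp only: mult_ac)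
    qed
    have "Cauchy (\<lambda>n. a n * h)"
    proof (rule metric_CauchyI)
      fix e :: real assume "e > 0"
      have "(\<lambda>n. (1 / 2 ^ n) * (2 * K)) \<longlonglongrightarrow> 0 * (2 * K)" by (intro tendsto_mult tendsto_const half)
      then have "\<forall>\<^sub>F n in sequentially. (1 / 2 ^ n) * (2 * K) < e"
        using \<open>e > 0\<close> by (intro order_tendstoD) simp_all
      then obtain N where N: "(1 / 2 ^ N) * (2 * K) < e" by (auto simp: eventually_sequentially)
      have K0: "0 \<le> K" by (simp add: K_def)
      have "dist (a m * h) (a n * h) < e" if "N \<le> m" "N \<le> n" for m n
      proof -
        have "(1 / 2 ^ m + 1 / 2 ^ n) * K \<le> (1 / 2 ^ N + 1 / 2 ^ N) * K"
          using that K0 by (intro mult_right_mono add_mono divide_left_mono power_increasing) auto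
        then show ?thesis using ah[of m n] N by (simp add: dist_norm)
      qed
      then show "\<exists>M. \<forall>m\<ge>M. \<forall>n\<ge>M. dist (a m * h) (a n * h) < e" by blast
    qed
    then obtain g where g: "(\<lambda>n. a n * h) \<longlonglongrightarrow> g" using Cauchy_convergent convergent_def by blast
    have "q * g = q * (D * h)"
    proof (rule LIMSEQ_unique)
      show "(\<lambda>n. q * (a n * h)) \<longlonglongrightarrow> q * g" by (intro tendsto_mult tendsto_const g)
      have "(\<lambda>n. norm (q * (D - a n))) \<longlonglongrightarrow> 0"
        by (rule tendsto_sandwich[OF _ _ tendsto_const half]) (simp_all add: qB)
      then have "(\<lambda>n. q * (D - a n)) \<longlonglongrightarrow> 0" by (simp add: tendsto_norm_zero_iff)
      then have "(\<lambda>n. q * (D * h) - q * (D - a n) * h) \<longlonglongrightarrow> q * (D * h) - 0 * h"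
        by (intro tendsto_diff tendsto_mult tendsto_const)
      then show "(\<lambda>n. q * (a n * h)) \<longlonglongrightarrow> q * (D * h)"
        by (simp add: left_diff_distrib right_diff_distrib mult.assoc)
    qed
    then have "g = D * h" by (rule q_cancel)
    then have Dh: "(\<lambda>n. a n * h) \<longlonglongrightarrow> D * h" using g by simp
    have "(\<lambda>n. \<gamma> (a n * h)) \<longlonglongrightarrow> \<gamma> (D * h)"
    proof (rule LIMSEQ_I)
      fix r :: real assume "r > 0"
      then obtain N where "\<And>n. n \<ge> N \<Longrightarrow> norm (a n * h - D * h) < r" using LIMSEQ_D[OF Dh] by blast
      moreover have "norm (\<gamma> (a n * h) - \<gamma> (D * h)) \<le> norm (a n * h - D * h)" for n
        using star_hom_norm_le[OF M \<gamma>, of "a n * h - D * h"]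
        by (simp add: \<gamma>_diff M.diff M.times AM a DM hA)
      ultimately show "\<exists>N. \<forall>n\<ge>N. norm (\<gamma> (a n * h) - \<gamma> (D * h)) < r" by (meson le_less_trans)
    qed
    then have "(\<lambda>n. u * \<gamma> (a n * h) * t) \<longlonglongrightarrow> u * \<gamma> (D * h) * t"
      by (intro tendsto_mult tendsto_const)
    moreover have E_id: "u * \<gamma> b * t = b" if "b \<in> A" for b
      using t[OF that] tuv(3) by (simp add: mult.assoc[of u]) (simp flip: mult.assoc)
    ultimately have "(\<lambda>n. a n * h) \<longlonglongrightarrow> u * \<gamma> (D * h) * t" by (simp add: A.times a hA)
    then have "D * h = u * \<gamma> (D * h) * t" using Dh LIMSEQ_unique by blast
    also have "\<dots> = u * \<gamma> D * t * h"
      using t[OF hA] by (simp add: \<gamma>_times DM AM hA mult.assoc)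
    finally have D1h: "(D - u * \<gamma> D * t) * h = 0" by (simp add: left_diff_distrib)
    define D1 where "D1 = D - u * \<gamma> D * t"
    \<comment> \<open>It remains to deduce \<open>D1 = 0\<close> from \<open>D1 * h = 0\<close>.
      Since \<open>h\<close> has the form \<open>b\<^sup>\<dagger> * b\<close> with
      \<open>b = \<gamma> q * t\<close>, first \<open>b * D1\<^sup>\<dagger>\<close>
      vanishes.\<close>
    have "(\<gamma> q * t * D1\<^sup>\<dagger>)\<^sup>\<dagger> * (\<gamma> q * t * D1\<^sup>\<dagger>) = D1 * h * D1\<^sup>\<dagger>"
      using \<gamma>_adj[OF q(1) q(1)] q(2) by (simp add: h_def \<gamma>_times q mult.assoc)
    also have "\<dots> = 0" using D1h by (simp add: D1_def)
    finally have "\<gamma> q * t * D1\<^sup>\<dagger> = 0" by (rule adj_times_self_eq_0)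
    \<comment> \<open>The factor \<open>v\<^sup>\<dagger>\<close> pulls \<open>q\<close> out of
      \<open>\<gamma>\<close> to the far left, where it can be cancelled; the relation between
      \<open>v\<^sup>\<dagger> * t\<close> and \<open>t\<^sup>\<dagger> * t\<close> then removes
      \<open>t\<close>.\<close>
    then have "v\<^sup>\<dagger> * (\<gamma> q * t * D1\<^sup>\<dagger>) = 0" by simp
    moreover have "v\<^sup>\<dagger> * \<gamma> q = q * v\<^sup>\<dagger>"
      using arg_cong[OF v[OF q(1)], of adj] \<gamma>_adj[OF q(1) q(1)] q(2) by simp
    ultimately have "q * (v\<^sup>\<dagger> * t * D1\<^sup>\<dagger>) = q * 0" by (simp flip: mult.assoc)
    then have "v\<^sup>\<dagger> * t * D1\<^sup>\<dagger> = 0" by (rule q_cancel)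
    then have "(t * D1\<^sup>\<dagger>)\<^sup>\<dagger> * (t * D1\<^sup>\<dagger>) = 0" by (simp add: tuv(4) mult.assoc)
    then have "t * D1\<^sup>\<dagger> = 0" by (rule adj_times_self_eq_0)
    then have "u * t * D1\<^sup>\<dagger> = 0" by (simp add: mult.assoc)
    then have "D1 = 0" using adj_eq_iff[of D1 0] by (simp add: tuv(3))
    then have "D = u * \<gamma> D * t" by (simp add: D1_def)
    then show ?thesis using E[OF DM] by simp
  qed
  have "commutant (commutant A) \<subseteq> A"
  proof
    fix T assume T: "T \<in> commutant (commutant A)"
    interpret A': star_algebra "commutant A" by (rule star_algebra_commutant) (rule A.adj)
    interpret A'': star_algebra "commutant (commutant A)" by (rule star_algebra_commutant) (rule A'.adj)
    have 1: "T + T\<^sup>\<dagger> \<in> A"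
      by (rule main) (simp_all add: A''.add A''.adj T add.commute)
    have "\<i> *\<^sub>C (T - T\<^sup>\<dagger>) \<in> A"
    proof (rule main)
      show "\<i> *\<^sub>C (T - T\<^sup>\<dagger>) \<in> commutant (commutant A)"
        by (intro A''.scaleC A''.diff A''.adj T)
      show "(\<i> *\<^sub>C (T - T\<^sup>\<dagger>))\<^sup>\<dagger> = \<i> *\<^sub>C (T - T\<^sup>\<dagger>)"
        using scaleC_bop_scaleC[of \<i> "- 1" "T\<^sup>\<dagger> - T"] by (simp add: scaleC_bop_minus_one)
    qed
    then have "(- \<i>) *\<^sub>C \<i> *\<^sub>C (T - T\<^sup>\<dagger>) \<in> A" by (rule A.scaleC)
    then have 2: "T - T\<^sup>\<dagger> \<in> A" by (simp add: scaleC_bop_scaleC scaleC_bop_one)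
    have "(1/2) *\<^sub>R ((T + T\<^sup>\<dagger>) + (T - T\<^sup>\<dagger>)) \<in> A" by (intro A.scaleR A.add 1 2)
    then show "T \<in> A" by (simp add: scaleR_2[symmetric])
  qed
  then show ?thesis
    using bicommutant_superset[of A] A.adj by (auto simp: von_neumann_algebra_def)
qed

subsection \<open>Frobenius algebras in the category of endomorphisms\<close>

lemma reassoc: "a * b = c \<Longrightarrow> a * (b * y) = c * (y :: 'a::semigroup_mult)"
  by (simp flip: mult.assoc)

lemma scaleC_bop_zero: "0 *\<^sub>C T = (0 :: 'h::chilbert_space bop)"
  using scaleR_bop_def[of 0 T] by simp

text \<open>Q-systems without the normalisation of \<open>w\<close> and \<open>x\<close>.\<close>

locale frobenius_algebra =
  fixes N :: "'h::chilbert_space bop set" and \<theta> :: "'h bop \<Rightarrow> 'h bop" and w x :: "'h bop"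
  assumes vN: "von_neumann_algebra N"
    and hom: "star_hom N N \<theta>"
    and w_Hom: "w \<in> Hom N N id \<theta>"
    and x_Hom: "x \<in> Hom N N \<theta> (\<theta> \<circ> \<theta>)"
    and unit_left: "w\<^sup>\<dagger> * x = 1"
    and unit_right: "\<theta> (w\<^sup>\<dagger>) * x = 1"
    and coassoc: "x * x = \<theta> x * x"
    and frobenius: "\<theta> (x\<^sup>\<dagger>) * x = x * x\<^sup>\<dagger>"
begin

sublocale N: star_algebra N by (rule von_neumann_star_algebra[OF vN])

lemma wx [simp]: "w \<in> N" "x \<in> N"
  using w_Hom x_Hom by (auto simp: Hom_def)

lemma \<theta>_simps [simp]:
  "a \<in> N \<Longrightarrow> \<theta> a \<in> N"
  "a \<in> N \<Longrightarrow> b \<in> N \<Longrightarrow> \<theta> (a * b) = \<theta> a * \<theta> b"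
  "a \<in> N \<Longrightarrow> b \<in> N \<Longrightarrow> \<theta> (a + b) = \<theta> a + \<theta> b"
  "a \<in> N \<Longrightarrow> \<theta> (c *\<^sub>C a) = c *\<^sub>C \<theta> a"
  "a \<in> N \<Longrightarrow> \<theta> (a\<^sup>\<dagger>) = (\<theta> a)\<^sup>\<dagger>"
  "\<theta> 1 = 1"
  using hom by (auto simp: star_hom_def)

lemma \<theta>_scaleR [simp]: "a \<in> N \<Longrightarrow> \<theta> (r *\<^sub>R a) = r *\<^sub>R \<theta> a"
  by (simp add: scaleR_bop_def)

lemma \<theta>_diff [simp]: "a \<in> N \<Longrightarrow> b \<in> N \<Longrightarrow> \<theta> (a - b) = \<theta> a - \<theta> b"
  using \<theta>_simps(3)[of a "(-1) *\<^sub>R b"] \<theta>_scaleR[of b "-1"] by (simp add: N.uminus)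

declare N.one [simp] N.times [simp] N.adj [simp] N.add [simp] N.diff [simp] N.scaleC [simp]
  N.scaleR [simp]

lemma w_int: "a \<in> N \<Longrightarrow> w * a = \<theta> a * w"
  using w_Hom by (simp add: Hom_def)

lemma x_int: "a \<in> N \<Longrightarrow> x * \<theta> a = \<theta> (\<theta> a) * x"
  using x_Hom by (simp add: Hom_def)

lemma w_adj_int: "a \<in> N \<Longrightarrow> w\<^sup>\<dagger> * \<theta> a = a * w\<^sup>\<dagger>"
  using arg_cong[OF w_int[of "a\<^sup>\<dagger>"], of adj] by simp

lemma x_adj_int: "a \<in> N \<Longrightarrow> x\<^sup>\<dagger> * \<theta> (\<theta> a) = \<theta> a * x\<^sup>\<dagger>"
  using arg_cong[OF x_int[of "a\<^sup>\<dagger>"], of adj] by simp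

lemma unit_left_adj: "x\<^sup>\<dagger> * w = 1"
  using arg_cong[OF unit_left, of adj] by simp

lemma unit_right_adj: "x\<^sup>\<dagger> * \<theta> w = 1"
  using arg_cong[OF unit_right, of adj] by simp

lemma frobenius_adj: "x\<^sup>\<dagger> * \<theta> x = x * x\<^sup>\<dagger>"
  using arg_cong[OF frobenius, of adj] by simp

text \<open>The coevaluation of the Frobenius algebra. By the Frobenius and unit laws it makes
  \<open>\<theta>\<close> its own conjugate, with \<open>r\<close> in both roles.\<close>

definition r :: "'h bop" where "r = x * w"

lemma r_N [simp]: "r \<in> N"
  by (simp add: r_def)

lemma r_int: "a \<in> N \<Longrightarrow> r * a = \<theta> (\<theta> a) * r"
  by (simp add: r_def mult.assoc w_int x_int[THEN reassoc])

lemma r_adj_int: "a \<in> N \<Longrightarrow> r\<^sup>\<dagger> * \<theta> (\<theta> a) = a * r\<^sup>\<dagger>"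
  using arg_cong[OF r_int[of "a\<^sup>\<dagger>"], of adj] by simp

lemma r_conjugate: "r\<^sup>\<dagger> * \<theta> r = 1" "\<theta> (r\<^sup>\<dagger>) * r = 1"
proof -
  show "r\<^sup>\<dagger> * \<theta> r = 1"
    by (simp add: r_def mult.assoc frobenius_adj[THEN reassoc] unit_left unit_right_adj)
  show "\<theta> (r\<^sup>\<dagger>) * r = 1"
    using frobenius unit_right
    by (simp add: r_def mult.assoc frobenius[simplified, THEN reassoc]
        unit_right[simplified, THEN reassoc] unit_left_adj unit_left)
qed

lemma conjugate_r: "conjugate_solution N N \<theta> \<theta> r r"
  using r_conjugate by (simp add: conjugate_solution_def Hom_def r_int)

definition n :: "'h bop" where "n = x\<^sup>\<dagger> * x"

lemma n_N [simp]: "n \<in> N"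
  by (simp add: n_def)

lemma n_int: "a \<in> N \<Longrightarrow> n * \<theta> a = \<theta> a * n"
  by (simp add: n_def mult.assoc x_int x_adj_int[THEN reassoc])

lemma x_n: "x * n = \<theta> n * x" "x * n = n * x"
proof -
  have "x * n = x * x\<^sup>\<dagger> * x" by (simp add: n_def mult.assoc)
  also have "\<dots> = \<theta> (x\<^sup>\<dagger>) * (x * x)" by (simp only: frobenius mult.assoc[symmetric])
  also have "\<dots> = \<theta> n * x" by (simp add: coassoc n_def mult.assoc)
  finally show "x * n = \<theta> n * x" .
  have "x * n = x * x\<^sup>\<dagger> * x" by (simp add: n_def mult.assoc)
  also have "\<dots> = x\<^sup>\<dagger> * (\<theta> x * x)" by (simp only: frobenius_adj mult.assoc[symmetric])
  also have "\<dots> = n * x" by (simp only: coassoc[symmetric] n_def mult.assoc)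
  finally show "x * n = n * x" .
qed

lemma n_coercive: "coercive n"
  unfolding n_def by (rule coercive_adj_times_self[OF unit_left])

lemma r_adj_r: "r\<^sup>\<dagger> * r = w\<^sup>\<dagger> * n * w"
  by (simp add: r_def n_def mult.assoc)

end

subsection \<open>Dimension of the underlying endomorphism\<close>

lemma factor_central_scalar:
  assumes "factor N" and T: "T \<in> N" "T \<in> commutant N" and \<xi>: "norm \<xi> = 1"
  shows "T = cinner \<xi> (T \<cdot> \<xi>) *\<^sub>C 1"
proof -
  obtain c where c: "T = c *\<^sub>C 1" using assms unfolding factor_def by blast
  then have "cinner \<xi> (T \<cdot> \<xi>) = c"
    using \<xi> by (simp add: bop_apply_scaleC_left bop_apply_one cinner_scaleC_right cinner_self)
  then show ?thesis using c by simp
qed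

lemma factor_unit_vector:
  assumes "factor (N :: 'h::chilbert_space bop set)"
  shows "\<exists>\<xi>::'h. norm \<xi> = 1"
proof -
  have "(1 :: 'h bop) \<noteq> 0" using assms by (simp add: factor_def)
  then obtain y :: 'h where "y \<noteq> 0" by (metis bop_eqI bop_apply_one bop_apply_zero_left)
  then have "norm ((1 / norm y) *\<^sub>R y) = 1" by simp
  then show ?thesis by blast
qed

text \<open>Evaluation at one fixed unit vector turns identities between scalar operators into
  identities between real numbers, in which dimensions are compared.\<close>

lemma conjugate_dims_norm:
  assumes "s\<^sup>\<dagger> * s = complex_of_real d *\<^sub>C 1" and "norm \<xi> = 1"
  shows "d = (norm (s \<cdot> \<xi>))\<^sup>2"
proof -
  have "inner \<xi> ((s\<^sup>\<dagger> * s) \<cdot> \<xi>) = d"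
    using assms(2) unfolding assms(1)
    by (simp add: bop_apply_one flip: scaleR_bop_def)
      (simp add: bop_apply_scaleR_left bop_apply_one power2_norm_eq_inner[symmetric])
  then show ?thesis by (simp add: norm_apply_adj_times)
qed

lemma conjugate_dims_nonneg:
  assumes "factor N" "d \<in> conjugate_dims N N \<alpha>"
  shows "0 \<le> d"
  using assms factor_unit_vector[OF assms(1)] conjugate_dims_norm
  by (fastforce simp: conjugate_dims_def)

lemma hom_dim_le:
  assumes "factor N" "d \<in> conjugate_dims N N \<alpha>"
  shows "hom_dim N N \<alpha> \<le> d"
  unfolding hom_dim_def
  using assms conjugate_dims_nonneg[OF assms(1)] by (intro cInf_lower bdd_belowI[of _ 0]) auto

lemma hom_dim_nonneg:
  assumes "factor N" "conjugate_dims N N \<alpha> \<noteq> {}"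
  shows "0 \<le> hom_dim N N \<alpha>"
  unfolding hom_dim_def
  using assms conjugate_dims_nonneg[OF assms(1)] by (intro cInf_greatest)

lemma linear_coefficient_zero:
  fixes A K e :: real
  assumes "e > 0" and nn: "\<And>t. \<bar>t\<bar> \<le> e \<Longrightarrow> 0 \<le> t * A + t\<^sup>2 * K"
  shows "A = 0"
proof (rule ccontr)
  assume "A \<noteq> 0"
  \<comment> \<open>So small that the quadratic term is less than half of the linear one;
    \<open>t = - s * sgn A\<close> then gives a negative value.\<close>
  define s where "s = min e (\<bar>A\<bar> / (2 * (\<bar>K\<bar> + 1)))"
  have s: "0 < s" "s \<le> e" using \<open>e > 0\<close> \<open>A \<noteq> 0\<close> by (auto simp: s_def)
  have "s \<le> \<bar>A\<bar> / (2 * (\<bar>K\<bar> + 1))" by (simp add: s_def)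
  then have sK: "s * (2 * (\<bar>K\<bar> + 1)) \<le> \<bar>A\<bar>" by (subst (asm) pos_le_divide_eq) auto
  have "0 \<le> (- s * sgn A) * A + (- s * sgn A)\<^sup>2 * K"
    using s \<open>A \<noteq> 0\<close> by (intro nn) (simp add: abs_mult abs_sgn_eq)
  also have "\<dots> = s * (s * K - \<bar>A\<bar>)"
    using \<open>A \<noteq> 0\<close> by (simp add: power2_eq_square algebra_simps abs_sgn sgn_if)
  finally have "\<bar>A\<bar> \<le> s * K" using s(1) by (simp add: zero_le_mult_iff)
  also have "\<dots> \<le> s * \<bar>K\<bar>" using s by simp
  finally show False using s sK \<open>A \<noteq> 0\<close> by (simp add: algebra_simps)
qed

context frobenius_algebra
begin

text \<open>\<open>r\<^sup>\<dagger> * a * r\<close> intertwines the identity with itself, hence is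
  central. The cases \<open>a = b\<close> and \<open>a = \<theta> b\<close> are the two traces of an
  intertwiner \<open>b\<close>.\<close>

lemma central_scalar:
  assumes "factor N" and "norm \<xi> = 1" and a: "a \<in> N" "\<And>b. b \<in> N \<Longrightarrow> a * \<theta> (\<theta> b) = \<theta> (\<theta> b) * a"
    and sa: "a\<^sup>\<dagger> = a"
  shows "r\<^sup>\<dagger> * a * r = complex_of_real (inner (r \<cdot> \<xi>) (a \<cdot> r \<cdot> \<xi>)) *\<^sub>C 1"
proof -
  let ?T = "r\<^sup>\<dagger> * a * r"
  have "?T * b = b * ?T" if "b \<in> N" for b
    using that by (simp add: mult.assoc r_int a(2)[THEN reassoc] r_adj_int[THEN reassoc])
  then have "?T \<in> commutant N" by (simp add: commutant_def)
  then have *: "?T = cinner \<xi> (?T \<cdot> \<xi>) *\<^sub>C 1"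
    using a by (intro factor_central_scalar[OF assms(1) _ _ assms(2)]) auto
  have "?T\<^sup>\<dagger> = ?T" by (simp add: sa mult.assoc)
  then have "cinner \<xi> (?T \<cdot> \<xi>) = cnj (cinner \<xi> (?T \<cdot> \<xi>))"
    by (metis cinner_adj cinner_commute)
  then have "cinner \<xi> (?T \<cdot> \<xi>) = complex_of_real (Re (cinner \<xi> (?T \<cdot> \<xi>)))"
    by (simp add: complex_eq_iff)
  also have "Re (cinner \<xi> (?T \<cdot> \<xi>)) = inner (r \<cdot> \<xi>) (a \<cdot> r \<cdot> \<xi>)"
    by (simp add: Re_cinner bop_apply_times inner_adj_right)
  finally show ?thesis using * by simp
qed

lemma dimension_exists:
  assumes "factor N"
  shows "\<exists>\<delta>>0. r\<^sup>\<dagger> * r = complex_of_real \<delta> *\<^sub>C 1"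
proof -
  obtain \<xi> :: 'h where \<xi>: "norm \<xi> = 1" using factor_unit_vector[OF assms] by blast
  have rr: "r\<^sup>\<dagger> * r = complex_of_real ((norm (r \<cdot> \<xi>))\<^sup>2) *\<^sub>C 1"
    using central_scalar[OF assms \<xi>, of 1] by (simp add: bop_apply_one power2_norm_eq_inner)
  have "r \<cdot> \<xi> \<noteq> 0"
  proof
    assume "r \<cdot> \<xi> = 0"
    then have "r\<^sup>\<dagger> * r = 0" by (simp add: rr scaleC_bop_zero)
    then have "r = 0" by (rule adj_times_self_eq_0)
    with r_conjugate(2) have "(1 :: 'h bop) = 0" by simp
    then show False using assms by (simp add: factor_def)
  qed
  then show ?thesis using rr by (intro exI[of _ "(norm (r \<cdot> \<xi>))\<^sup>2"]) simp
qed

lemma rescaled_conjugate_dim: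
  assumes s: "conjugate_solution N N \<theta> \<theta> s s'" and p: "p > 0" "s\<^sup>\<dagger> * s = complex_of_real p *\<^sub>C 1"
    and q: "q > 0" "s'\<^sup>\<dagger> * s' = complex_of_real q *\<^sub>C 1"
  shows "sqrt (p * q) \<in> conjugate_dims N N \<theta>"
proof -
  \<comment> \<open>Multiplying \<open>s\<close> by \<open>l\<close> and \<open>s'\<close> by
    \<open>1 / l\<close> keeps the conjugate equations. The fourth root of \<open>q / p\<close>
    balances the two norms at their geometric mean:
    \<open>l * l * p = q / (l * l) = sqrt (p * q)\<close>.\<close>
  define l where "l = sqrt (sqrt (q / p))"
  have l: "l > 0" using p q by (simp add: l_def)
  have l2: "l * l = sqrt (q / p)" using p q by (simp add: l_def)
  have lp: "l * l * p = sqrt (p * q)"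
    unfolding l2 using p q by (simp add: real_sqrt_divide real_sqrt_mult field_simps)
  have "sqrt (p * q) * (l * l) = q"
    unfolding l2 using p q by (simp add: real_sqrt_divide real_sqrt_mult)
  then have lq: "q / (l * l) = sqrt (p * q)" using l by (simp add: field_simps)
  have sN: "s \<in> N" "s' \<in> N" using s by (auto simp: conjugate_solution_def Hom_def)
  have "conjugate_solution N N \<theta> \<theta> (l *\<^sub>R s) ((1 / l) *\<^sub>R s')"
    using s l sN by (auto simp: conjugate_solution_def Hom_def)
  moreover have "(l *\<^sub>R s)\<^sup>\<dagger> * (l *\<^sub>R s) = complex_of_real (sqrt (p * q)) *\<^sub>C 1"
    using p(2) lp by (simp flip: scaleR_bop_def)
  moreover have "((1 / l) *\<^sub>R s')\<^sup>\<dagger> * ((1 / l) *\<^sub>R s') = complex_of_real (sqrt (p * q)) *\<^sub>C 1"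
    using q(2) lq by (simp flip: scaleR_bop_def)
  ultimately show ?thesis using hom unfolding conjugate_dims_def by blast
qed

text \<open>If \<open>r\<close> attains the minimal dimension, comparing it with the solutions deformed by \<open>1 + t b\<close>
  shows that the left and the right trace agree on \<open>b\<close> to first order in \<open>t\<close>.\<close>

lemma minimal_imp_spherical:
  assumes N: "factor N" and r: "r\<^sup>\<dagger> * r = complex_of_real (hom_dim N N \<theta>) *\<^sub>C 1"
    and b: "b \<in> Hom N N \<theta> \<theta>" "b\<^sup>\<dagger> = b"
  shows "r\<^sup>\<dagger> * b * r = r\<^sup>\<dagger> * \<theta> b * r"
proof -
  obtain \<xi> :: 'h where \<xi>: "norm \<xi> = 1" using factor_unit_vector[OF N] by blast
  define y where "y = r \<cdot> \<xi>"
  obtain d where d: "d > 0" "r\<^sup>\<dagger> * r = complex_of_real d *\<^sub>C 1" using dimension_exists[OF N] by blast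
  have dy: "d = (norm y)\<^sup>2" unfolding y_def by (rule conjugate_dims_norm[OF d(2) \<xi>])
  have dhom: "d = hom_dim N N \<theta>"
    using conjugate_dims_norm[OF r \<xi>] dy by (simp add: y_def)
  have bN [simp]: "b \<in> N" and b_int: "\<And>a. a \<in> N \<Longrightarrow> b * \<theta> a = \<theta> a * b" using b by (auto simp: Hom_def)
  define \<beta> where "\<beta> = inner y (b \<cdot> y)"
  define \<beta>' where "\<beta>' = inner y (\<theta> b \<cdot> y)"
  define \<kappa> where "\<kappa> = inner y ((b * b) \<cdot> y)"
  \<comment> \<open>Bounds the second-order coefficient in the deformed norm \<open>q\<close>: the
    remainder \<open>Y\<close> below satisfies \<open>norm Y \<le> 16 * (norm b)\<^sup>2\<close>,
    and \<open>d\<close> is the squared norm of \<open>y\<close>.\<close>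
  define c where "c = 16 * (norm b)\<^sup>2 * d"
  \<comment> \<open>For \<open>\<bar>t\<bar> \<le> e\<close> the perturbation
    \<open>t *\<^sub>R b\<close> has norm at most 1/2, so \<open>1 + t *\<^sub>R b\<close> is
    invertible with inverse of norm at most 2.\<close>
  define e where "e = 1 / (2 * (norm b + 1))"
  have e: "e > 0" "e \<le> 1" "e * norm b \<le> 1 / 2"
    by (auto simp: e_def field_simps add_pos_nonneg)
  have deform: "d\<^sup>2 \<le> (d + 2 * t * \<beta> + t\<^sup>2 * \<kappa>) * (d - 2 * t * \<beta>' + t\<^sup>2 * c)" if t: "\<bar>t\<bar> \<le> e" for t
  proof -
    define u where "u = 1 + t *\<^sub>R b"
    have tb: "norm (t *\<^sub>R b) \<le> 1 / 2"
      using t e mult_right_mono[of "\<bar>t\<bar>" e "norm b"] by simp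
    then obtain z where "(1 - - (t *\<^sub>R b)) * z = 1" "z * (1 - - (t *\<^sub>R b)) = 1"
      using Neumann_inverse[of "- (t *\<^sub>R b)"] by auto
    then have z: "u * z = 1" "z * u = 1" by (simp_all add: u_def)
    have uN [simp]: "u \<in> N" by (simp add: u_def)
    have zN [simp]: "z \<in> N" by (rule von_neumann_inverse[OF vN uN z])
    have usa: "u\<^sup>\<dagger> = u" by (simp add: u_def b)
    have zsa: "z\<^sup>\<dagger> = z"
    proof -
      have "z\<^sup>\<dagger> * u = 1" using arg_cong[OF z(1), of adj] by (simp add: usa)
      then have "z\<^sup>\<dagger> * (u * z) = z" by (simp flip: mult.assoc)
      then show ?thesis by (simp add: z)
    qed
    have u_int: "u * \<theta> a = \<theta> a * u" if "a \<in> N" for a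
      using that by (simp add: u_def distrib_left distrib_right b_int)
    have z_int: "z * \<theta> a = \<theta> a * z" if "a \<in> N" for a
    proof -
      have "z * \<theta> a = z * (\<theta> a * u) * z" by (simp add: mult.assoc z)
      also have "\<dots> = z * u * \<theta> a * z" using that by (simp add: u_int mult.assoc)
      finally show ?thesis by (simp add: z)
    qed
    \<comment> \<open>Deforming one copy of \<open>r\<close> by \<open>u\<close> and the other by
      \<open>\<theta>\<close> of its inverse preserves the conjugate equations, since the two
      factors meet and cancel.\<close>
    have cs: "conjugate_solution N N \<theta> \<theta> (u * r) (\<theta> z * r)"
      unfolding conjugate_solution_def
    proof (intro conjI)
      show "u * r \<in> Hom N N id (\<theta> \<circ> \<theta>)"
        by (simp add: Hom_def mult.assoc r_int u_int[THEN reassoc])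
      show "\<theta> z * r \<in> Hom N N id (\<theta> \<circ> \<theta>)"
        by (simp add: Hom_def mult.assoc r_int) (simp add: z_int flip: mult.assoc \<theta>_simps(2))
      have "(u * r)\<^sup>\<dagger> * \<theta> (\<theta> z * r) = r\<^sup>\<dagger> * (u * \<theta> (\<theta> z * r))" by (simp add: usa mult.assoc)
      also have "\<dots> = r\<^sup>\<dagger> * \<theta> (\<theta> z) * \<theta> r * u" by (subst u_int) (simp_all add: mult.assoc)
      also have "\<dots> = z * (r\<^sup>\<dagger> * \<theta> r) * u" by (simp add: r_adj_int mult.assoc)
      finally show "(u * r)\<^sup>\<dagger> * \<theta> (\<theta> z * r) = 1" by (simp add: r_conjugate z)
      have "\<theta> ((u * r)\<^sup>\<dagger>) * (\<theta> z * r) = \<theta> (r\<^sup>\<dagger> * (u * z)) * r" by (simp add: usa mult.assoc)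
      then show "\<theta> ((u * r)\<^sup>\<dagger>) * (\<theta> z * r) = 1" by (simp only: z mult_1_right r_conjugate)
    qed
    define p where "p = d + 2 * t * \<beta> + t\<^sup>2 * \<kappa>"
    define q where "q = inner y (\<theta> (z * z) \<cdot> y)"
    have "inner y ((u * u) \<cdot> y) = p"
      by (simp add: u_def p_def \<beta>_def \<kappa>_def dy distrib_left distrib_right bop_apply_plus bop_apply_one
          bop_apply_scaleR_left inner_add_right power2_norm_eq_inner[symmetric] power2_eq_square[of t])
    moreover have "r\<^sup>\<dagger> * (u * u) * r = complex_of_real (inner y ((u * u) \<cdot> y)) *\<^sub>C 1"
      unfolding y_def
    proof (rule central_scalar[OF N \<xi>])
      show "u * u * \<theta> (\<theta> a) = \<theta> (\<theta> a) * (u * u)" if "a \<in> N" for a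
        using that by (simp add: mult.assoc u_int) (simp add: u_int flip: mult.assoc)
    qed (simp_all add: usa)
    ultimately have p: "(u * r)\<^sup>\<dagger> * (u * r) = complex_of_real p *\<^sub>C 1"
      by (simp add: usa mult.assoc)
    have q: "(\<theta> z * r)\<^sup>\<dagger> * (\<theta> z * r) = complex_of_real q *\<^sub>C 1"
    proof -
      have "\<theta> (z * z) * \<theta> (\<theta> a) = \<theta> (\<theta> a) * \<theta> (z * z)" if "a \<in> N" for a
        using that z_int[of a] by (simp flip: \<theta>_simps(2) add: mult.assoc) (simp flip: mult.assoc)
      moreover have "(\<theta> z)\<^sup>\<dagger> = \<theta> z" using \<theta>_simps(5)[OF zN] by (simp add: zsa)
      ultimately show ?thesis
        using central_scalar[OF N \<xi>, of "\<theta> (z * z)"] by (simp add: mult.assoc q_def y_def)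
    qed
    have p0: "p > 0" and q0: "q > 0"
    proof -
      have r0: "y \<noteq> 0" using d dy by auto
      have "u * r \<noteq> 0" "\<theta> z * r \<noteq> 0"
      proof -
        have "z * (u * r) = r" "\<theta> u * (\<theta> z * r) = r"
          using z by (simp_all flip: mult.assoc) (simp flip: \<theta>_simps(2))
        moreover have "r \<noteq> 0" using r0 by (auto simp: y_def bop_apply_zero_left)
        ultimately show "u * r \<noteq> 0" "\<theta> z * r \<noteq> 0" by auto
      qed
      then have "p \<noteq> 0" "q \<noteq> 0"
        using p q adj_times_self_eq_0[of "u * r"] adj_times_self_eq_0[of "\<theta> z * r"]
        by (auto simp: scaleC_bop_zero simp del: adj_times)
      moreover have "0 \<le> p" "0 \<le> q"
        using conjugate_dims_norm[OF p \<xi>] conjugate_dims_norm[OF q \<xi>] by auto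
      ultimately show "p > 0" "q > 0" by auto
    qed
    have "d \<le> sqrt (p * q)"
      unfolding dhom by (rule hom_dim_le[OF N rescaled_conjugate_dim[OF cs p0 p q0 q]])
    then have dpq: "d\<^sup>2 \<le> p * q"
      using d(1) p0 q0 by (metis less_imp_le power_mono real_sqrt_pow2 mult_nonneg_nonneg)
    have z1: "z = 1 - t *\<^sub>R (b * z)" using z(1) by (simp add: u_def distrib_right eq_diff_eq)
    have nz: "norm z \<le> 2"
    proof -
      have "norm z \<le> norm (1 :: 'h bop) + norm (t *\<^sub>R b * z)"
        using z1 norm_triangle_ineq4[of 1 "t *\<^sub>R b * z"] by simp
      also have "\<dots> \<le> 1 + 1 / 2 * norm z"
        using norm_bop_one_le[where 'h = 'h] norm_mult_ineq[of "t *\<^sub>R b" z]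
          mult_right_mono[OF tb norm_ge_zero[of z]] by linarith
      finally show ?thesis by simp
    qed
    \<comment> \<open>The remainder of the inverse square,
      \<open>z * z = 1 - 2tb + t\<^sup>2 Y\<close>. It comes from the identity \<open>(1 - 2tb)(1 +
      tb)\<^sup>2 = 1 - t\<^sup>2 b\<^sup>2 (3 + 2tb)\<close>.\<close>
    define Y where "Y = b * b * (3 *\<^sub>R 1 + (2 * t) *\<^sub>R b) * (z * z)"
    have "(1 - (2 * t) *\<^sub>R b + t\<^sup>2 *\<^sub>R (b * b * (3 *\<^sub>R 1 + (2 * t) *\<^sub>R b) * (z * z))) * (u * u) = 1"
    proof -
      have "z * z * (u * u) = 1" by (metis mult.assoc mult_1_right z(2))
      then have "(1 - (2 * t) *\<^sub>R b + t\<^sup>2 *\<^sub>R (b * b * (3 *\<^sub>R 1 + (2 * t) *\<^sub>R b) * (z * z))) * (u * u) =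
          (1 - (2 * t) *\<^sub>R b) * (u * u) + t\<^sup>2 *\<^sub>R (b * b * (3 *\<^sub>R 1 + (2 * t) *\<^sub>R b))"
        by (simp add: distrib_right mult.assoc)
      also have "\<dots> = 1"
        by (simp add: u_def distrib_left distrib_right left_diff_distrib right_diff_distrib
            scaleR_add_right power2_eq_square mult.assoc)
          (simp add: algebra_simps flip: scaleR_add_left)
      finally show ?thesis .
    qed
    then have "(1 - (2 * t) *\<^sub>R b + t\<^sup>2 *\<^sub>R Y) * (u * u) * (z * z) = z * z" by (simp add: Y_def)
    moreover have "u * u * (z * z) = 1" by (metis mult.assoc mult_1_right z(1))
    ultimately have zz: "z * z = 1 - (2 * t) *\<^sub>R b + t\<^sup>2 *\<^sub>R Y" by (simp add: mult.assoc)
    have YN [simp]: "Y \<in> N" by (simp add: Y_def)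
    have "norm Y \<le> 16 * (norm b)\<^sup>2"
    proof -
      have "norm (3 *\<^sub>R (1 :: 'h bop) + (2 * t) *\<^sub>R b) \<le> 4"
        using norm_triangle_ineq[of "3 *\<^sub>R (1 :: 'h bop)" "(2 * t) *\<^sub>R b"] norm_bop_one_le[where 'h = 'h] tb
        by (simp add: abs_mult)
      then have "norm (b * b * (3 *\<^sub>R 1 + (2 * t) *\<^sub>R b)) \<le> norm b * norm b * 4"
        by (intro order_trans[OF norm_mult_ineq] mult_mono norm_mult_ineq) auto
      moreover have "norm (z * z) \<le> 2 * 2"
        by (intro order_trans[OF norm_mult_ineq] mult_mono nz) auto
      ultimately have "norm Y \<le> (norm b * norm b * 4) * (2 * 2)"
        unfolding Y_def by (rule order_trans[OF norm_mult_ineq mult_mono]) auto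
      then show ?thesis by (simp add: power2_eq_square)
    qed
    then have "norm (\<theta> Y) \<le> 16 * (norm b)\<^sup>2"
      using star_hom_norm_le[OF vN hom YN] by linarith
    then have "inner y (\<theta> Y \<cdot> y) \<le> c"
    proof -
      assume "norm (\<theta> Y) \<le> 16 * (norm b)\<^sup>2"
      then have "norm (\<theta> Y) * (norm y)\<^sup>2 \<le> c" by (simp add: c_def dy mult_right_mono)
      moreover have "inner y (\<theta> Y \<cdot> y) \<le> norm y * (norm (\<theta> Y) * norm y)"
        by (rule inner_bop_apply_le)
      ultimately show ?thesis by (simp add: power2_eq_square mult_ac)
    qed
    moreover have "q = d - 2 * t * \<beta>' + t\<^sup>2 * inner y (\<theta> Y \<cdot> y)"
      unfolding q_def zz
      by (simp add: \<beta>'_def dy bop_apply_plus bop_apply_diff_left bop_apply_one bop_apply_scaleR_left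
          inner_add_right inner_diff_right power2_norm_eq_inner)
    ultimately have "q \<le> d - 2 * t * \<beta>' + t\<^sup>2 * c" by (simp add: mult_left_mono)
    then have "p * q \<le> p * (d - 2 * t * \<beta>' + t\<^sup>2 * c)" using p0 by simp
    then show ?thesis using dpq unfolding p_def by linarith
  qed
  \<comment> \<open>Collects the coefficients of \<open>t\<^sup>2\<close>, \<open>t\<^sup>3\<close>
    and \<open>t\<^sup>4\<close> in the product of the two quadratics; for
    \<open>\<bar>t\<bar> \<le> 1\<close> they are together at most
    \<open>t\<^sup>2 * K\<close>.\<close>
  define K where "K = \<bar>d * c + \<kappa> * d - 4 * \<beta> * \<beta>'\<bar> + \<bar>2 * \<beta> * c - 2 * \<kappa> * \<beta>'\<bar> + \<bar>\<kappa> * c\<bar>"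
  have "2 * d * (\<beta> - \<beta>') = 0"
  proof (rule linear_coefficient_zero[OF e(1)])
    fix t :: real assume t: "\<bar>t\<bar> \<le> e"
    have t1: "\<bar>t\<bar> \<le> 1" using t e by linarith
    have "t * (2 * \<beta> * c - 2 * \<kappa> * \<beta>') \<le> 1 * \<bar>2 * \<beta> * c - 2 * \<kappa> * \<beta>'\<bar>"
      by (rule order_trans[OF abs_ge_self]) (simp only: abs_mult mult_right_mono[OF t1 abs_ge_zero])
    moreover have "t\<^sup>2 * (\<kappa> * c) \<le> 1 * \<bar>\<kappa> * c\<bar>"
      using t1 abs_square_le_1[of t]
      by (intro order_trans[OF mult_left_mono[OF abs_ge_self] mult_right_mono]) auto
    ultimately have "(d * c + \<kappa> * d - 4 * \<beta> * \<beta>') + t * (2 * \<beta> * c - 2 * \<kappa> * \<beta>') + t\<^sup>2 * (\<kappa> * c) \<le> K"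
      unfolding K_def mult_1_left by (intro add_mono abs_ge_self)
    then have "t\<^sup>2 * ((d * c + \<kappa> * d - 4 * \<beta> * \<beta>') + t * (2 * \<beta> * c - 2 * \<kappa> * \<beta>') + t\<^sup>2 * (\<kappa> * c)) \<le> t\<^sup>2 * K"
      by (rule mult_left_mono) simp
    moreover have "(d + 2 * t * \<beta> + t\<^sup>2 * \<kappa>) * (d - 2 * t * \<beta>' + t\<^sup>2 * c) - d\<^sup>2 =
        t * (2 * d * (\<beta> - \<beta>')) +
        t\<^sup>2 * ((d * c + \<kappa> * d - 4 * \<beta> * \<beta>') + t * (2 * \<beta> * c - 2 * \<kappa> * \<beta>') + t\<^sup>2 * (\<kappa> * c))"
      by (simp add: power2_eq_square algebra_simps)
    ultimately show "0 \<le> t * (2 * d * (\<beta> - \<beta>')) + t\<^sup>2 * K" using deform[OF t] by linarith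
  qed
  then have \<beta>\<beta>': "\<beta> = \<beta>'" using d by simp
  have "r\<^sup>\<dagger> * b * r = complex_of_real \<beta> *\<^sub>C 1"
    unfolding \<beta>_def y_def by (rule central_scalar[OF N \<xi>]) (simp_all add: b_int b)
  moreover have "r\<^sup>\<dagger> * \<theta> b * r = complex_of_real \<beta>' *\<^sub>C 1"
    unfolding \<beta>'_def y_def
  proof (rule central_scalar[OF N \<xi>])
    show "\<theta> b * \<theta> (\<theta> a) = \<theta> (\<theta> a) * \<theta> b" if "a \<in> N" for a
      using that b_int[of a] by (simp flip: \<theta>_simps(2))
    show "(\<theta> b)\<^sup>\<dagger> = \<theta> b" using \<theta>_simps(5)[OF bN] by (simp add: b)
  qed simp
  ultimately show ?thesis using \<beta>\<beta>' by simp
qed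

text \<open>An arbitrary solution \<open>s\<close>, \<open>s'\<close> is \<open>u * r\<close>,
  \<open>\<theta> y * r\<close> with \<open>y\<^sup>\<dagger> * u = 1\<close>. Thus
  \<open>\<delta>\<close> is the inner product of \<open>(y * r) \<cdot> \<xi>\<close> and
  \<open>(u * r) \<cdot> \<xi>\<close>, and each has squared norm \<open>d\<close> once the traces
  agree on \<open>y\<^sup>\<dagger> * y\<close>; Cauchy-Schwarz finishes.\<close>

lemma spherical_imp_minimal:
  assumes N: "factor N" and r: "r\<^sup>\<dagger> * r = complex_of_real \<delta> *\<^sub>C 1"
    and spherical: "\<And>b. b \<in> Hom N N \<theta> \<theta> \<Longrightarrow> b\<^sup>\<dagger> = b \<Longrightarrow> r\<^sup>\<dagger> * b * r = r\<^sup>\<dagger> * \<theta> b * r"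
  shows "hom_dim N N \<theta> = \<delta>"
proof (rule antisym)
  have \<delta>: "\<delta> \<in> conjugate_dims N N \<theta>"
    unfolding conjugate_dims_def using hom conjugate_r r by blast
  then show "hom_dim N N \<theta> \<le> \<delta>" by (rule hom_dim_le[OF N])
  obtain \<xi> :: 'h where \<xi>: "norm \<xi> = 1" using factor_unit_vector[OF N] by blast
  have "\<delta> \<le> d" if "d \<in> conjugate_dims N N \<theta>" for d
  proof -
    obtain \<beta> s s' where \<beta>: "star_hom N N \<beta>" and cs: "conjugate_solution N N \<theta> \<beta> s s'"
      and d: "s\<^sup>\<dagger> * s = complex_of_real d *\<^sub>C 1" "s'\<^sup>\<dagger> * s' = complex_of_real d *\<^sub>C 1"
      using \<open>d \<in> conjugate_dims N N \<theta>\<close> unfolding conjugate_dims_def by blast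
    have \<beta>_simps [simp]: "a \<in> N \<Longrightarrow> \<beta> a \<in> N" "a \<in> N \<Longrightarrow> b \<in> N \<Longrightarrow> \<beta> (a * b) = \<beta> a * \<beta> b"
      "\<beta> 1 = 1" "a \<in> N \<Longrightarrow> \<beta> (a\<^sup>\<dagger>) = (\<beta> a)\<^sup>\<dagger>" for a b
      using \<beta> by (auto simp: star_hom_def)
    have sN [simp]: "s \<in> N" "s' \<in> N" using cs by (auto simp: conjugate_solution_def Hom_def)
    have s_int: "s * a = \<beta> (\<theta> a) * s" "s' * a = \<theta> (\<beta> a) * s'" if "a \<in> N" for a
      using cs that by (auto simp: conjugate_solution_def Hom_def)
    have conj: "s\<^sup>\<dagger> * \<beta> s' = 1" "\<theta> (s\<^sup>\<dagger>) * s' = 1" using cs by (auto simp: conjugate_solution_def)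
    have s'_adj: "s'\<^sup>\<dagger> * \<theta> (\<beta> a) = a * s'\<^sup>\<dagger>" if "a \<in> N" for a
      using arg_cong[OF s_int(2)[of "a\<^sup>\<dagger>"], of adj] that by simp
    define u where "u = \<beta> (r\<^sup>\<dagger>) * s"
    define y where "y = r\<^sup>\<dagger> * \<theta> s'"
    have ur: "u * r = s"
    proof -
      have "u * r = \<beta> (r\<^sup>\<dagger> * \<theta> r) * s" by (simp add: u_def mult.assoc s_int)
      then show ?thesis by (simp only: r_conjugate \<beta>_simps mult_1_left)
    qed
    have yr: "\<theta> y * r = s'"
    proof -
      have "\<theta> y * r = \<theta> (r\<^sup>\<dagger>) * r * s'" by (simp add: y_def mult.assoc r_int)
      then show ?thesis by (simp only: r_conjugate mult_1_left)
    qed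
    have yN [simp]: "y \<in> N" by (simp add: y_def)
    have y_int: "y * \<theta> a = \<beta> a * y" if "a \<in> N" for a
    proof -
      have "y * \<theta> a = r\<^sup>\<dagger> * \<theta> (s' * a)" using that by (simp add: y_def mult.assoc)
      also have "\<dots> = r\<^sup>\<dagger> * \<theta> (\<theta> (\<beta> a)) * \<theta> s'" using that by (simp add: s_int mult.assoc)
      also have "\<dots> = \<beta> a * y" using that by (simp add: r_adj_int y_def mult.assoc)
      finally show ?thesis .
    qed
    have y_adj_int: "\<theta> a * y\<^sup>\<dagger> = y\<^sup>\<dagger> * \<beta> a" if "a \<in> N" for a
      using arg_cong[OF y_int[of "a\<^sup>\<dagger>"], of adj] that by simp
    have yu: "y\<^sup>\<dagger> * u = 1"
    proof -
      have "y\<^sup>\<dagger> * u = \<theta> (s'\<^sup>\<dagger>) * (r * \<beta> (r\<^sup>\<dagger>)) * s" by (simp add: y_def u_def mult.assoc)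
      also have "\<dots> = \<theta> (s'\<^sup>\<dagger> * \<theta> (\<beta> (r\<^sup>\<dagger>))) * (r * s)"
        by (subst r_int) (simp_all add: mult.assoc del: \<theta>_simps(5) \<beta>_simps(4))
      also have "\<dots> = \<theta> (r\<^sup>\<dagger> * s'\<^sup>\<dagger>) * (\<theta> (\<theta> s) * r)"
        by (simp only: s'_adj r_int r_N sN N.adj)
      also have "\<dots> = \<theta> (r\<^sup>\<dagger>) * \<theta> (s'\<^sup>\<dagger> * \<theta> s) * r" by (simp add: mult.assoc)
      also have "s'\<^sup>\<dagger> * \<theta> s = 1" using arg_cong[OF conj(2), of adj] by simp
      finally show ?thesis by (simp add: r_conjugate del: \<theta>_simps(5))
    qed
    \<comment> \<open>Equality of traces turns the norm of \<open>s' = \<theta> y * r\<close> into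
      that of \<open>y * r\<close>, the vector paired with \<open>s = u * r\<close>.\<close>
    have "r\<^sup>\<dagger> * (y\<^sup>\<dagger> * y) * r = r\<^sup>\<dagger> * \<theta> (y\<^sup>\<dagger> * y) * r"
    proof (rule spherical)
      show "y\<^sup>\<dagger> * y \<in> Hom N N \<theta> \<theta>"
        by (simp add: Hom_def mult.assoc y_int y_adj_int[THEN reassoc])
    qed simp
    also have "\<dots> = s'\<^sup>\<dagger> * s'" by (simp add: mult.assoc flip: yr)
    finally have "(y * r)\<^sup>\<dagger> * (y * r) = complex_of_real d *\<^sub>C 1" by (simp add: d mult.assoc)
    then have dy: "d = (norm ((y * r) \<cdot> \<xi>))\<^sup>2" by (rule conjugate_dims_norm[OF _ \<xi>])
    have ds: "d = (norm (s \<cdot> \<xi>))\<^sup>2" by (rule conjugate_dims_norm[OF d(1) \<xi>])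
    have "\<delta> = (norm (r \<cdot> \<xi>))\<^sup>2" by (rule conjugate_dims_norm[OF r \<xi>])
    also have "\<dots> = inner (r \<cdot> \<xi>) ((y\<^sup>\<dagger> * u) \<cdot> r \<cdot> \<xi>)"
      by (simp only: yu bop_apply_one power2_norm_eq_inner)
    also have "\<dots> = inner ((y * r) \<cdot> \<xi>) (s \<cdot> \<xi>)"
      by (simp add: bop_apply_times inner_adj_right flip: ur)
    also have "\<dots> \<le> norm ((y * r) \<cdot> \<xi>) * norm (s \<cdot> \<xi>)" by (rule norm_cauchy_schwarz)
    also have "norm ((y * r) \<cdot> \<xi>) = norm (s \<cdot> \<xi>)"
      using dy ds by (metis norm_ge_zero power2_eq_imp_eq)
    finally show ?thesis using ds by (simp add: power2_eq_square)
  qed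
  then show "\<delta> \<le> hom_dim N N \<theta>"
    unfolding hom_dim_def using \<delta> by (intro cInf_greatest) auto
qed

end

subsection \<open>Normalisation\<close>

lemma Q_system_frobenius_algebra:
  assumes "von_neumann_algebra N" "star_hom N N \<theta>" "Q_system N C \<theta> w x"
  shows "frobenius_algebra N \<theta> w x"
  using assms by unfold_locales (auto simp: Q_system_def mtimes_def star_hom_def)

context frobenius_algebra
begin

definition h :: "'h bop" where "h = sqrt_bop n"
definition k :: "'h bop" where "k = inv_bop h"

lemma h_rules:
  shows "h \<in> N" "h\<^sup>\<dagger> = h" "h * h = n" "k \<in> N" "k\<^sup>\<dagger> = k" "h * k = 1" "k * h = 1"
    and "a \<in> N \<Longrightarrow> h * \<theta> a = \<theta> a * h" "a \<in> N \<Longrightarrow> k * \<theta> a = \<theta> a * k"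
proof -
  note s = sqrt_bop_coercive[OF n_coercive, folded h_def]
  note i = inv_bop_coercive[OF s(1), folded k_def]
  show hN: "h \<in> N" unfolding h_def by (rule von_neumann_sqrt[OF vN n_N n_coercive])
  show "h\<^sup>\<dagger> = h" using s(1) by (simp add: coercive_def)
  show "h * h = n" by (rule s(2))
  show "k\<^sup>\<dagger> = k" by (rule i(3))
  show "h * k = 1" "k * h = 1" by (rule i(2), rule i(1))
  then show "k \<in> N" by (rule von_neumann_inverse[OF vN hN])
  show *: "h * \<theta> a = \<theta> a * h" if "a \<in> N" for a by (rule s(3)[symmetric]) (simp add: n_int that)
  show "k * \<theta> a = \<theta> a * k" if "a \<in> N" by (rule i(4)[symmetric]) (simp add: * that)
qed

text \<open>Factors \<open>h\<close> and \<open>k\<close> are cancelled or combined into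
  \<open>n\<close> and its inverse \<open>m\<close>, which pass through \<open>x\<close> by
  \<open>x_n\<close>; a single \<open>\<theta> k\<close> passes by the intertwining property of
  \<open>x\<close>.\<close>

lemma normalised_relations:
  defines "w' \<equiv> h * w" and "x' \<equiv> k * \<theta> k * x * h"
  shows "w' \<in> Hom N N id \<theta>" and "x' \<in> Hom N N \<theta> (\<theta> \<circ> \<theta>)"
    and "w'\<^sup>\<dagger> * x' = 1" and "\<theta> (w'\<^sup>\<dagger>) * x' = 1" and "x' * x' = \<theta> x' * x'"
    and "\<theta> (x'\<^sup>\<dagger>) * x' = x' * x'\<^sup>\<dagger>" and "w'\<^sup>\<dagger> * w' = r\<^sup>\<dagger> * r" and "x'\<^sup>\<dagger> * x' = 1"
proof -
  note hk = h_rules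
  have [simp]: "h \<in> N" "k \<in> N" by (rule hk)+
  have sa: "h\<^sup>\<dagger> = h" "k\<^sup>\<dagger> = k" by (rule hk)+
  have \<theta>sa: "(\<theta> h)\<^sup>\<dagger> = \<theta> h" "(\<theta> k)\<^sup>\<dagger> = \<theta> k"
    using \<theta>_simps(5)[of h] \<theta>_simps(5)[of k] by (simp_all only: sa hk(1,4) simp_thms)
  have hh: "\<theta> h * \<theta> k = 1" "\<theta> k * \<theta> h = 1"
    using \<theta>_simps(2)[of h k] \<theta>_simps(2)[of k h] by (simp_all only: hk(1,4,6,7) \<theta>_simps(6) simp_thms)
  note inv = hk(6) hk(7) hk(6)[THEN reassoc] hk(7)[THEN reassoc] hh hh[THEN reassoc]
  \<comment> \<open>The inverse of \<open>n\<close>; multiplying the relations of \<open>x_n\<close>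
    by it on both sides shows that it slides through \<open>x\<close> as \<open>n\<close>
    does.\<close>
  define m where "m = k * k"
  have [simp]: "m \<in> N" by (simp add: m_def)
  have nm: "n * m = 1" "m * n = 1" by (simp_all add: m_def mult.assoc inv flip: hk(3))
  have xm: "x * m = m * x" "x * m = \<theta> m * x"
  proof -
    have "x * m = m * (n * x) * m" by (simp add: nm flip: mult.assoc)
    also have "n * x = x * n" by (rule x_n(2)[symmetric])
    finally show "x * m = m * x" by (simp add: mult.assoc nm)
    have "x * m = \<theta> (m * n) * x * m" by (simp add: nm del: \<theta>_simps(2))
    also have "\<dots> = \<theta> m * (\<theta> n * x) * m" by (simp add: mult.assoc)
    also have "\<theta> n * x = x * n" by (rule x_n(1)[symmetric])
    finally show "x * m = \<theta> m * x" by (simp add: mult.assoc nm)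
  qed
  show w'H: "w' \<in> Hom N N id \<theta>"
    by (simp add: w'_def Hom_def mult.assoc w_int hk(8)[THEN reassoc])
  have x'_int: "x' * \<theta> a = \<theta> (\<theta> a) * x'" if "a \<in> N" for a
  proof -
    have "x' * \<theta> a = k * (\<theta> k * \<theta> (\<theta> a)) * x * h"
      using that by (simp add: x'_def mult.assoc hk(8) x_int[THEN reassoc])
    also have "\<theta> k * \<theta> (\<theta> a) = \<theta> (\<theta> a) * \<theta> k" using that hk(9)[of a] by (simp flip: \<theta>_simps(2))
    finally show ?thesis using that by (simp add: x'_def mult.assoc hk(9)[THEN reassoc])
  qed
  then show "x' \<in> Hom N N \<theta> (\<theta> \<circ> \<theta>)" by (simp add: Hom_def) (simp add: x'_def)
  show "w'\<^sup>\<dagger> * x' = 1"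
    by (simp add: w'_def x'_def sa mult.assoc inv w_adj_int[THEN reassoc] unit_left[THEN reassoc])
  have "\<theta> (w'\<^sup>\<dagger>) * x' = (\<theta> w)\<^sup>\<dagger> * \<theta> h * (k * \<theta> k) * x * h"
    by (simp add: w'_def x'_def \<theta>sa mult.assoc)
  also have "k * \<theta> k = \<theta> k * k" by (simp add: hk)
  also have "(\<theta> w)\<^sup>\<dagger> * \<theta> h * (\<theta> k * k) * x * h = \<theta> (w\<^sup>\<dagger>) * k * x * h"
    by (simp add: mult.assoc inv)
  also have "\<theta> (w\<^sup>\<dagger>) * k = k * \<theta> (w\<^sup>\<dagger>)" by (rule hk(9)[symmetric]) simp
  finally show "\<theta> (w'\<^sup>\<dagger>) * x' = 1"
    using unit_right by (simp only: mult.assoc unit_right[THEN reassoc] hk mult_1_left)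
  have k\<theta>: "k * \<theta> a * b = \<theta> a * (k * b)" if "a \<in> N" for a b
    using that by (simp add: hk(9) mult.assoc)
  show "x' * x' = \<theta> x' * x'"
  proof -
    have "x' * x' = k * \<theta> k * (x * \<theta> k) * x * h"
      by (simp add: x'_def mult.assoc inv)
    also have "\<dots> = k * \<theta> k * \<theta> (\<theta> k) * \<theta> x * x * h"
      by (subst x_int) (simp_all add: mult.assoc coassoc[THEN reassoc])
    also have "\<dots> = k * (\<theta> (k * \<theta> k * x) * x * h)" by (simp add: mult.assoc)
    also have "\<dots> = k * (\<theta> (x' * k) * x * h)" by (simp only: x'_def mult.assoc hk mult_1_right)
    also have "\<dots> = (k * \<theta> x') * (\<theta> k * x * h)" by (simp add: x'_def mult.assoc)
    also have "k * \<theta> x' = \<theta> x' * k" by (rule hk(9)) (simp add: x'_def)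
    finally show ?thesis by (simp add: x'_def mult.assoc)
  qed
  have x'_adj: "x'\<^sup>\<dagger> = h * x\<^sup>\<dagger> * \<theta> k * k"
    using \<theta>sa sa by (simp add: x'_def mult.assoc)
  show "\<theta> (x'\<^sup>\<dagger>) * x' = x' * x'\<^sup>\<dagger>"
  proof -
    have "\<theta> (x'\<^sup>\<dagger>) * x' = \<theta> (h * x\<^sup>\<dagger> * \<theta> k * k) * (k * \<theta> k) * x * h"
      unfolding x'_adj by (simp add: x'_def mult.assoc)
    also have "k * \<theta> k = \<theta> k * k" by (rule hk(9)) simp
    also have "\<theta> (h * x\<^sup>\<dagger> * \<theta> k * k) * (\<theta> k * k) * x * h = (\<theta> (h * x\<^sup>\<dagger> * \<theta> k * m) * k) * x * h"
      by (simp add: m_def mult.assoc)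
    also have "\<theta> (h * x\<^sup>\<dagger> * \<theta> k * m) * k = k * \<theta> (h * x\<^sup>\<dagger> * \<theta> k * m)" by (rule hk(9)[symmetric]) simp
    also have "k * \<theta> (h * x\<^sup>\<dagger> * \<theta> k * m) * x * h = k * \<theta> (h * x\<^sup>\<dagger>) * \<theta> (\<theta> k) * (\<theta> m * x) * h"
      by (simp add: mult.assoc)
    also have "\<theta> m * x = x * m" by (rule xm(2)[symmetric])
    also have "k * \<theta> (h * x\<^sup>\<dagger>) * \<theta> (\<theta> k) * (x * m) * h = k * \<theta> (h * x\<^sup>\<dagger>) * (\<theta> (\<theta> k) * x) * k"
      by (simp add: mult.assoc m_def inv)
    also have "\<theta> (\<theta> k) * x = x * \<theta> k" by (rule x_int[symmetric]) simp
    also have "k * \<theta> (h * x\<^sup>\<dagger>) * (x * \<theta> k) * k = k * \<theta> h * (\<theta> (x\<^sup>\<dagger>) * x) * \<theta> k * k"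
      by (simp add: mult.assoc)
    also have "\<dots> = k * \<theta> h * x * x\<^sup>\<dagger> * \<theta> k * k" by (simp only: frobenius mult.assoc)
    \<comment> \<open>Trades \<open>\<theta> h\<close> for the factor \<open>\<theta> k\<close>
      needed in \<open>x'\<close>; the remaining \<open>\<theta> n\<close> moves through
      \<open>x\<close> and supplies the \<open>h\<close> of \<open>x'\<close> and that of its
      adjoint.\<close>
    also have "\<theta> h = \<theta> k * \<theta> n" by (simp add: mult.assoc inv flip: hk(3))
    also have "k * (\<theta> k * \<theta> n) * x * x\<^sup>\<dagger> * \<theta> k * k = k * \<theta> k * (\<theta> n * x) * x\<^sup>\<dagger> * \<theta> k * k"
      by (simp add: mult.assoc)
    also have "\<theta> n * x = x * (h * h)" by (simp add: x_n(1) hk)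
    finally show ?thesis unfolding x'_adj by (simp add: x'_def mult.assoc)
  qed
  show "w'\<^sup>\<dagger> * w' = r\<^sup>\<dagger> * r"
    by (simp add: w'_def r_adj_r sa mult.assoc hk(3)[THEN reassoc])
  show "x'\<^sup>\<dagger> * x' = 1"
  proof -
    have "x'\<^sup>\<dagger> * x' = h * x\<^sup>\<dagger> * \<theta> k * (m * \<theta> k) * x * h"
      unfolding x'_adj by (simp add: x'_def mult.assoc m_def)
    also have "m * \<theta> k = \<theta> k * m" by (simp add: m_def mult.assoc hk(9) hk(9)[THEN reassoc])
    also have "h * x\<^sup>\<dagger> * \<theta> k * (\<theta> k * m) * x * h = h * x\<^sup>\<dagger> * \<theta> m * (m * x) * h"
      by (simp add: mult.assoc m_def)
    also have "m * x = x * m" by (rule xm(1)[symmetric])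
    also have "h * x\<^sup>\<dagger> * \<theta> m * (x * m) * h = h * x\<^sup>\<dagger> * (\<theta> m * x) * m * h" by (simp only: mult.assoc)
    also have "\<theta> m * x = x * m" by (rule xm(2)[symmetric])
    also have "h * x\<^sup>\<dagger> * (x * m) * m * h = h * n * m * m * h" by (simp add: n_def mult.assoc)
    also have "\<dots> = 1" by (simp add: mult.assoc nm(1)[THEN reassoc]) (simp add: m_def mult.assoc inv)
    finally show ?thesis .
  qed
qed

text \<open>Before scaling, \<open>k * \<theta> k * x * h\<close> is an isometry and the square of
  \<open>h * w\<close> is \<open>d\<close>. Reciprocal factors keep the unit laws, and the fourth
  roots of \<open>d\<close> split this so that both squares become \<open>sqrt d\<close>.\<close>

lemma normalised_Q_system:
  assumes "\<theta> \<in> C" and d: "d = hom_dim N N \<theta>" "d > 0"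
    and rr: "r\<^sup>\<dagger> * r = complex_of_real d *\<^sub>C 1"
  shows "Q_system N C \<theta> (complex_of_real (d powr (- 1 / 4)) *\<^sub>C (h * w))
    (complex_of_real (d powr (1 / 4)) *\<^sub>C (k * \<theta> k * x * h))"
proof -
  define c where "c = d powr (1 / 4)"
  define c' where "c' = d powr (- 1 / 4)"
  have cc: "c * c' = 1" "c' * c = 1" using d(2) by (simp_all add: c_def c'_def flip: powr_add)
  have csq: "c * c = sqrt d" using d(2) by (simp add: c_def powr_half_sqrt[symmetric] flip: powr_add)
  have "c' * c' * d = c' * c' * (c * c * (c * c))" using d(2) by (simp add: csq)
  also have "\<dots> = (c' * c) * (c' * c) * (c * c)" by (simp only: mult_ac)
  finally have c'sq: "c' * c' * d = sqrt d" by (simp add: cc csq)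
  have Q: "Q_dim N \<theta> = sqrt d" by (simp add: Q_dim_def d)
  define w' where "w' = h * w"
  define x' where "x' = k * \<theta> k * x * h"
  note R = normalised_relations[folded w'_def x'_def]
  have [simp]: "w' \<in> N" "x' \<in> N" using R(1,2) by (auto simp: Hom_def)
  show ?thesis
    unfolding Q_system_def mtimes_def Q c_def[symmetric] c'_def[symmetric] w'_def[symmetric] x'_def[symmetric]
  proof (intro conjI)
    show "\<theta> \<in> C" by fact
    show "complex_of_real c' *\<^sub>C w' \<in> Hom N N id \<theta>"
      using R(1) by (auto simp: Hom_def simp flip: scaleR_bop_def)
    show "complex_of_real c *\<^sub>C x' \<in> Hom N N \<theta> (\<theta> \<circ> \<theta>)"
      using R(2) by (auto simp: Hom_def simp flip: scaleR_bop_def)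
    show "(complex_of_real c' *\<^sub>C w')\<^sup>\<dagger> * \<theta> 1 * complex_of_real c *\<^sub>C x' = 1"
      using R(3) cc by (simp flip: scaleR_bop_def)
    show "1 * \<theta> ((complex_of_real c' *\<^sub>C w')\<^sup>\<dagger>) * complex_of_real c *\<^sub>C x' = 1"
      using R(4) cc by (simp flip: scaleR_bop_def)
    show "complex_of_real c *\<^sub>C x' * \<theta> 1 * complex_of_real c *\<^sub>C x' =
        1 * \<theta> (complex_of_real c *\<^sub>C x') * complex_of_real c *\<^sub>C x'"
      using R(5) by (simp flip: scaleR_bop_def)
    have F: "\<theta> (x'\<^sup>\<dagger>) * x' = x' * x'\<^sup>\<dagger>" by (rule R(6))
    then show "1 * \<theta> ((complex_of_real c *\<^sub>C x')\<^sup>\<dagger>) * (complex_of_real c *\<^sub>C x' * \<theta> 1) =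
        complex_of_real c *\<^sub>C x' * (complex_of_real c *\<^sub>C x')\<^sup>\<dagger>"
      by (simp flip: scaleR_bop_def)
    have "x'\<^sup>\<dagger> * \<theta> x' = x' * x'\<^sup>\<dagger>" using arg_cong[OF F, of adj] by simp
    then show "complex_of_real c *\<^sub>C x' * (complex_of_real c *\<^sub>C x')\<^sup>\<dagger> =
        (complex_of_real c *\<^sub>C x')\<^sup>\<dagger> * (\<theta> \<circ> \<theta>) 1 * (1 * \<theta> (complex_of_real c *\<^sub>C x'))"
      by (simp flip: scaleR_bop_def)
    have "(complex_of_real c' *\<^sub>C w')\<^sup>\<dagger> * (complex_of_real c' *\<^sub>C w') = (c' * c') *\<^sub>R (d *\<^sub>R 1)"
      using R(7) rr by (simp flip: scaleR_bop_def)
    also have "\<dots> = complex_of_real (sqrt d) *\<^sub>C 1" using c'sq by (simp flip: scaleR_bop_def)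
    finally show "(complex_of_real c' *\<^sub>C w')\<^sup>\<dagger> * (complex_of_real c' *\<^sub>C w') = complex_of_real (sqrt d) *\<^sub>C 1" .
    show "(complex_of_real c *\<^sub>C x')\<^sup>\<dagger> * (complex_of_real c *\<^sub>C x') = complex_of_real (sqrt d) *\<^sub>C 1"
      using R(8) csq by (simp flip: scaleR_bop_def)
  qed
qed

end

subsection \<open>Compression to a projection\<close>

locale frobenius_projection = frobenius_algebra +
  fixes P S
  assumes P_Hom: "P \<in> Hom N N \<theta> \<theta>" and P_proj: "projection P"
    and P_left: "P * \<theta> P * x = P * x * P"
    and P_right: "P * x * P = \<theta> P * x * P"
    and P_w: "P * w = w"
    and S_N [simp]: "S \<in> N" and S_isometry: "S\<^sup>\<dagger> * S = 1" and S_P: "S * S\<^sup>\<dagger> = P"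
begin

lemma P_N [simp]: "P \<in> N"
  using P_Hom by (simp add: Hom_def)

lemma P_int: "a \<in> N \<Longrightarrow> P * \<theta> a = \<theta> a * P"
  using P_Hom by (simp add: Hom_def)

lemma P_rules: "P * P = P" "P\<^sup>\<dagger> = P" "(\<theta> P)\<^sup>\<dagger> = \<theta> P" "\<theta> P * \<theta> P = \<theta> P"
proof -
  show 1: "P * P = P" "P\<^sup>\<dagger> = P" using P_proj by (auto simp: projection_def)
  show "(\<theta> P)\<^sup>\<dagger> = \<theta> P" using \<theta>_simps(5)[of P] by (simp add: 1)
  show "\<theta> P * \<theta> P = \<theta> P" using \<theta>_simps(2)[of P P] by (simp add: 1)
qed

lemma S_rules: "P * S = S" "S\<^sup>\<dagger> * P = S\<^sup>\<dagger>" "\<theta> P * \<theta> S = \<theta> S" "\<theta> (S\<^sup>\<dagger>) * \<theta> P = \<theta> (S\<^sup>\<dagger>)"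
proof -
  show 1: "P * S = S" by (simp add: S_isometry mult.assoc flip: S_P)
  show 2: "S\<^sup>\<dagger> * P = S\<^sup>\<dagger>" by (simp add: S_isometry flip: S_P mult.assoc)
  show "\<theta> P * \<theta> S = \<theta> S" using \<theta>_simps(2)[of P S] by (simp add: 1)
  show "\<theta> (S\<^sup>\<dagger>) * \<theta> P = \<theta> (S\<^sup>\<dagger>)" using \<theta>_simps(2)[of "S\<^sup>\<dagger>" P] by (simp add: 2)
qed

text \<open>A two-out-of-three rule: with \<open>P\<close> on any two of the three legs of
  \<open>x\<close>, it may be put on the third as well.\<close>

lemma P_x: "P * \<theta> P * x * P = P * \<theta> P * x" "P * x * P = P * \<theta> P * x" "\<theta> P * x * P = P * \<theta> P * x"
proof -
  show "P * \<theta> P * x * P = P * \<theta> P * x" by (simp only: P_left) (simp only: mult.assoc P_rules)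
  show "P * x * P = P * \<theta> P * x" by (rule P_left[symmetric])
  show "\<theta> P * x * P = P * \<theta> P * x" by (simp only: P_left P_right)
qed

text \<open>The incoming leg of \<open>x\<close> is closed by \<open>w = P * w\<close> and so
  already carries \<open>P\<close>. The rule \<open>P_x\<close> then spreads a projection on one leg
  of \<open>r\<close> to the other.\<close>

lemma r_P: "P * r = P * \<theta> P * r" "\<theta> P * r = P * \<theta> P * r"
proof -
  have "P * x * P * w = P * \<theta> P * x * w" by (simp only: P_x)
  then show "P * r = P * \<theta> P * r" by (simp add: r_def mult.assoc P_w)
  have "\<theta> P * x * P * w = P * \<theta> P * x * w" by (simp only: P_x)
  then show "\<theta> P * r = P * \<theta> P * r" by (simp add: r_def mult.assoc P_w)
qed

lemma r_adj_P: "r\<^sup>\<dagger> * \<theta> P = r\<^sup>\<dagger> * P"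
proof -
  have "P * r = \<theta> P * r" using r_P by simp
  from arg_cong[OF this, of adj] show ?thesis by (simp add: P_rules)
qed

definition \<theta>\<^sub>P :: "'a bop \<Rightarrow> 'a bop" where "\<theta>\<^sub>P = (\<lambda>a. S\<^sup>\<dagger> * \<theta> a * S)"
definition W :: "'a bop" where "W = S\<^sup>\<dagger> * w"
definition X :: "'a bop" where "X = S\<^sup>\<dagger> * \<theta> (S\<^sup>\<dagger>) * x * S"

lemma WX_N [simp]: "W \<in> N" "X \<in> N"
  by (simp_all add: W_def X_def del: \<theta>_simps(5))

lemma \<theta>\<^sub>P_N [simp]: "a \<in> N \<Longrightarrow> \<theta>\<^sub>P a \<in> N"
  by (simp add: \<theta>\<^sub>P_def)

lemma S_int: "a \<in> N \<Longrightarrow> S * \<theta>\<^sub>P a = \<theta> a * S"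
proof -
  assume a: "a \<in> N"
  have "S * \<theta>\<^sub>P a = P * \<theta> a * S" by (simp add: \<theta>\<^sub>P_def S_P[THEN reassoc] mult.assoc)
  then show ?thesis using a by (simp add: P_int mult.assoc S_rules)
qed

lemma S_adj_int: "a \<in> N \<Longrightarrow> S\<^sup>\<dagger> * \<theta> a = \<theta>\<^sub>P a * S\<^sup>\<dagger>"
proof -
  assume a: "a \<in> N"
  have "\<theta>\<^sub>P a * S\<^sup>\<dagger> = S\<^sup>\<dagger> * (\<theta> a * P)" by (simp add: \<theta>\<^sub>P_def S_P mult.assoc)
  then show ?thesis using a by (simp add: P_int[symmetric] S_rules(2)[THEN reassoc])
qed

lemma \<theta>\<^sub>P_hom: "star_hom N N \<theta>\<^sub>P"
  unfolding star_hom_def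
proof (intro conjI ballI allI)
  show "\<theta>\<^sub>P (a * b) = \<theta>\<^sub>P a * \<theta>\<^sub>P b" if "a \<in> N" "b \<in> N" for a b
  proof -
    have "\<theta>\<^sub>P a * \<theta>\<^sub>P b = S\<^sup>\<dagger> * \<theta> a * (S * \<theta>\<^sub>P b)" by (simp add: \<theta>\<^sub>P_def mult.assoc)
    then show ?thesis using that by (simp add: S_int) (simp add: \<theta>\<^sub>P_def mult.assoc)
  qed
qed (simp_all add: \<theta>\<^sub>P_def distrib_left distrib_right scaleC_bop_times_left scaleC_bop_times_right
    mult.assoc S_isometry)

lemma \<theta>\<^sub>P_adj [simp]: "a \<in> N \<Longrightarrow> \<theta>\<^sub>P (a\<^sup>\<dagger>) = (\<theta>\<^sub>P a)\<^sup>\<dagger>"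
  using \<theta>\<^sub>P_hom by (auto simp: star_hom_def)

lemma S\<theta>S_x_P: "S\<^sup>\<dagger> * \<theta> (S\<^sup>\<dagger>) * x * P = S\<^sup>\<dagger> * \<theta> (S\<^sup>\<dagger>) * x"
proof -
  have e: "S\<^sup>\<dagger> * \<theta> (S\<^sup>\<dagger>) = S\<^sup>\<dagger> * \<theta> (S\<^sup>\<dagger>) * (P * \<theta> P)"
  proof -
    have "S\<^sup>\<dagger> * \<theta> (S\<^sup>\<dagger>) * (P * \<theta> P) = S\<^sup>\<dagger> * (\<theta> (S\<^sup>\<dagger>) * P) * \<theta> P" by (simp only: mult.assoc)
    also have "\<theta> (S\<^sup>\<dagger>) * P = P * \<theta> (S\<^sup>\<dagger>)" by (rule P_int[symmetric]) simp
    also have "S\<^sup>\<dagger> * (P * \<theta> (S\<^sup>\<dagger>)) * \<theta> P = S\<^sup>\<dagger> * P * (\<theta> (S\<^sup>\<dagger>) * \<theta> P)" by (simp only: mult.assoc)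
    finally show ?thesis by (simp only: S_rules)
  qed
  have "S\<^sup>\<dagger> * \<theta> (S\<^sup>\<dagger>) * x * P = S\<^sup>\<dagger> * \<theta> (S\<^sup>\<dagger>) * (P * \<theta> P * x * P)"
    by (subst e) (simp only: mult.assoc)
  also have "\<dots> = S\<^sup>\<dagger> * \<theta> (S\<^sup>\<dagger>) * (P * \<theta> P) * x" by (simp only: P_x(1)) (simp only: mult.assoc)
  finally show ?thesis by (simp only: e[symmetric])
qed

lemma X_S_adj: "X * S\<^sup>\<dagger> = S\<^sup>\<dagger> * \<theta> (S\<^sup>\<dagger>) * x"
  by (simp add: X_def mult.assoc S_P) (simp only: S\<theta>S_x_P[simplified mult.assoc \<theta>_simps S_N])

lemma \<theta>\<^sub>P_\<theta>\<^sub>P_S: "a \<in> N \<Longrightarrow> S\<^sup>\<dagger> * \<theta> (S\<^sup>\<dagger>) * \<theta> (\<theta> a) = \<theta>\<^sub>P (\<theta>\<^sub>P a) * (S\<^sup>\<dagger> * \<theta> (S\<^sup>\<dagger>))"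
proof -
  assume a: "a \<in> N"
  have "S\<^sup>\<dagger> * \<theta> (S\<^sup>\<dagger>) * \<theta> (\<theta> a) = S\<^sup>\<dagger> * \<theta> (S\<^sup>\<dagger> * \<theta> a)" using a by (simp add: mult.assoc)
  also have "\<dots> = S\<^sup>\<dagger> * \<theta> (\<theta>\<^sub>P a) * \<theta> (S\<^sup>\<dagger>)" using a by (simp only: S_adj_int[OF a] \<theta>_simps(2) \<theta>\<^sub>P_N S_N N.adj mult.assoc)
  also have "\<dots> = \<theta>\<^sub>P (\<theta>\<^sub>P a) * (S\<^sup>\<dagger> * \<theta> (S\<^sup>\<dagger>))"
    using a by (simp only: S_adj_int \<theta>\<^sub>P_N) (simp only: mult.assoc)
  finally show ?thesis .
qed

lemma w_adj_S: "w\<^sup>\<dagger> * P = w\<^sup>\<dagger>"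
  using arg_cong[OF P_w, of adj] by (simp add: P_rules)

lemma compressed_frobenius_algebra: "frobenius_algebra N \<theta>\<^sub>P W X"
proof
  show "von_neumann_algebra N" by (rule vN)
  show "star_hom N N \<theta>\<^sub>P" by (rule \<theta>\<^sub>P_hom)
  show "W \<in> Hom N N id \<theta>\<^sub>P"
    by (simp add: Hom_def) (simp add: W_def mult.assoc w_int S_adj_int[THEN reassoc])
  have Xint: "X * \<theta>\<^sub>P a = \<theta>\<^sub>P (\<theta>\<^sub>P a) * X" if "a \<in> N" for a
  proof -
    have "X * \<theta>\<^sub>P a = S\<^sup>\<dagger> * \<theta> (S\<^sup>\<dagger>) * (x * \<theta> a) * S"
      using that by (simp add: X_def mult.assoc S_int)
    also have "\<dots> = S\<^sup>\<dagger> * \<theta> (S\<^sup>\<dagger>) * \<theta> (\<theta> a) * x * S" using that by (simp only: x_int mult.assoc)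
    also have "\<dots> = \<theta>\<^sub>P (\<theta>\<^sub>P a) * X" using that by (simp only: \<theta>\<^sub>P_\<theta>\<^sub>P_S) (simp only: X_def mult.assoc)
    finally show ?thesis .
  qed
  then show "X \<in> Hom N N \<theta>\<^sub>P (\<theta>\<^sub>P \<circ> \<theta>\<^sub>P)" by (simp add: Hom_def)
  show "W\<^sup>\<dagger> * X = 1"
  proof -
    have "W\<^sup>\<dagger> * X = w\<^sup>\<dagger> * P * \<theta> (S\<^sup>\<dagger>) * x * S"
      by (simp add: W_def X_def mult.assoc S_P[THEN reassoc])
    also have "\<dots> = S\<^sup>\<dagger> * (w\<^sup>\<dagger> * x) * S"
      by (simp only: w_adj_S w_adj_int S_N N.adj mult.assoc)
    finally show ?thesis by (simp add: unit_left S_isometry)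
  qed
  show "\<theta>\<^sub>P (W\<^sup>\<dagger>) * X = 1"
  proof -
    have "\<theta>\<^sub>P (W\<^sup>\<dagger>) * X = S\<^sup>\<dagger> * \<theta> (w\<^sup>\<dagger> * S) * (S * S\<^sup>\<dagger>) * \<theta> (S\<^sup>\<dagger>) * x * S"
      by (simp add: \<theta>\<^sub>P_def W_def X_def mult.assoc)
    also have "\<dots> = S\<^sup>\<dagger> * \<theta> (w\<^sup>\<dagger> * S) * (P * \<theta> (S\<^sup>\<dagger>)) * x * S" by (simp only: S_P mult.assoc)
    also have "P * \<theta> (S\<^sup>\<dagger>) = \<theta> (S\<^sup>\<dagger>) * P" by (rule P_int) simp
    also have "S\<^sup>\<dagger> * \<theta> (w\<^sup>\<dagger> * S) * (\<theta> (S\<^sup>\<dagger>) * P) * x * S = S\<^sup>\<dagger> * (\<theta> (w\<^sup>\<dagger> * (S * S\<^sup>\<dagger>)) * P) * x * S"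
      by (simp add: mult.assoc)
    also have "\<theta> (w\<^sup>\<dagger> * (S * S\<^sup>\<dagger>)) * P = P * \<theta> (w\<^sup>\<dagger>)"
      by (simp only: S_P w_adj_S P_int N.adj wx)
    also have "S\<^sup>\<dagger> * (P * \<theta> (w\<^sup>\<dagger>)) * x * S = (S\<^sup>\<dagger> * P) * (\<theta> (w\<^sup>\<dagger>) * x) * S" by (simp only: mult.assoc)
    finally show ?thesis by (simp only: unit_right S_rules S_isometry mult_1_right)
  qed
  let ?Q = "S\<^sup>\<dagger> * \<theta> (S\<^sup>\<dagger>)"
  have \<theta>\<^sub>P_b: "\<theta>\<^sub>P b * X = S\<^sup>\<dagger> * \<theta> (b * S\<^sup>\<dagger>) * x * S" if b: "b \<in> N" for b
  proof -
    have "\<theta>\<^sub>P b * X = \<theta>\<^sub>P b * S\<^sup>\<dagger> * \<theta> (S\<^sup>\<dagger>) * x * S" by (simp only: X_def mult.assoc)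
    also have "\<theta>\<^sub>P b * S\<^sup>\<dagger> = S\<^sup>\<dagger> * \<theta> b" using b by (simp only: S_adj_int)
    finally show ?thesis using b by (simp add: mult.assoc)
  qed
  show "X * X = \<theta>\<^sub>P X * X"
  proof -
    have "X * X = X * S\<^sup>\<dagger> * \<theta> (S\<^sup>\<dagger>) * x * S" by (subst (2) X_def) (simp only: mult.assoc)
    also have "\<dots> = ?Q * (x * \<theta> (S\<^sup>\<dagger>)) * x * S" by (simp only: X_S_adj mult.assoc)
    also have "\<dots> = ?Q * \<theta> (\<theta> (S\<^sup>\<dagger>)) * (x * x) * S" by (simp only: x_int S_N N.adj mult.assoc)
    also have "\<dots> = S\<^sup>\<dagger> * \<theta> (?Q * x) * x * S" by (simp add: coassoc mult.assoc)
    also have "\<dots> = \<theta>\<^sub>P X * X" by (simp only: \<theta>\<^sub>P_b WX_N X_S_adj)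
    finally show ?thesis .
  qed
  show "\<theta>\<^sub>P (X\<^sup>\<dagger>) * X = X * X\<^sup>\<dagger>"
  proof -
    have X_adj: "X\<^sup>\<dagger> = S\<^sup>\<dagger> * x\<^sup>\<dagger> * \<theta> S * S" by (simp add: X_def mult.assoc)
    \<comment> \<open>The adjoint of the two-out-of-three rule moves \<open>P\<close> to the inner
      leg, where it is absorbed by \<open>\<theta> S\<close>.\<close>
    have SxP: "S\<^sup>\<dagger> * x\<^sup>\<dagger> * P = S\<^sup>\<dagger> * x\<^sup>\<dagger> * \<theta> P"
    proof -
      have "P * x * P = \<theta> P * x * P" by (rule P_right)
      from arg_cong[OF this, of adj] have "P * x\<^sup>\<dagger> * P = P * x\<^sup>\<dagger> * \<theta> P" by (simp add: P_rules mult.assoc)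
      then have "S\<^sup>\<dagger> * (P * x\<^sup>\<dagger> * P) = S\<^sup>\<dagger> * (P * x\<^sup>\<dagger> * \<theta> P)" by simp
      then show ?thesis by (simp add: S_rules(2)[THEN reassoc] mult.assoc)
    qed
    have "\<theta>\<^sub>P (X\<^sup>\<dagger>) * X = S\<^sup>\<dagger> * \<theta> (S\<^sup>\<dagger> * x\<^sup>\<dagger> * \<theta> S * (S * S\<^sup>\<dagger>)) * x * S"
      by (subst \<theta>\<^sub>P_b) (simp_all add: X_adj mult.assoc)
    also have "S\<^sup>\<dagger> * x\<^sup>\<dagger> * \<theta> S * (S * S\<^sup>\<dagger>) = S\<^sup>\<dagger> * x\<^sup>\<dagger> * P * \<theta> S"
      by (simp only: S_P P_int S_N mult.assoc)
    also have "S\<^sup>\<dagger> * x\<^sup>\<dagger> * P * \<theta> S = S\<^sup>\<dagger> * x\<^sup>\<dagger> * \<theta> S"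
      by (simp only: SxP) (simp only: S_rules mult.assoc)
    also have "S\<^sup>\<dagger> * \<theta> (S\<^sup>\<dagger> * x\<^sup>\<dagger> * \<theta> S) * x * S = ?Q * \<theta> (x\<^sup>\<dagger>) * (\<theta> (\<theta> S) * x) * S"
      by (simp add: mult.assoc)
    also have "\<theta> (\<theta> S) * x = x * \<theta> S" by (simp only: x_int S_N)
    also have "?Q * \<theta> (x\<^sup>\<dagger>) * (x * \<theta> S) * S = ?Q * (\<theta> (x\<^sup>\<dagger>) * x) * \<theta> S * S" by (simp only: mult.assoc)
    also have "\<dots> = X * S\<^sup>\<dagger> * x\<^sup>\<dagger> * \<theta> S * S" by (simp only: frobenius X_S_adj mult.assoc)
    also have "\<dots> = X * X\<^sup>\<dagger>" by (simp only: X_adj mult.assoc)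
    finally show ?thesis .
  qed
qed

sublocale compressed: frobenius_algebra N \<theta>\<^sub>P W X
  by (rule compressed_frobenius_algebra)

lemma compressed_r: "compressed.r = S\<^sup>\<dagger> * \<theta> (S\<^sup>\<dagger>) * r"
  unfolding compressed.r_def by (simp only: W_def mult.assoc[symmetric] X_S_adj r_def)

lemma compressed_n: "compressed.n = S\<^sup>\<dagger> * x\<^sup>\<dagger> * (P * \<theta> P) * x * S"
proof -
  have "compressed.n = S\<^sup>\<dagger> * x\<^sup>\<dagger> * \<theta> S * (S * S\<^sup>\<dagger>) * \<theta> (S\<^sup>\<dagger>) * x * S"
    unfolding compressed.n_def by (simp add: X_def mult.assoc)
  also have "\<dots> = S\<^sup>\<dagger> * x\<^sup>\<dagger> * (\<theta> S * P) * \<theta> (S\<^sup>\<dagger>) * x * S" by (simp only: S_P mult.assoc)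
  also have "\<theta> S * P = P * \<theta> S" by (simp only: P_int S_N)
  also have "S\<^sup>\<dagger> * x\<^sup>\<dagger> * (P * \<theta> S) * \<theta> (S\<^sup>\<dagger>) * x * S = S\<^sup>\<dagger> * x\<^sup>\<dagger> * (P * \<theta> (S * S\<^sup>\<dagger>)) * x * S"
    by (simp add: mult.assoc)
  finally show ?thesis by (simp only: S_P)
qed

text \<open>Both traces of \<open>b\<close> are those of its extension
  \<open>t = S * b * S\<^sup>\<dagger>\<close> to \<open>\<theta>\<close>. The cutting projection on
  one leg may be moved along \<open>r\<close> to the other, where \<open>t\<close> absorbs
  it.\<close>

lemma compressed_spherical:
  assumes spherical: "\<And>b. b \<in> Hom N N \<theta> \<theta> \<Longrightarrow> b\<^sup>\<dagger> = b \<Longrightarrow> r\<^sup>\<dagger> * b * r = r\<^sup>\<dagger> * \<theta> b * r"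
    and b: "b \<in> Hom N N \<theta>\<^sub>P \<theta>\<^sub>P" "b\<^sup>\<dagger> = b"
  shows "compressed.r\<^sup>\<dagger> * b * compressed.r = compressed.r\<^sup>\<dagger> * \<theta>\<^sub>P b * compressed.r"
proof -
  have b_int: "b * \<theta>\<^sub>P a = \<theta>\<^sub>P a * b" if "a \<in> N" for a
    using b that by (auto simp: Hom_def)
  have bN [simp]: "b \<in> N" using b by (simp add: Hom_def)
  define t where "t = S * b * S\<^sup>\<dagger>"
  have tN [simp]: "t \<in> N" by (simp add: t_def)
  have t_int: "t * \<theta> a = \<theta> a * t" if "a \<in> N" for a
  proof -
    have "t * \<theta> a = S * (b * \<theta>\<^sub>P a) * S\<^sup>\<dagger>" using that by (simp add: t_def mult.assoc S_adj_int)
    also have "\<dots> = S * \<theta>\<^sub>P a * b * S\<^sup>\<dagger>" using that by (simp add: b_int mult.assoc)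
    finally show ?thesis using that by (simp add: S_int t_def mult.assoc)
  qed
  have tP: "t * P = t" "P * t = t" "\<theta> t * \<theta> P = \<theta> t"
  proof -
    show 1: "t * P = t" "P * t = t" by (simp_all add: t_def mult.assoc S_rules S_rules[THEN reassoc])
    show "\<theta> t * \<theta> P = \<theta> t" using \<theta>_simps(2)[of t P] by (simp add: 1)
  qed
  have R_adj: "compressed.r\<^sup>\<dagger> = r\<^sup>\<dagger> * \<theta> S * S" by (simp add: compressed_r mult.assoc)
  have "compressed.r\<^sup>\<dagger> * b * compressed.r = r\<^sup>\<dagger> * (\<theta> S * t) * \<theta> (S\<^sup>\<dagger>) * r"
    by (simp only: R_adj) (simp only: compressed_r t_def mult.assoc)
  also have "\<theta> S * t = t * \<theta> S" by (simp only: t_int S_N)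
  also have "r\<^sup>\<dagger> * (t * \<theta> S) * \<theta> (S\<^sup>\<dagger>) * r = r\<^sup>\<dagger> * t * (\<theta> (S * S\<^sup>\<dagger>) * r)" by (simp add: mult.assoc)
  also have "\<theta> (S * S\<^sup>\<dagger>) * r = P * r" by (simp only: S_P r_P(2)) (simp only: r_P(1)[symmetric])
  also have "r\<^sup>\<dagger> * t * (P * r) = r\<^sup>\<dagger> * (t * P) * r" by (simp only: mult.assoc)
  also have "\<dots> = r\<^sup>\<dagger> * t * r" by (simp only: tP)
  also have "\<dots> = r\<^sup>\<dagger> * \<theta> t * r"
    by (rule spherical) (simp_all add: Hom_def t_int, simp add: t_def b mult.assoc)
  also have "\<dots> = r\<^sup>\<dagger> * (\<theta> t * \<theta> P) * r" by (simp only: tP)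
  also have "\<dots> = r\<^sup>\<dagger> * \<theta> t * (\<theta> P * r)" by (simp only: mult.assoc)
  also have "\<theta> P * r = P * r" by (simp only: r_P(2)) (simp only: r_P(1)[symmetric])
  also have "r\<^sup>\<dagger> * \<theta> t * (P * r) = r\<^sup>\<dagger> * (\<theta> t * P) * r" by (simp only: mult.assoc)
  also have "\<theta> t * P = \<theta> S * (S * S\<^sup>\<dagger>) * \<theta> (b * S\<^sup>\<dagger>)"
  proof -
    have "\<theta> t * P = \<theta> S * (\<theta> (b * S\<^sup>\<dagger>) * P)" by (simp add: t_def mult.assoc)
    also have "\<theta> (b * S\<^sup>\<dagger>) * P = P * \<theta> (b * S\<^sup>\<dagger>)" by (rule P_int[symmetric]) simp
    finally show ?thesis by (simp only: S_P mult.assoc)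
  qed
  also have "r\<^sup>\<dagger> * (\<theta> S * (S * S\<^sup>\<dagger>) * \<theta> (b * S\<^sup>\<dagger>)) * r = compressed.r\<^sup>\<dagger> * (S\<^sup>\<dagger> * \<theta> b) * \<theta> (S\<^sup>\<dagger>) * r"
    by (simp add: R_adj mult.assoc)
  also have "S\<^sup>\<dagger> * \<theta> b = \<theta>\<^sub>P b * S\<^sup>\<dagger>" by (simp only: S_adj_int bN)
  also have "compressed.r\<^sup>\<dagger> * (\<theta>\<^sub>P b * S\<^sup>\<dagger>) * \<theta> (S\<^sup>\<dagger>) * r = compressed.r\<^sup>\<dagger> * \<theta>\<^sub>P b * compressed.r"
    by (simp only: compressed_r mult.assoc)
  finally show ?thesis .
qed

end

subsection \<open>Extensions\<close>

lemma star_hom_compose: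
  assumes "star_hom A B \<alpha>" "star_hom B C \<beta>"
  shows "star_hom A C (\<lambda>a. \<beta> (\<alpha> a))"
  using assms unfolding star_hom_def by simp

context frobenius_algebra
begin

context
  fixes M :: "'k::chilbert_space bop set" and \<iota> :: "'h bop \<Rightarrow> 'k bop" and v :: "'k bop"
  assumes ext: "extension N \<theta> w x M \<iota> v"
begin

lemma \<iota>_simps:
  "a \<in> N \<Longrightarrow> \<iota> a \<in> M"
  "a \<in> N \<Longrightarrow> b \<in> N \<Longrightarrow> \<iota> (a * b) = \<iota> a * \<iota> b"
  "a \<in> N \<Longrightarrow> b \<in> N \<Longrightarrow> \<iota> (a + b) = \<iota> a + \<iota> b"
  "a \<in> N \<Longrightarrow> \<iota> (c *\<^sub>C a) = c *\<^sub>C \<iota> a"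
  "a \<in> N \<Longrightarrow> \<iota> (a\<^sup>\<dagger>) = (\<iota> a)\<^sup>\<dagger>"
  "\<iota> 1 = 1"
  using ext by (auto simp: extension_def star_hom_def)

lemma v_rules:
  "v \<in> M"
  "a \<in> N \<Longrightarrow> v * \<iota> a = \<iota> (\<theta> a) * v"
  "v * v = \<iota> x * v"
  "v\<^sup>\<dagger> = \<iota> (w\<^sup>\<dagger> * x\<^sup>\<dagger>) * v"
  "\<iota> (w\<^sup>\<dagger>) * v = 1"
  using ext by (auto simp: extension_def)

lemma extension_vN: "von_neumann_algebra M"
  using ext by (simp add: extension_def)

lemma extension_cases:
  assumes "m \<in> M"
  obtains a where "a \<in> N" "m = \<iota> a * v"
  using ext assms unfolding extension_def by blast

lemma extension_unique:
  assumes "a \<in> N" "b \<in> N" "\<iota> a * v = \<iota> b * v"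
  shows "a = b"
proof -
  interpret M: star_algebra M by (rule von_neumann_star_algebra[OF extension_vN])
  have "\<iota> a * v \<in> M" by (intro M.times \<iota>_simps assms v_rules)
  then show ?thesis using ext assms unfolding extension_def by metis
qed

lemma extension_times:
  assumes "a \<in> N" "b \<in> N"
  shows "(\<iota> a * v) * (\<iota> b * v) = \<iota> (a * \<theta> b * x) * v"
proof -
  have "(\<iota> a * v) * (\<iota> b * v) = \<iota> a * (v * \<iota> b) * v" by (simp only: mult.assoc)
  also have "\<dots> = \<iota> a * \<iota> (\<theta> b) * (v * v)" by (simp only: v_rules assms mult.assoc)
  finally show ?thesis using assms by (simp add: v_rules \<iota>_simps mult.assoc)
qed

lemma extension_adj:
  assumes "a \<in> N"
  shows "(\<iota> a * v)\<^sup>\<dagger> = \<iota> (w\<^sup>\<dagger> * x\<^sup>\<dagger> * \<theta> (a\<^sup>\<dagger>)) * v"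
proof -
  have "(\<iota> a * v)\<^sup>\<dagger> = v\<^sup>\<dagger> * \<iota> (a\<^sup>\<dagger>)" using assms by (simp add: \<iota>_simps)
  also have "\<dots> = \<iota> (w\<^sup>\<dagger> * x\<^sup>\<dagger>) * (v * \<iota> (a\<^sup>\<dagger>))" by (simp only: v_rules(4) mult.assoc)
  also have "\<dots> = \<iota> (w\<^sup>\<dagger> * x\<^sup>\<dagger>) * \<iota> (\<theta> (a\<^sup>\<dagger>)) * v" using assms by (simp only: v_rules N.adj mult.assoc)
  finally show ?thesis using assms by (simp only: \<iota>_simps(2) N.times N.adj wx \<theta>_simps(1))
qed

lemma extension_embed: "a \<in> N \<Longrightarrow> \<iota> a = \<iota> (a * w\<^sup>\<dagger>) * v"
  by (simp only: \<iota>_simps(2) N.adj wx mult.assoc v_rules mult_1_right)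

definition coefficient :: "'k bop \<Rightarrow> 'h bop" where
  "coefficient m = (THE a. a \<in> N \<and> m = \<iota> a * v)"

lemma coefficient: "a \<in> N \<Longrightarrow> coefficient (\<iota> a * v) = a"
  unfolding coefficient_def by (rule the_equality) (auto dest: extension_unique)

text \<open>The conjugate homomorphism of \<open>\<iota>\<close>. Coassociativity makes it
  multiplicative, the Frobenius law makes it preserve adjoints, and
  \<open>w\<^sup>\<dagger> * (\<theta> a * x) = a\<close> makes it faithful. It represents
  \<open>M\<close> on the space of \<open>N\<close>.\<close>

lemma conjugate_embedding:
  shows "star_hom M N (\<lambda>m. \<theta> (coefficient m) * x)"
    and "m \<in> M \<Longrightarrow> \<theta> (coefficient m) * x = 0 \<Longrightarrow> m = 0"
proof -
  let ?\<iota> = "\<lambda>m. \<theta> (coefficient m) * x"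
  show "star_hom M N ?\<iota>"
    unfolding star_hom_def
  proof (intro conjI ballI allI)
    fix m m' assume "m \<in> M" "m' \<in> M"
    then obtain a b where a: "a \<in> N" "m = \<iota> a * v" and b: "b \<in> N" "m' = \<iota> b * v"
      by (elim extension_cases)
    show "?\<iota> m \<in> N" by (simp add: a coefficient)
    have "m + m' = \<iota> (a + b) * v" by (simp add: a b \<iota>_simps distrib_right)
    then show "?\<iota> (m + m') = ?\<iota> m + ?\<iota> m'" by (simp add: a b coefficient distrib_right)
    have "m * m' = \<iota> (a * \<theta> b * x) * v" by (simp only: a b extension_times)
    then have "?\<iota> (m * m') = \<theta> a * \<theta> (\<theta> b) * (x * x)" using a b by (simp add: coefficient coassoc mult.assoc)
    also have "\<dots> = ?\<iota> m * ?\<iota> m'" using a b by (simp add: coefficient mult.assoc x_int[THEN reassoc])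
    finally show "?\<iota> (m * m') = ?\<iota> m * ?\<iota> m'" .
    have "?\<iota> (m\<^sup>\<dagger>) = \<theta> (w\<^sup>\<dagger> * x\<^sup>\<dagger> * \<theta> (a\<^sup>\<dagger>)) * x"
      using a by (simp only: extension_adj coefficient N.times N.adj wx \<theta>_simps(1))
    also have "\<dots> = \<theta> (w\<^sup>\<dagger>) * \<theta> (x\<^sup>\<dagger>) * (\<theta> (\<theta> (a\<^sup>\<dagger>)) * x)"
      using a by (simp add: mult.assoc)
    also have "\<theta> (\<theta> (a\<^sup>\<dagger>)) * x = x * \<theta> (a\<^sup>\<dagger>)" using a by (simp only: x_int N.adj)
    also have "\<theta> (w\<^sup>\<dagger>) * \<theta> (x\<^sup>\<dagger>) * (x * \<theta> (a\<^sup>\<dagger>)) = \<theta> (w\<^sup>\<dagger>) * (\<theta> (x\<^sup>\<dagger>) * x) * \<theta> (a\<^sup>\<dagger>)"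
      by (simp only: mult.assoc)
    also have "\<dots> = (\<theta> (w\<^sup>\<dagger>) * x) * x\<^sup>\<dagger> * \<theta> (a\<^sup>\<dagger>)" by (simp only: frobenius mult.assoc)
    also have "\<dots> = (?\<iota> m)\<^sup>\<dagger>" using a by (simp only: unit_right mult_1_left) (simp add: coefficient)
    finally show "?\<iota> (m\<^sup>\<dagger>) = (?\<iota> m)\<^sup>\<dagger>" .
  next
    fix c m assume "m \<in> M"
    then obtain a where a: "a \<in> N" "m = \<iota> a * v" by (elim extension_cases)
    then have "c *\<^sub>C m = \<iota> (c *\<^sub>C a) * v" by (simp add: \<iota>_simps scaleC_bop_times_left)
    then show "?\<iota> (c *\<^sub>C m) = c *\<^sub>C ?\<iota> m" using a by (simp add: coefficient scaleC_bop_times_left)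
  next
    have "?\<iota> 1 = \<theta> (w\<^sup>\<dagger>) * x" by (subst v_rules(5)[symmetric]) (simp only: coefficient N.adj wx)
    then show "?\<iota> 1 = 1" by (simp only: unit_right)
  qed
  assume "m \<in> M" and 0: "?\<iota> m = 0"
  then obtain a where a: "a \<in> N" "m = \<iota> a * v" by (elim extension_cases)
  have "a * (w\<^sup>\<dagger> * x) = w\<^sup>\<dagger> * (\<theta> a * x)" using a by (simp add: w_adj_int[THEN reassoc] mult.assoc)
  also have "\<dots> = 0" using 0 a by (simp add: coefficient)
  finally have "a = 0" by (simp add: unit_left)
  then have "\<iota> a = 0" using \<iota>_simps(4)[of 0 0] N.zero by (simp add: scaleC_bop_zero)
  then show "m = 0" by (simp add: a)
qed

lemma canonical_endomorphism: "star_hom M M (\<lambda>m. \<iota> (\<theta> (coefficient m) * x))"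
  by (rule star_hom_compose[OF conjugate_embedding(1)]) (use ext in \<open>simp add: extension_def\<close>)

end

text \<open>Products, adjoints and the unit are expressed by the coefficients through
  \<open>\<theta>\<close>, \<open>w\<close> and \<open>x\<close> alone, so matching coefficients is
  an isomorphism.\<close>

lemma extension_isomorphic:
  fixes M :: "'k::chilbert_space bop set" and M' :: "'l::chilbert_space bop set"
  assumes e: "extension N \<theta> w x M \<iota> v" and e': "extension N \<theta> w x M' \<iota>' v'"
  shows "isomorphic_over N \<iota> M \<iota>' M'"
proof -
  note i = \<iota>_simps[OF e] \<iota>_simps[OF e']
  interpret M': star_algebra M' by (rule von_neumann_star_algebra[OF extension_vN[OF e']])
  define \<phi> where "\<phi> m = \<iota>' (coefficient \<iota> v m) * v'" for m
  have \<phi>: "\<phi> (\<iota> a * v) = \<iota>' a * v'" if "a \<in> N" for a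
    by (simp add: \<phi>_def coefficient[OF e] that)
  have "star_hom M M' \<phi>"
    unfolding star_hom_def
  proof (intro conjI ballI allI)
    fix m m' assume "m \<in> M" "m' \<in> M"
    then obtain a b where a: "a \<in> N" "m = \<iota> a * v" and b: "b \<in> N" "m' = \<iota> b * v"
      by (elim extension_cases[OF e])
    show "\<phi> m \<in> M'" using a by (simp add: \<phi> M'.times i v_rules[OF e'])
    have "m + m' = \<iota> (a + b) * v" by (simp add: a b i distrib_right)
    then have "\<phi> (m + m') = \<iota>' (a + b) * v'" using a b by (simp only: \<phi> N.add)
    then show "\<phi> (m + m') = \<phi> m + \<phi> m'" using a b by (simp only: \<phi> i distrib_right)
    show "\<phi> (m * m') = \<phi> m * \<phi> m'"
      using a b by (simp only: extension_times[OF e] extension_times[OF e'] \<phi> N.times wx \<theta>_simps(1))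
    show "\<phi> (m\<^sup>\<dagger>) = (\<phi> m)\<^sup>\<dagger>"
      using a by (simp only: extension_adj[OF e] extension_adj[OF e'] \<phi> N.times N.adj wx \<theta>_simps(1))
  next
    fix c m assume "m \<in> M"
    then obtain a where a: "a \<in> N" "m = \<iota> a * v" by (elim extension_cases[OF e])
    then have "c *\<^sub>C m = \<iota> (c *\<^sub>C a) * v" by (simp add: i scaleC_bop_times_left)
    then have "\<phi> (c *\<^sub>C m) = \<iota>' (c *\<^sub>C a) * v'" using a by (simp only: \<phi> N.scaleC)
    then show "\<phi> (c *\<^sub>C m) = c *\<^sub>C \<phi> m" using a by (simp only: \<phi> i scaleC_bop_times_left)
  next
    show "\<phi> 1 = 1"
      by (subst v_rules(5)[OF e, symmetric]) (simp only: \<phi> N.adj wx v_rules(5)[OF e'])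
  qed
  moreover have "bij_betw \<phi> M M'"
    unfolding bij_betw_def
  proof
    show "inj_on \<phi> M"
    proof (rule inj_onI)
      fix m m' assume "m \<in> M" "m' \<in> M" and eq: "\<phi> m = \<phi> m'"
      then obtain a b where a: "a \<in> N" "m = \<iota> a * v" and b: "b \<in> N" "m' = \<iota> b * v"
        by (elim extension_cases[OF e])
      then show "m = m'" using eq extension_unique[OF e', of a b] by (simp add: \<phi>)
    qed
    show "\<phi> ` M = M'"
    proof
      show "\<phi> ` M \<subseteq> M'" using \<open>star_hom M M' \<phi>\<close> by (auto simp: star_hom_def)
      show "M' \<subseteq> \<phi> ` M"
      proof
        fix m' assume "m' \<in> M'"
        then obtain a where a: "a \<in> N" "m' = \<iota>' a * v'" by (elim extension_cases[OF e'])
        interpret M: star_algebra M by (rule von_neumann_star_algebra[OF extension_vN[OF e]])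
        have "\<iota> a * v \<in> M" using a by (simp add: M.times i v_rules[OF e])
        then show "m' \<in> \<phi> ` M" using a \<phi> by (metis image_eqI)
      qed
    qed
  qed
  moreover have "\<phi> (\<iota> a) = \<iota>' a" if "a \<in> N" for a
    using that by (subst (1) extension_embed[OF e], assumption)
      (simp only: \<phi> N.times N.adj wx extension_embed[OF e', symmetric])
  ultimately show ?thesis unfolding isomorphic_over_def by blast
qed

text \<open>Normalising the Frobenius algebra changes neither \<open>M\<close> nor
  \<open>\<iota>\<close>: the generator is multiplied by the invertible factor
  \<open>c *\<^sub>R \<iota> k\<close>, and coefficients by \<open>h\<close> on the right, up to the
  scalar \<open>1 / c\<close>.\<close>

lemma normalised_extension:
  assumes e: "extension N \<theta> w x M \<iota> v" and c: "c * c' = 1"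
  shows "extension N \<theta> (complex_of_real c' *\<^sub>C (h * w)) (complex_of_real c *\<^sub>C (k * \<theta> k * x * h))
    M \<iota> (complex_of_real c *\<^sub>C (\<iota> k * v))"
proof -
  note i = \<iota>_simps[OF e] and V = v_rules[OF e]
  interpret M: star_algebra M by (rule von_neumann_star_algebra[OF extension_vN[OF e]])
  have \<iota>_scaleR: "\<iota> (s *\<^sub>R a) = s *\<^sub>R \<iota> a" if "a \<in> N" for s a using that by (simp add: scaleR_bop_def i)
  have c': "c \<noteq> 0" "c' * c = 1" using c by (auto simp: mult.commute)
  note hk = h_rules
  have [simp]: "h \<in> N" "k \<in> N" by (rule hk)+
  define m where "m = k * k"
  let ?x = "k * \<theta> k * x * h"
  have ext: "\<iota> a * (\<iota> k * v) = \<iota> (a * k) * v" if "a \<in> N" for a using that by (simp add: i mult.assoc)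
  show ?thesis
    unfolding extension_def scaleR_bop_def[symmetric]
  proof (intro conjI ballI)
    show "von_neumann_algebra M" by (rule extension_vN[OF e])
    show "star_hom N M \<iota>" using e by (simp add: extension_def)
    show "c *\<^sub>R (\<iota> k * v) \<in> M" by (simp add: M.scaleR M.times i V)
    show "\<exists>!a. a \<in> N \<and> m = \<iota> a * c *\<^sub>R (\<iota> k * v)" if m: "m \<in> M" for m
    proof -
      obtain b where b: "b \<in> N" "m = \<iota> b * v" using m by (elim extension_cases[OF e])
      show ?thesis
      proof (rule ex1I[of _ "(1 / c) *\<^sub>R (b * h)"])
        show "(1 / c) *\<^sub>R (b * h) \<in> N \<and> m = \<iota> ((1 / c) *\<^sub>R (b * h)) * c *\<^sub>R (\<iota> k * v)"
          using b c' by (simp add: \<iota>_scaleR ext del: i(2)) (simp add: mult.assoc hk)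
        fix a assume a: "a \<in> N \<and> m = \<iota> a * c *\<^sub>R (\<iota> k * v)"
        then have "m = \<iota> (c *\<^sub>R (a * k)) * v" by (simp add: \<iota>_scaleR ext del: i(2))
        then have "b = c *\<^sub>R (a * k)" using a b by (intro extension_unique[OF e]) auto
        then show "a = (1 / c) *\<^sub>R (b * h)" using c' by (simp add: mult.assoc hk)
      qed
    qed
    show "c *\<^sub>R (\<iota> k * v) * \<iota> a = \<iota> (\<theta> a) * c *\<^sub>R (\<iota> k * v)" if a: "a \<in> N" for a
    proof -
      have "\<iota> k * v * \<iota> a = \<iota> (k * \<theta> a) * v" using a by (simp add: V i mult.assoc)
      then show ?thesis using a by (simp add: hk ext del: i(2))
    qed
    show "c *\<^sub>R (\<iota> k * v) * c *\<^sub>R (\<iota> k * v) = \<iota> (c *\<^sub>R ?x) * c *\<^sub>R (\<iota> k * v)"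
    proof -
      have "\<iota> k * v * (\<iota> k * v) = \<iota> (k * \<theta> k * x) * v" by (rule extension_times[OF e]) simp_all
      also have "\<dots> = \<iota> ?x * (\<iota> k * v)" by (simp only: ext N.times wx \<theta>_simps(1) \<open>h \<in> N\<close> \<open>k \<in> N\<close>)
          (simp add: mult.assoc hk)
      finally show ?thesis by (simp add: \<iota>_scaleR)
    qed
    show "1 = \<iota> ((c' *\<^sub>R (h * w))\<^sup>\<dagger>) * c *\<^sub>R (\<iota> k * v)"
    proof -
      have "\<iota> ((h * w)\<^sup>\<dagger>) * (\<iota> k * v) = \<iota> ((h * w)\<^sup>\<dagger> * k) * v" by (rule ext) simp
      also have "(h * w)\<^sup>\<dagger> * k = w\<^sup>\<dagger>" by (simp add: mult.assoc hk)
      finally have *: "\<iota> ((h * w)\<^sup>\<dagger>) * (\<iota> k * v) = 1" by (simp only: V)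
      have "\<iota> ((c' *\<^sub>R (h * w))\<^sup>\<dagger>) = c' *\<^sub>R \<iota> ((h * w)\<^sup>\<dagger>)" by (simp only: adj_scaleR \<iota>_scaleR N.adj N.times wx \<open>h \<in> N\<close>)
      then show ?thesis using c by (simp only: *) (simp add: * del: adj_times)
    qed
    show "(c *\<^sub>R (\<iota> k * v))\<^sup>\<dagger> = \<iota> ((c' *\<^sub>R (h * w))\<^sup>\<dagger> * (c *\<^sub>R ?x)\<^sup>\<dagger>) * c *\<^sub>R (\<iota> k * v)"
    proof -
      have sa: "(\<theta> k)\<^sup>\<dagger> = \<theta> k" using \<theta>_simps(5)[of k] by (simp only: hk(4,5))
      have nm: "n * (k * k) = 1" by (simp only: hk(3)[symmetric] mult.assoc hk(6)[THEN reassoc] hk(6) mult_1_left)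
      have nx: "n * x\<^sup>\<dagger> = x\<^sup>\<dagger> * n"
        using arg_cong[OF x_n(2), of adj] by (simp add: n_def mult.assoc)
      \<comment> \<open>The two inner factors \<open>h\<close> combine to \<open>n\<close>, which
        passes \<open>x\<^sup>\<dagger>\<close> and \<open>\<theta> k\<close> and cancels against
        \<open>k * k\<close>.\<close>
      have "(h * w)\<^sup>\<dagger> * ?x\<^sup>\<dagger> * k = w\<^sup>\<dagger> * (h * h) * x\<^sup>\<dagger> * \<theta> k * (k * k)"
        by (simp add: mult.assoc hk(2,5) sa)
      also have "\<dots> = w\<^sup>\<dagger> * (n * x\<^sup>\<dagger>) * \<theta> k * (k * k)" by (simp only: hk(3) mult.assoc)
      also have "\<dots> = w\<^sup>\<dagger> * x\<^sup>\<dagger> * (n * \<theta> k) * (k * k)" by (simp only: nx mult.assoc)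
      also have "\<dots> = w\<^sup>\<dagger> * x\<^sup>\<dagger> * \<theta> k * (n * (k * k))" by (simp only: n_int \<open>k \<in> N\<close> mult.assoc)
      finally have key: "(h * w)\<^sup>\<dagger> * ?x\<^sup>\<dagger> * k = w\<^sup>\<dagger> * x\<^sup>\<dagger> * \<theta> k" by (simp only: nm mult_1_right)
      have "(\<iota> k * v)\<^sup>\<dagger> = \<iota> (w\<^sup>\<dagger> * x\<^sup>\<dagger> * \<theta> (k\<^sup>\<dagger>)) * v" by (rule extension_adj[OF e]) simp
      also have "\<dots> = \<iota> ((h * w)\<^sup>\<dagger> * ?x\<^sup>\<dagger> * k) * v" by (simp only: key hk(5))
      also have "\<dots> = \<iota> ((h * w)\<^sup>\<dagger> * ?x\<^sup>\<dagger>) * (\<iota> k * v)" by (rule ext[symmetric]) simp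
      finally have *: "(\<iota> k * v)\<^sup>\<dagger> = \<iota> ((h * w)\<^sup>\<dagger> * ?x\<^sup>\<dagger>) * (\<iota> k * v)" .
      have "(c' *\<^sub>R (h * w))\<^sup>\<dagger> * (c *\<^sub>R ?x)\<^sup>\<dagger> = (h * w)\<^sup>\<dagger> * ?x\<^sup>\<dagger>"
        using c' by (simp only: adj_scaleR mult_scaleR_left mult_scaleR_right scaleR_scaleR c scaleR_one)
      then show ?thesis by (simp only: adj_scaleR * mult_scaleR_right)
    qed
  qed
qed

end

subsection \<open>The intermediate algebra\<close>

context frobenius_projection
begin

context
  fixes M :: "'k::chilbert_space bop set" and \<iota> :: "'a bop \<Rightarrow> 'k bop" and v :: "'k bop"
  assumes ext: "extension N \<theta> w x M \<iota> v"
begin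

definition L :: "'k bop set" where "L = {\<iota> (a * P) * v | a. a \<in> N}"

lemma L_iff: "m \<in> L \<longleftrightarrow> (\<exists>a\<in>N. a * P = a \<and> m = \<iota> a * v)"
proof
  assume "m \<in> L"
  then obtain a where "a \<in> N" "m = \<iota> (a * P) * v" by (auto simp: L_def)
  then show "\<exists>a\<in>N. a * P = a \<and> m = \<iota> a * v"
    by (intro bexI[of _ "a * P"]) (simp_all add: mult.assoc P_rules)
next
  assume "\<exists>a\<in>N. a * P = a \<and> m = \<iota> a * v"
  then show "m \<in> L" unfolding L_def by (metis (mono_tags, lifting) mem_Collect_eq)
qed

lemma L_subset: "L \<subseteq> M"
proof -
  interpret M: star_algebra M by (rule von_neumann_star_algebra[OF extension_vN[OF ext]])
  show ?thesis
    by (auto simp: L_iff M.times \<iota>_simps[OF ext] v_rules[OF ext])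
qed

lemma \<iota>_in_L: "a \<in> N \<Longrightarrow> \<iota> a \<in> L"
  unfolding L_iff using extension_embed[OF ext, of a]
  by (intro bexI[of _ "a * w\<^sup>\<dagger>"]) (simp_all add: mult.assoc w_adj_S)

text \<open>The coefficient of a product carries \<open>P\<close> on both outgoing legs of
  \<open>x\<close>, hence also on the incoming one by \<open>P_x\<close>. For adjoints
  \<open>r_adj_P\<close> moves \<open>P\<close> to the other leg, where it is absorbed.\<close>

lemma star_algebra_L: "star_algebra L"
proof
  note i = \<iota>_simps[OF ext] and V = v_rules[OF ext]
  show "1 \<in> L" using \<iota>_in_L[OF N.one] by (simp add: i)
  fix m m' assume "m \<in> L" "m' \<in> L"
  then obtain a b where a: "a \<in> N" "a * P = a" "m = \<iota> a * v" and b: "b \<in> N" "b * P = b" "m' = \<iota> b * v"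
    unfolding L_iff by blast
  show "m + m' \<in> L"
    unfolding L_iff using a b by (intro bexI[of _ "a + b"]) (simp_all add: i distrib_right)
  show "m * m' \<in> L"
    unfolding L_iff
  proof (intro bexI conjI)
    show "m * m' = \<iota> (a * \<theta> b * x) * v" by (simp only: a b extension_times[OF ext])
    have \<theta>b: "\<theta> b * \<theta> P = \<theta> b" using \<theta>_simps(2)[of b P] b by simp
    have e: "a * \<theta> b * x = a * \<theta> b * (P * \<theta> P * x)"
    proof -
      have "a * \<theta> b * x = a * (P * \<theta> b) * \<theta> P * x" using a(2) \<theta>b by (simp add: mult.assoc[symmetric]) (simp add: mult.assoc)
      also have "P * \<theta> b = \<theta> b * P" using b by (simp add: P_int)
      finally show ?thesis by (simp only: mult.assoc)
    qed
    show "a * \<theta> b * x * P = a * \<theta> b * x"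
      by (subst (1 2) e) (simp only: P_x(1) mult.assoc[of "a * \<theta> b"])
    show "a * \<theta> b * x \<in> N" using a b by simp
  qed
  show "c *\<^sub>C m \<in> L" for c
    unfolding L_iff using a by (intro bexI[of _ "c *\<^sub>C a"]) (simp_all add: i scaleC_bop_times_left)
  show "m\<^sup>\<dagger> \<in> L"
    unfolding L_iff
  proof (intro bexI conjI)
    show "m\<^sup>\<dagger> = \<iota> (w\<^sup>\<dagger> * x\<^sup>\<dagger> * \<theta> (a\<^sup>\<dagger>)) * v" using a by (simp only: extension_adj[OF ext])
    have "P * a\<^sup>\<dagger> = a\<^sup>\<dagger>" using arg_cong[OF a(2), of adj] by (simp add: P_rules)
    then have Pa: "\<theta> P * \<theta> (a\<^sup>\<dagger>) = \<theta> (a\<^sup>\<dagger>)" using \<theta>_simps(2)[of P "a\<^sup>\<dagger>"] a by simp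
    have "r\<^sup>\<dagger> * \<theta> (a\<^sup>\<dagger>) * P = r\<^sup>\<dagger> * (P * \<theta> (a\<^sup>\<dagger>))" using a by (simp only: P_int N.adj mult.assoc)
    also have "\<dots> = r\<^sup>\<dagger> * \<theta> P * \<theta> (a\<^sup>\<dagger>)" by (simp only: r_adj_P mult.assoc)
    also have "\<dots> = r\<^sup>\<dagger> * \<theta> (a\<^sup>\<dagger>)" by (simp only: Pa mult.assoc)
    finally show "w\<^sup>\<dagger> * x\<^sup>\<dagger> * \<theta> (a\<^sup>\<dagger>) * P = w\<^sup>\<dagger> * x\<^sup>\<dagger> * \<theta> (a\<^sup>\<dagger>)" by (simp add: r_def)
    show "w\<^sup>\<dagger> * x\<^sup>\<dagger> * \<theta> (a\<^sup>\<dagger>) \<in> N" using a by simp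
  qed
qed

text \<open>The criterion is applied with \<open>\<gamma>\<close> the canonical endomorphism,
  \<open>t = \<iota> P * v\<close> and \<open>u = \<iota> (w\<^sup>\<dagger>)\<close>. The resulting
  projection of \<open>M\<close> onto \<open>L\<close> sends \<open>\<iota> a * v\<close> to
  \<open>\<iota> (a * P) * v\<close>.\<close>

lemma von_neumann_L:
  assumes sep: "separable_space (euclidean :: 'a topology)"
  shows "von_neumann_algebra L"
proof -
  note i = \<iota>_simps[OF ext] and V = v_rules[OF ext]
  note M = extension_vN[OF ext]
  interpret M: star_algebra M by (rule von_neumann_star_algebra[OF M])
  let ?c = "coefficient \<iota> v"
  define \<gamma> where "\<gamma> m = \<iota> (\<theta> (?c m) * x)" for m
  have \<gamma>: "\<gamma> (\<iota> a * v) = \<iota> (\<theta> a * x)" if "a \<in> N" for a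
    using that by (simp only: \<gamma>_def coefficient[OF ext])
  obtain \<xi> where \<xi>: "separating_sequence M \<xi>"
    using separating_sequence_exists[OF sep M conjugate_embedding[OF ext]] by blast
  have \<iota>v_times: "\<iota> a * (\<iota> b * v) = \<iota> (a * b) * v" if "a \<in> N" "b \<in> N" for a b
    using that by (simp add: i mult.assoc)
  show ?thesis
  proof (rule von_neumann_subalgebra[OF M \<xi> star_algebra_L L_subset])
    show "star_hom M M \<gamma>" unfolding \<gamma>_def by (rule canonical_endomorphism[OF ext])
    show "\<iota> P * v \<in> M" by (simp add: M.times i V)
    show "\<iota> (w\<^sup>\<dagger>) \<in> M" by (rule i) simp
    show "\<iota> (w\<^sup>\<dagger>) * (\<iota> P * v) = 1"
      by (simp only: \<iota>v_times N.adj wx P_N w_adj_S V)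
    show "v\<^sup>\<dagger> * (\<iota> P * v) = (\<iota> P * v)\<^sup>\<dagger> * (\<iota> P * v)"
    proof -
      have "(\<iota> P * v)\<^sup>\<dagger> = v\<^sup>\<dagger> * \<iota> P" using i(5)[of P] by (simp add: P_rules)
      then have "(\<iota> P * v)\<^sup>\<dagger> * (\<iota> P * v) = v\<^sup>\<dagger> * (\<iota> P * (\<iota> P * v))" by (simp only: mult.assoc)
      then show ?thesis by (simp only: \<iota>v_times P_N P_rules)
    qed
    show "\<gamma> m * (\<iota> P * v) = \<iota> P * v * m" if m: "m \<in> L" for m
    proof -
      obtain a where a: "a \<in> N" "a * P = a" "m = \<iota> a * v" using m unfolding L_iff by blast
      have \<theta>a: "\<theta> a = \<theta> a * \<theta> P" using \<theta>_simps(2)[of a P] a by simp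
      have "\<gamma> m * (\<iota> P * v) = \<iota> (\<theta> a * x * P) * v"
        using a by (simp only: \<gamma> \<iota>v_times N.times wx P_N \<theta>_simps(1))
      also have "\<theta> a * x * P = \<theta> a * (\<theta> P * x * P)" by (subst \<theta>a) (simp only: mult.assoc)
      also have "\<dots> = \<theta> a * P * \<theta> P * x" by (simp only: P_x(3)) (simp only: mult.assoc)
      also have "\<theta> a * P = P * \<theta> a" using a by (simp only: P_int)
      also have "P * \<theta> a * \<theta> P * x = P * \<theta> a * x" by (subst (2) \<theta>a) (simp only: mult.assoc)
      also have "\<iota> (P * \<theta> a * x) * v = \<iota> P * v * m"
        using a by (simp only: extension_times[OF ext] P_N)
      finally show ?thesis .
    qed
    show "v * m = \<gamma> m * v" if m: "m \<in> M" for m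
    proof -
      obtain a where a: "a \<in> N" "m = \<iota> a * v" using m by (elim extension_cases[OF ext])
      have "v * m = (v * \<iota> a) * v" by (simp only: a mult.assoc)
      also have "\<dots> = \<iota> (\<theta> a) * (v * v)" using a by (simp only: V mult.assoc)
      also have "\<dots> = \<gamma> m * v" using a by (simp only: V(3) \<gamma> \<iota>v_times wx \<theta>_simps(1))
      finally show ?thesis .
    qed
    show "\<iota> (w\<^sup>\<dagger>) * \<gamma> m * (\<iota> P * v) \<in> L" if m: "m \<in> M" for m
    proof -
      obtain a where a: "a \<in> N" "m = \<iota> a * v" using m by (elim extension_cases[OF ext])
      have "\<iota> (w\<^sup>\<dagger>) * \<gamma> m * (\<iota> P * v) = \<iota> (w\<^sup>\<dagger> * (\<theta> a * x * P)) * v"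
        using a by (simp only: \<gamma> mult.assoc[of "\<iota> (w\<^sup>\<dagger>)"] \<iota>v_times N.times N.adj wx P_N \<theta>_simps(1))
      also have "w\<^sup>\<dagger> * (\<theta> a * x * P) = a * P"
        using a by (simp add: mult.assoc w_adj_int[THEN reassoc] unit_left[THEN reassoc])
      finally show ?thesis using a by (auto simp: L_def)
    qed
    show "(\<iota> P * v)\<^sup>\<dagger> * \<gamma> m * (\<iota> P * v) \<in> L" if m: "m \<in> M" for m
    proof -
      obtain a where a: "a \<in> N" "m = \<iota> a * v" using m by (elim extension_cases[OF ext])
      define b where "b = w\<^sup>\<dagger> * x\<^sup>\<dagger> * \<theta> P * \<theta> (\<theta> a * x * P) * x"
      have bN: "b \<in> N" using a by (simp add: b_def)
      have "(\<iota> P * v)\<^sup>\<dagger> * \<gamma> m * (\<iota> P * v) = (\<iota> (w\<^sup>\<dagger> * x\<^sup>\<dagger> * \<theta> P) * v) * (\<iota> (\<theta> a * x * P) * v)"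
        using a by (simp only: extension_adj[OF ext] P_N P_rules \<gamma> mult.assoc[of "_ * v"] \<iota>v_times
            N.times wx \<theta>_simps(1))
      also have "\<dots> = \<iota> b * v"
        using a by (simp only: extension_times[OF ext] b_def N.times N.adj wx P_N \<theta>_simps(1))
      finally have eq: "(\<iota> P * v)\<^sup>\<dagger> * \<gamma> m * (\<iota> P * v) = \<iota> b * v" .
      have "b = r\<^sup>\<dagger> * \<theta> P * \<theta> (\<theta> a * x * P) * x" by (simp add: b_def r_def)
      also have "\<dots> = r\<^sup>\<dagger> * (P * \<theta> (\<theta> a * x * P)) * x" by (simp only: r_adj_P mult.assoc)
      also have "P * \<theta> (\<theta> a * x * P) = \<theta> (\<theta> a * x * P) * P" using a by (simp add: P_int del: \<theta>_simps(2))
      also have "r\<^sup>\<dagger> * (\<theta> (\<theta> a * x * P) * P) * x = r\<^sup>\<dagger> * \<theta> (\<theta> a * x) * \<theta> P * P * x"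
        using a by (simp add: mult.assoc)
      also have "\<dots> = r\<^sup>\<dagger> * \<theta> (\<theta> a * x) * (P * \<theta> P * x)"
        by (simp only: P_int[OF P_N, symmetric] mult.assoc)
      finally have b: "b = r\<^sup>\<dagger> * \<theta> (\<theta> a * x) * (P * \<theta> P * x)" .
      have "b * P = r\<^sup>\<dagger> * \<theta> (\<theta> a * x) * (P * \<theta> P * x * P)" unfolding b by (simp only: mult.assoc)
      then have "b * P = b" by (simp only: P_x(1) b)
      then show ?thesis unfolding eq L_iff using bN by blast
    qed
  qed
qed

text \<open>With the generator \<open>\<iota> (S\<^sup>\<dagger>) * v\<close>, an element of
  \<open>L\<close> with coefficient \<open>b = b * P\<close> acquires the coefficient
  \<open>b * S\<close>; multiplying by \<open>S\<^sup>\<dagger>\<close> inverts this.\<close>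

lemma compressed_extension:
  assumes L: "von_neumann_algebra L"
  shows "extension N \<theta>\<^sub>P W X L \<iota> (\<iota> (S\<^sup>\<dagger>) * v)"
proof -
  note i = \<iota>_simps[OF ext] and V = v_rules[OF ext]
  have \<iota>v_times: "\<iota> a * (\<iota> b * v) = \<iota> (a * b) * v" if "a \<in> N" "b \<in> N" for a b
    using that by (simp add: i mult.assoc)
  show ?thesis
    unfolding extension_def
  proof (intro conjI ballI)
    show "von_neumann_algebra L" by (rule L)
    show "star_hom N L \<iota>" using \<iota>_in_L i by (auto simp: star_hom_def)
    show "\<iota> (S\<^sup>\<dagger>) * v \<in> L" unfolding L_iff by (intro bexI[of _ "S\<^sup>\<dagger>"]) (simp_all add: S_rules)
    show "\<exists>!a. a \<in> N \<and> m = \<iota> a * (\<iota> (S\<^sup>\<dagger>) * v)" if m: "m \<in> L" for m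
    proof -
      obtain b where b: "b \<in> N" "b * P = b" "m = \<iota> b * v" using m unfolding L_iff by blast
      show ?thesis
      proof (rule ex1I[of _ "b * S"])
        have "m = \<iota> (b * S * S\<^sup>\<dagger>) * v" by (simp only: b mult.assoc S_P)
        then show "b * S \<in> N \<and> m = \<iota> (b * S) * (\<iota> (S\<^sup>\<dagger>) * v)"
          using b by (simp only: \<iota>v_times N.times N.adj S_N simp_thms)
        fix a assume a: "a \<in> N \<and> m = \<iota> a * (\<iota> (S\<^sup>\<dagger>) * v)"
        then have "\<iota> (a * S\<^sup>\<dagger>) * v = \<iota> b * v" using b by (simp only: \<iota>v_times N.adj S_N)
        then have "a * S\<^sup>\<dagger> = b" using a b by (intro extension_unique[OF ext]) auto
        then show "a = b * S" by (auto simp: mult.assoc S_isometry)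
      qed
    qed
    show "\<iota> (S\<^sup>\<dagger>) * v * \<iota> a = \<iota> (\<theta>\<^sub>P a) * (\<iota> (S\<^sup>\<dagger>) * v)" if a: "a \<in> N" for a
    proof -
      have "\<iota> (S\<^sup>\<dagger>) * v * \<iota> a = \<iota> (S\<^sup>\<dagger>) * (\<iota> (\<theta> a) * v)" using a by (simp only: V mult.assoc)
      also have "\<dots> = \<iota> (\<theta>\<^sub>P a * S\<^sup>\<dagger>) * v"
        using a by (simp only: \<iota>v_times N.adj S_N \<theta>_simps(1) S_adj_int)
      finally show ?thesis using a by (simp only: \<iota>v_times N.adj S_N \<theta>\<^sub>P_N)
    qed
    show "\<iota> (S\<^sup>\<dagger>) * v * (\<iota> (S\<^sup>\<dagger>) * v) = \<iota> X * (\<iota> (S\<^sup>\<dagger>) * v)"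
      by (simp only: extension_times[OF ext] \<iota>v_times N.adj S_N WX_N X_S_adj)
    show "(\<iota> (S\<^sup>\<dagger>) * v)\<^sup>\<dagger> = \<iota> (W\<^sup>\<dagger> * X\<^sup>\<dagger>) * (\<iota> (S\<^sup>\<dagger>) * v)"
    proof -
      have "W\<^sup>\<dagger> * X\<^sup>\<dagger> * S\<^sup>\<dagger> = w\<^sup>\<dagger> * P * x\<^sup>\<dagger> * \<theta> S * P"
        by (simp add: W_def X_def mult.assoc S_P S_P[THEN reassoc])
      also have "\<dots> = r\<^sup>\<dagger> * (\<theta> S * P)" by (simp add: w_adj_S r_def mult.assoc)
      also have "\<theta> S * P = P * \<theta> S" by (simp only: P_int S_N)
      also have "r\<^sup>\<dagger> * (P * \<theta> S) = r\<^sup>\<dagger> * \<theta> P * \<theta> S" by (simp only: r_adj_P mult.assoc)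
      also have "\<dots> = w\<^sup>\<dagger> * x\<^sup>\<dagger> * \<theta> S" by (simp only: S_rules mult.assoc) (simp add: r_def mult.assoc)
      finally have *: "W\<^sup>\<dagger> * X\<^sup>\<dagger> * S\<^sup>\<dagger> = w\<^sup>\<dagger> * x\<^sup>\<dagger> * \<theta> ((S\<^sup>\<dagger>)\<^sup>\<dagger>)" by (simp only: adj_adj)
      show ?thesis
        by (simp only: extension_adj[OF ext] \<iota>v_times N.adj N.times S_N WX_N *)
    qed
    show "1 = \<iota> (W\<^sup>\<dagger>) * (\<iota> (S\<^sup>\<dagger>) * v)"
    proof -
      have "W\<^sup>\<dagger> * S\<^sup>\<dagger> = w\<^sup>\<dagger>" by (simp add: W_def mult.assoc S_P w_adj_S)
      then show ?thesis by (simp only: \<iota>v_times N.adj S_N WX_N V)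
    qed
  qed
qed

end

end

section \<open>The compressed Q-system and its extension\<close>

theorem proposition4p11:
  fixes N :: "'h::chilbert_space bop set" and C :: "('h bop \<Rightarrow> 'h bop) set"
    and \<theta> \<theta>\<^sub>P :: "'h bop \<Rightarrow> 'h bop" and w x P S n\<^sub>P w\<^sub>P x\<^sub>P :: "'h bop"
    and M L\<^sub>P :: "'k::chilbert_space bop set" and \<iota> :: "'h bop \<Rightarrow> 'k bop" and v :: "'k bop"
  assumes "separable_space (euclidean :: 'h topology)"
    and "type_III_factor N"
    and "full_tensor_subcategory N C"
    and "Q_system N C \<theta> w x"
    and "extension N \<theta> w x M \<iota> v"
    and "hom_dim N M \<iota> = Q_dim N \<theta>"
    and "P \<in> Hom N N \<theta> \<theta>" and "projection P"
    and "(P \<times>\<^bsub>\<theta>\<^esub> P) * x = (P \<times>\<^bsub>\<theta>\<^esub> 1) * x * P"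
    and "(P \<times>\<^bsub>\<theta>\<^esub> 1) * x * P = (1 \<times>\<^bsub>\<theta>\<^esub> P) * x * P"
    and "P * w = w"
    and "S \<in> N" and "isometry S" and "S * S\<^sup>\<dagger> = P"
    and "\<theta>\<^sub>P = (\<lambda>n. S\<^sup>\<dagger> * \<theta> n * S)"
    and "n\<^sub>P = S\<^sup>\<dagger> * x\<^sup>\<dagger> * (P \<times>\<^bsub>\<theta>\<^esub> P) * x * S"
    and "w\<^sub>P = complex_of_real (hom_dim N N \<theta>\<^sub>P powr (- 1 / 4)) *\<^sub>C (sqrt_bop n\<^sub>P * S\<^sup>\<dagger> * w)"
    and "x\<^sub>P = complex_of_real (hom_dim N N \<theta>\<^sub>P powr (1 / 4)) *\<^sub>C
           (((inv_bop (sqrt_bop n\<^sub>P) * S\<^sup>\<dagger>) \<times>\<^bsub>\<theta>\<^esub> (inv_bop (sqrt_bop n\<^sub>P) * S\<^sup>\<dagger>)) * x * S * sqrt_bop n\<^sub>P)"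
    and "L\<^sub>P = {\<iota> (n * P) * v | n. n \<in> N}"
  shows "n\<^sub>P \<in> Hom N N \<theta>\<^sub>P \<theta>\<^sub>P \<and> positive_bop n\<^sub>P \<and> invertible_bop n\<^sub>P \<and>
    Q_system N C \<theta>\<^sub>P w\<^sub>P x\<^sub>P \<and>
    von_neumann_algebra L\<^sub>P \<and> \<iota> ` N \<subseteq> L\<^sub>P \<and> L\<^sub>P \<subseteq> M \<and>
    (\<exists>(M' :: 'k bop set) \<iota>' v'. extension N \<theta>\<^sub>P w\<^sub>P x\<^sub>P M' \<iota>' v' \<and> isomorphic_over N \<iota>' M' \<iota> L\<^sub>P) \<and>
    (\<forall>(M' :: 'l::chilbert_space bop set) \<iota>' v'.
       extension N \<theta>\<^sub>P w\<^sub>P x\<^sub>P M' \<iota>' v' \<longrightarrow> isomorphic_over N \<iota>' M' \<iota> L\<^sub>P)"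
proof -
  have N: "factor N" using assms(2) unfolding type_III_factor_def by (rule conjunct1)
  then have vN: "von_neumann_algebra N" unfolding factor_def by (rule conjunct1)
  have \<theta>C: "\<theta> \<in> C" using assms(4) by (simp add: Q_system_def)
  have "C \<subseteq> End0 N" using assms(3) unfolding full_tensor_subcategory_def by (rule conjunct1)
  then have "\<theta> \<in> End0 N" using \<theta>C by (rule subsetD)
  then have \<theta>: "star_hom N N \<theta>" "conjugate_dims N N \<theta> \<noteq> {}" by (auto simp: End0_def)
  interpret frobenius_algebra N \<theta> w x by (rule Q_system_frobenius_algebra[OF vN \<theta>(1) assms(4)])
  interpret F: frobenius_projection N \<theta> w x P S
    by unfold_locales (use assms(7-14) in \<open>auto simp: mtimes_def isometry_def\<close>)
  have \<theta>\<^sub>P: "\<theta>\<^sub>P = F.\<theta>\<^sub>P" by (simp add: assms(15) F.\<theta>\<^sub>P_def)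
  have n\<^sub>P: "n\<^sub>P = F.compressed.n" by (simp only: assms(16) F.compressed_n mtimes_def)
  have L\<^sub>P: "L\<^sub>P = F.L \<iota> v" by (simp only: assms(19) F.L_def[OF assms(5)])

  let ?q = "Q_dim N \<theta>"
  have "x\<^sup>\<dagger> * x = ?q *\<^sub>R 1" "w\<^sup>\<dagger> * w = ?q *\<^sub>R 1"
    using assms(4) by (simp_all add: Q_system_def scaleR_bop_def)
  \<comment> \<open>The Q-system normalisations of \<open>w\<close> and \<open>x\<close> multiply to
    the dimension of \<open>\<theta>\<close>, so \<open>r\<close> attains the infimum and the
    variational argument applies.\<close>
  then have "r\<^sup>\<dagger> * r = (?q * ?q) *\<^sub>R 1" by (simp add: r_adj_r n_def)
  also have "?q * ?q = hom_dim N N \<theta>" using hom_dim_nonneg[OF N \<theta>(2)] by (simp add: Q_dim_def)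
  finally have "r\<^sup>\<dagger> * r = complex_of_real (hom_dim N N \<theta>) *\<^sub>C 1" by (simp only: scaleR_bop_def)
  note spherical = F.compressed_spherical[OF minimal_imp_spherical[OF N this]]
  obtain d where d: "d > 0" "F.compressed.r\<^sup>\<dagger> * F.compressed.r = complex_of_real d *\<^sub>C 1"
    using F.compressed.dimension_exists[OF N] by blast
  have dim: "hom_dim N N F.\<theta>\<^sub>P = d"
    by (rule F.compressed.spherical_imp_minimal[OF N d(2)]) (rule spherical)

  \<comment> \<open>The isometry \<open>S\<close> exhibits the compression as a subobject of
    \<open>\<theta>\<close>.\<close>
  have "S \<in> Hom N N F.\<theta>\<^sub>P \<theta>" by (simp add: Hom_def F.S_int)
  then have \<theta>\<^sub>PC: "F.\<theta>\<^sub>P \<in> C"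
    using assms(3,13) \<theta>C F.\<theta>\<^sub>P_hom unfolding full_tensor_subcategory_def by blast
  have w\<^sub>P: "w\<^sub>P = complex_of_real (d powr (- 1 / 4)) *\<^sub>C (F.compressed.h * F.W)"
    by (simp only: assms(17) \<theta>\<^sub>P n\<^sub>P dim F.W_def F.compressed.h_def mult.assoc)
  have x\<^sub>P: "x\<^sub>P = complex_of_real (d powr (1 / 4)) *\<^sub>C
      (F.compressed.k * F.\<theta>\<^sub>P F.compressed.k * F.X * F.compressed.h)"
  proof -
    define h k where hk: "h = F.compressed.h" "k = F.compressed.k"
    have sqrt: "sqrt_bop n\<^sub>P = h" "inv_bop h = k"
      by (simp_all only: n\<^sub>P hk F.compressed.h_def F.compressed.k_def)
    have k: "k \<in> N" unfolding hk by (rule F.compressed.h_rules(4))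
    \<comment> \<open>Moving \<open>S\<^sup>\<dagger>\<close> across \<open>\<theta> k\<close> turns
      the monoidal product over \<open>\<theta>\<close> in the statement into one over
      \<open>\<theta>\<^sub>P\<close> applied to \<open>X\<close>.\<close>
    have "k * S\<^sup>\<dagger> * \<theta> (k * S\<^sup>\<dagger>) * x * S * h = k * (S\<^sup>\<dagger> * \<theta> k) * \<theta> (S\<^sup>\<dagger>) * x * S * h"
      using k by (simp add: mult.assoc)
    also have "S\<^sup>\<dagger> * \<theta> k = F.\<theta>\<^sub>P k * S\<^sup>\<dagger>" by (rule F.S_adj_int[OF k])
    also have "k * (F.\<theta>\<^sub>P k * S\<^sup>\<dagger>) * \<theta> (S\<^sup>\<dagger>) * x * S * h = k * F.\<theta>\<^sub>P k * F.X * h"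
      by (simp only: F.X_def mult.assoc)
    finally show ?thesis
      by (simp only: assms(18) \<theta>\<^sub>P dim sqrt mtimes_def hk[symmetric])
  qed
  have Q: "Q_system N C \<theta>\<^sub>P w\<^sub>P x\<^sub>P"
    unfolding \<theta>\<^sub>P w\<^sub>P x\<^sub>P by (rule F.compressed.normalised_Q_system[OF \<theta>\<^sub>PC dim[symmetric] d])
  have vL: "von_neumann_algebra L\<^sub>P" unfolding L\<^sub>P by (rule F.von_neumann_L[OF assms(5,1)])
  have "d powr (1 / 4) * d powr (- 1 / 4) = 1" using d(1) by (simp flip: powr_add)
  then have "\<exists>v'. extension N \<theta>\<^sub>P w\<^sub>P x\<^sub>P L\<^sub>P \<iota> v'"
    unfolding \<theta>\<^sub>P w\<^sub>P x\<^sub>P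
    using F.compressed.normalised_extension[OF F.compressed_extension[OF assms(5) vL[unfolded L\<^sub>P]]]
    unfolding L\<^sub>P by blast
  then obtain v' where v': "extension N \<theta>\<^sub>P w\<^sub>P x\<^sub>P L\<^sub>P \<iota> v'" by blast
  interpret A: frobenius_algebra N \<theta>\<^sub>P w\<^sub>P x\<^sub>P
    by (rule Q_system_frobenius_algebra[OF vN _ Q]) (simp add: \<theta>\<^sub>P F.\<theta>\<^sub>P_hom)
  have "n\<^sub>P \<in> Hom N N \<theta>\<^sub>P \<theta>\<^sub>P"
    unfolding n\<^sub>P \<theta>\<^sub>P by (simp add: Hom_def F.compressed.n_int)
  moreover have "positive_bop n\<^sub>P" "invertible_bop n\<^sub>P"
    using coercive_positive[OF F.compressed.n_coercive] coercive_invertible[OF F.compressed.n_coercive]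
    unfolding n\<^sub>P invertible_bop_def by blast+
  moreover have "\<iota> ` N \<subseteq> L\<^sub>P" "L\<^sub>P \<subseteq> M"
    unfolding L\<^sub>P using F.\<iota>_in_L[OF assms(5)] F.L_subset[OF assms(5)] by blast+
  \<comment> \<open>\<open>L\<^sub>P\<close> with the inclusion \<open>\<iota>\<close> is itself an
    extension for the compressed Q-system, which settles existence; uniqueness of extensions
    compares it with every other one, on whatever Hilbert space that lives.\<close>
  ultimately show ?thesis
    using Q vL v' A.extension_isomorphic[OF v' v'] A.extension_isomorphic[OF _ v'] by blast
qed

end
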